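(* Let $n\ge1$, $\mu>0$, $2\mu+n\lambda\ge0$, $\kappa>0$, $\gamma>1$, $R>0$. Consider the full compressible Navier–Stokes system in $\mathbb{R}^n\times(0,T]$: $$\partial_t\rho+\operatorname{div}(\rho u)=0,$$ $$\partial_t(\rho u)+\operatorname{div}(\rho u\otimes u)+\nabla p=\mu\Delta u+(\mu+\lambda)\nabla\operatorname{div}u,$$ $$\partial_t(\rho e)+\operatorname{div}(\rho e u)+p\operatorname{div}u=\tfrac{\mu}{2}|\nabla u+(\nabla u)^{T}|^2+\lambda(\operatorname{div}u)^2+\tfrac{\kappa(\gamma-1)}{R}\Delta e,$$ with $p=(\gamma-1)\rho e$ and $p=\exp\big(\tfrac{(\gamma-1)S}{R}\big)\rho^\gamma$ (defining the entropy $S$), and continuous initial data $(\rho,u,e)(x,0)=(\rho_0,u_0,e_0)(x)$, where $\operatorname{supp}\rho_0=\bar\Omega$ for a bounded open set $\Omega\subset\mathbb{R}^n$ with smooth boundary, $\rho_0>0$ in $\Omega$, and $e_0\ge0$, $e_0\not\equiv0$ in $\Omega$. Then for every $T>0$ and every $m>[\frac n2]+2$ there is no solution $(\rho,u,e)\in C^1([0,T];H^m(\mathbb{R}^n))$ whose entropy $S(x,t)$ is finite at every point $(x,t)$ (in particular in the vacuum region where $\rho=0$).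
   Context: $H^m(\mathbb{R}^n)$ is the standard inhomogeneous Sobolev space; $[\cdot]$ denotes the integer part. *)

theory Defs
  imports "HOL-Analysis.Analysis"
begin

definition dx :: "'n::finite \<Rightarrow> (real^'n \<Rightarrow> real) \<Rightarrow> real^'n \<Rightarrow> real" where
  "dx i f x = deriv (\<lambda>h. f (x + h *\<^sub>R axis i 1)) 0"

fun pderivs :: "'n::finite list \<Rightarrow> (real^'n \<Rightarrow> real) \<Rightarrow> real^'n \<Rightarrow> real" where
  "pderivs [] f = f"
| "pderivs (i # is) f = dx i (pderivs is f)"

definition dt :: "real \<Rightarrow> (real \<Rightarrow> real) \<Rightarrow> real \<Rightarrow> real" where
  "dt T f t = vector_derivative f (at t within {0..T})"

definition smooth_on :: "(real^'n::finite) set \<Rightarrow> (real^'n \<Rightarrow> real) \<Rightarrow> bool" where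
  "smooth_on U f \<longleftrightarrow>
     (\<forall>is. continuous_on U (pderivs is f) \<and>
       (\<forall>i. \<forall>x\<in>U. ((\<lambda>h. pderivs is f (x + h *\<^sub>R axis i 1)) has_real_derivative
                     pderivs (i # is) f x) (at 0)))"

definition smooth_boundary :: "(real^'n::finite) set \<Rightarrow> bool" where
  "smooth_boundary \<Omega> \<longleftrightarrow>
     (\<forall>z\<in>frontier \<Omega>. \<exists>U \<psi>. open U \<and> z \<in> U \<and> smooth_on U \<psi> \<and>
        (\<forall>x\<in>U. x \<in> \<Omega> \<longleftrightarrow> \<psi> x < 0) \<and>
        (\<forall>x\<in>U. \<exists>i. dx i \<psi> x \<noteq> 0))"

definition test_fun :: "(real^'n::finite \<Rightarrow> real) \<Rightarrow> bool" where
  "test_fun \<phi> \<longleftrightarrow> smooth_on UNIV \<phi> \<and> bounded {x. \<phi> x \<noteq> 0}"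

definition L2 :: "(real^'n::finite \<Rightarrow> real) \<Rightarrow> bool" where
  "L2 f \<longleftrightarrow> f \<in> borel_measurable lborel \<and> integrable lborel (\<lambda>x. (f x)\<^sup>2)"

definition weak_deriv :: "'n::finite list \<Rightarrow> (real^'n \<Rightarrow> real) \<Rightarrow> (real^'n \<Rightarrow> real) \<Rightarrow> bool" where
  "weak_deriv is f g \<longleftrightarrow>
     (\<forall>\<phi>. test_fun \<phi> \<longrightarrow>
        (\<integral>x. f x * pderivs is \<phi> x \<partial>lborel) = (-1) ^ length is * (\<integral>x. g x * \<phi> x \<partial>lborel))"

definition sobolev :: "nat \<Rightarrow> (real^'n::finite \<Rightarrow> real) \<Rightarrow> bool" where
  "sobolev m f \<longleftrightarrow> L2 f \<and> (\<forall>is::'n list. length is \<le> m \<longrightarrow> (\<exists>g. L2 g \<and> weak_deriv is f g))"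

definition wd :: "'n::finite list \<Rightarrow> (real^'n \<Rightarrow> real) \<Rightarrow> real^'n \<Rightarrow> real" where
  "wd is f = (SOME g. L2 g \<and> weak_deriv is f g)"

text \<open>An (equivalent) H^m norm: sum over all direction lists of length at most m.\<close>
definition sob_norm :: "nat \<Rightarrow> (real^'n::finite \<Rightarrow> real) \<Rightarrow> real" where
  "sob_norm m f = sqrt (\<Sum>is\<in>{is::'n list. length is \<le> m}. \<integral>x. (wd is f x)\<^sup>2 \<partial>lborel)"

definition C1_Hm :: "nat \<Rightarrow> real \<Rightarrow> (real \<Rightarrow> real^'n::finite \<Rightarrow> real) \<Rightarrow> bool" where
  "C1_Hm m T U \<longleftrightarrow>
     (\<forall>t\<in>{0..T}. sobolev m (U t)) \<and>
     (\<exists>V. (\<forall>t\<in>{0..T}. sobolev m (V t)) \<and>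
        (\<forall>t\<in>{0..T}. ((\<lambda>s. sob_norm m (\<lambda>x. (U s x - U t x) / (s - t) - V t x)) \<longlongrightarrow> 0)
                        (at t within {0..T})) \<and>
        (\<forall>t\<in>{0..T}. ((\<lambda>s. sob_norm m (\<lambda>x. V s x - V t x)) \<longlongrightarrow> 0) (at t within {0..T})))"

definition full_NS :: "real \<Rightarrow> real \<Rightarrow> real \<Rightarrow> real \<Rightarrow> real \<Rightarrow> real \<Rightarrow>
    (real^'n::finite \<Rightarrow> real \<Rightarrow> real) \<Rightarrow> (real^'n \<Rightarrow> real \<Rightarrow> real^'n) \<Rightarrow> (real^'n \<Rightarrow> real \<Rightarrow> real) \<Rightarrow> bool" where
  "full_NS \<mu> lam \<kappa> \<gamma> R T \<rho> u e \<longleftrightarrow>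
    (\<forall>x. \<forall>t\<in>{0<..T}.
      let p = (\<lambda>y. (\<gamma> - 1) * \<rho> y t * e y t);
          divu = (\<lambda>y. \<Sum>i\<in>UNIV. dx i (\<lambda>z. u z t $ i) y)
      in
      dt T (\<lambda>s. \<rho> x s) t + (\<Sum>i\<in>UNIV. dx i (\<lambda>y. \<rho> y t * u y t $ i) x) = 0 \<and>
      (\<forall>j. dt T (\<lambda>s. \<rho> x s * u x s $ j) t
            + (\<Sum>i\<in>UNIV. dx i (\<lambda>y. \<rho> y t * u y t $ j * u y t $ i) x)
            + dx j p x
          = \<mu> * (\<Sum>i\<in>UNIV. dx i (\<lambda>y. dx i (\<lambda>z. u z t $ j) y) x)
            + (\<mu> + lam) * dx j divu x) \<and>
      dt T (\<lambda>s. \<rho> x s * e x s) t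
        + (\<Sum>i\<in>UNIV. dx i (\<lambda>y. \<rho> y t * e y t * u y t $ i) x)
        + p x * divu x
      = \<mu> / 2 * (\<Sum>i\<in>UNIV. \<Sum>j\<in>UNIV. (dx i (\<lambda>y. u y t $ j) x + dx j (\<lambda>y. u y t $ i) x)\<^sup>2)
        + lam * (divu x)\<^sup>2
        + \<kappa> * (\<gamma> - 1) / R * (\<Sum>i\<in>UNIV. dx i (\<lambda>y. dx i (\<lambda>z. e z t) y) x))"

end

theory Submission
  imports Defs
begin

text \<open>
  Finite entropy forces \<open>e = 0\<close> exactly where \<open>\<rho> = 0\<close>, and \<open>e > 0\<close> elsewhere. Vacuum persists for a
  short time near a point away from the support of \<open>\<rho>0\<close>, so an expanding ball that starts inside
  \<open>{\<rho> > 0}\<close> can be tuned to touch the vacuum for the first time at a positive time. There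
  \<open>e\<close> attains its minimum 0, so its spatial gradient vanishes; but inside the ball \<open>e\<close> is a positive
  supersolution of a (degenerate) parabolic equation, because the viscous dissipation is nonnegative,
  and a Hopf barrier bounds it below by a multiple of the distance to the boundary.

  The pointwise form of the equations requires the embedding of \<open>H^m\<close> into \<open>C^2\<close>. With
  \<open>\<eta>(y) = max 0 (1 - |y|)\<close>, averaging the Taylor expansion of \<open>t \<mapsto> f (x + t y)\<close> about \<open>t = 1\<close>
  against \<open>\<eta>\<close> expresses \<open>f\<close> through integrals
  \<open>\<integral>\<^sub>0\<^sup>1 t^p \<integral> \<eta>(y) y^\<alpha> D^\<alpha> f (x + t y) dy dt\<close> over weak derivatives; the inner one is
  \<open>O(t^(-n/2))\<close> by Cauchy-Schwarz, hence everything converges when \<open>p + 1 > n/2\<close>.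
\<close>

subsection \<open>Smooth test functions\<close>

text \<open>The averaged Taylor formula is never applied to \<open>f\<close> itself, which has only
  weak derivatives. It is proved for test functions and then transposed: Fubini and the defining
  identity of weak derivatives carry it over to \<open>f\<close>, and the fundamental lemma of the
  calculus of variations turns equal pairings into equality almost everywhere. Products of
  one-variable bumps suffice as test functions, and their partial derivatives merely shift a
  multi-index. With p = [n/2] the formula spends p + 1 derivatives; two more are wanted pointwise,
  which is the origin of m > [n/2] + 2. Since its bound depends only on the Sobolev norm, the same
  formula applied to difference quotients in time yields pointwise time derivatives and a uniform
  gradient bound.

  The obstacle in the Hopf argument is that the coefficient \<rho> of the time derivative
  degenerates at contact, so contact must be visible in space: the touching ball has radius at least
  \<open>a\<close> > 0 there, and its normal has a nonzero spatial part. Letting the ball grow is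
  what forces contact at all, since a fixed ball need never meet the vacuum.\<close>

definition flat :: "real \<Rightarrow> nat \<Rightarrow> real \<Rightarrow> real" where
  "flat c p x = (if x > 0 then exp (- c / x) / x ^ p else 0)"

lemma flat_lim:
  assumes "c > 0" shows "(flat c p \<longlongrightarrow> 0) (at 0)"
proof -
  have 1: "((\<lambda>y::real. y ^ p / exp (c * y)) \<longlongrightarrow> 0) at_top"
  proof -
    have "((\<lambda>y::real. (1/c)^p * ((c * y) ^ p / exp (c * y))) \<longlongrightarrow> (1/c)^p * 0) at_top"
      by (intro tendsto_mult_left filterlim_compose[OF tendsto_power_div_exp_0]
          filterlim_tendsto_pos_mult_at_top[OF tendsto_const _ filterlim_ident] assms)
    then show ?thesis using assms by (simp add: power_mult_distrib power_divide)
  qed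
  have 2: "((\<lambda>x::real. exp (- c / x) / x ^ p) \<longlongrightarrow> 0) (at_right 0)"
    using filterlim_compose[OF 1 filterlim_inverse_at_top_right]
    by (simp add: field_simps exp_minus)
  have 3: "(flat c p \<longlongrightarrow> 0) (at_right 0)"
    by (rule Lim_transform_eventually[OF 2])
       (auto simp: flat_def eventually_at_filter)
  have 4: "(flat c p \<longlongrightarrow> 0) (at_left 0)"
    by (rule Lim_transform_eventually[OF tendsto_const])
       (auto simp: flat_def eventually_at_filter)
  show ?thesis using 3 4 by (simp add: filterlim_split_at_real)
qed

text \<open>The power in the denominator is carried as a parameter so that the family is closed
  under differentiation up to linear combinations; all higher derivatives then follow by
  induction.\<close>

lemma flat_deriv:
  assumes c: "c > 0"
  shows "(flat c p has_real_derivative c * flat c (p + 2) x - real p * flat c (p + 1) x) (at x)"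
proof (cases x "0 :: real" rule: linorder_cases)
  case less
  have "((\<lambda>_. 0) has_real_derivative 0) (at x)" by simp
  then have "(flat c p has_real_derivative 0) (at x)"
    by (rule has_field_derivative_transform_within_open[of _ _ _ "{..<0}"]) (use less in \<open>auto simp: flat_def\<close>)
  then show ?thesis using less by (simp add: flat_def)
next
  case equal
  \<comment> \<open>The difference quotient of \<open>flat c p\<close> at 0 coincides with
    \<open>flat c (Suc p)\<close> away from 0, so \<open>flat_lim\<close> gives derivative
    0.\<close>
  have "((\<lambda>h. (flat c p (0 + h) - flat c p 0) / h) \<longlongrightarrow> 0) (at 0)"
    by (rule Lim_transform_eventually[OF flat_lim[OF c, of "Suc p"]])
       (auto simp: flat_def eventually_at_filter)
  then show ?thesis using equal by (simp add: flat_def DERIV_def)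
next
  case greater
  have "((\<lambda>x. exp (- c / x) / x ^ p) has_real_derivative
     ((exp (- c / x) * (c / x^2)) * x ^ p - exp (- c / x) * (real p * x ^ (p - 1))) / (x ^ p * x ^ p)) (at x)"
    using greater by (auto intro!: derivative_eq_intros simp: power2_eq_square)
  then have "(flat c p has_real_derivative
     ((exp (- c / x) * (c / x^2)) * x ^ p - exp (- c / x) * (real p * x ^ (p - 1))) / (x ^ p * x ^ p)) (at x)"
    by (rule has_field_derivative_transform_within_open[of _ _ _ "{0<..}"]) (use greater in \<open>auto simp: flat_def\<close>)
  moreover have "((exp (- c / x) * (c / x^2)) * x ^ p - exp (- c / x) * (real p * x ^ (p - 1))) / (x ^ p * x ^ p)
     = c * flat c (p + 2) x - real p * flat c (p + 1) x"
    using greater by (cases p) (auto simp: flat_def field_simps power2_eq_square)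
  ultimately show ?thesis by simp
qed

text \<open>A function together with all its derivatives, so that iterated differentiation is a shift
  of the index.\<close>

definition jet :: "(nat \<Rightarrow> real \<Rightarrow> real) \<Rightarrow> bool" where
  "jet b \<longleftrightarrow> (\<forall>k x. (b k has_real_derivative b (Suc k) x) (at x))"

text \<open>The linear span of all products of a flat function rising from \<open>l\<close> with one
  vanishing at \<open>u\<close>. Membership of every derivative in this span stands in for a closed
  formula: it gives both renewed differentiability and vanishing off the interval.\<close>

inductive_set bumps :: "real \<Rightarrow> real \<Rightarrow> real \<Rightarrow> (real \<Rightarrow> real) set" for c l u where
  base: "(\<lambda>x. flat c p (x - l) * flat c q (u - x)) \<in> bumps c l u"
| add: "f \<in> bumps c l u \<Longrightarrow> g \<in> bumps c l u \<Longrightarrow> (\<lambda>x. f x + g x) \<in> bumps c l u"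
| scale: "f \<in> bumps c l u \<Longrightarrow> (\<lambda>x. a * f x) \<in> bumps c l u"

lemma bumps_deriv:
  assumes c: "c > 0" and f: "f \<in> bumps c l u"
  shows "\<exists>f'\<in>bumps c l u. \<forall>x. (f has_real_derivative f' x) (at x)"
  using f
proof induction
  case (base p q)
  let ?F = "\<lambda>p q x. flat c p (x - l) * flat c q (u - x)"
  let ?f' = "\<lambda>x. (c * ?F (p+2) q x + (- real p) * ?F (p+1) q x) +
    ((- c) * ?F p (q+2) x + real q * ?F p (q+1) x)"
  have "?f' \<in> bumps c l u"
    by (intro bumps.add bumps.scale bumps.base)
  moreover have "(?F p q has_real_derivative ?f' x) (at x)" for x
  proof -
    have 1: "((\<lambda>x. flat c p (x - l)) has_real_derivative
       (c * flat c (p + 2) (x-l) - real p * flat c (p + 1) (x-l)) * 1) (at x)"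
      by (rule DERIV_chain2[OF flat_deriv[OF c]]) (auto intro!: derivative_eq_intros)
    have 2: "((\<lambda>x. flat c q (u - x)) has_real_derivative
       (c * flat c (q + 2) (u-x) - real q * flat c (q + 1) (u-x)) * (-1)) (at x)"
      by (rule DERIV_chain2[OF flat_deriv[OF c]]) (auto intro!: derivative_eq_intros)
    show ?thesis
      by (rule DERIV_cong[OF DERIV_mult[OF 1 2]]) (simp add: algebra_simps)
  qed
  ultimately show ?case by (intro bexI[of _ ?f'] allI)
next
  case (add f g)
  then obtain f' g' where "f' \<in> bumps c l u" "g' \<in> bumps c l u"
    "\<forall>x. (f has_real_derivative f' x) (at x)" "\<forall>x. (g has_real_derivative g' x) (at x)" by blast
  then show ?case
    by (intro bexI[of _ "\<lambda>x. f' x + g' x"] bumps.add allI) (auto intro: DERIV_add)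
next
  case (scale f a)
  then obtain f' where "f' \<in> bumps c l u" "\<forall>x. (f has_real_derivative f' x) (at x)" by blast
  then show ?case
    by (intro bexI[of _ "\<lambda>x. a * f' x"] bumps.scale allI) (auto intro: DERIV_cmult)
qed

lemma bumps_outside: "f \<in> bumps c l u \<Longrightarrow> x \<notin> {l<..<u} \<Longrightarrow> f x = 0"
  by (induction rule: bumps.induct) (auto simp: flat_def)

text \<open>All derivatives of one bump, indexed by order. The parameter \<open>c\<close> is left
  free because the bump tends to the indicator of the open interval from \<open>l\<close> to
  \<open>u\<close> as \<open>c\<close> tends to 0 from above.\<close>

definition bump :: "real \<Rightarrow> real \<Rightarrow> real \<Rightarrow> nat \<Rightarrow> real \<Rightarrow> real" where
  "bump c l u k = (deriv ^^ k) (\<lambda>x. flat c 0 (x - l) * flat c 0 (u - x))"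

lemma bump_in: "c > 0 \<Longrightarrow> bump c l u k \<in> bumps c l u"
proof (induction k)
  case 0 show ?case unfolding bump_def by (auto intro: bumps.base)
next
  case (Suc k)
  obtain f' where f': "f' \<in> bumps c l u" "\<forall>x. (bump c l u k has_real_derivative f' x) (at x)"
    using bumps_deriv[OF Suc(2) Suc(1)[OF Suc(2)]] by blast
  then have "deriv (bump c l u k) = f'" by (auto intro!: DERIV_imp_deriv)
  with f' show ?case by (simp add: bump_def)
qed

lemma jet_bump: assumes "c > 0" shows "jet (bump c l u)"
  unfolding jet_def
proof safe
  fix k x
  obtain f' where f': "\<forall>x. (bump c l u k has_real_derivative f' x) (at x)"
    using bumps_deriv[OF assms bump_in[OF assms]] by blast
  then have "deriv (bump c l u k) = f'" by (auto intro!: DERIV_imp_deriv)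
  with f' show "(bump c l u k has_real_derivative bump c l u (Suc k) x) (at x)"
    by (simp add: bump_def)
qed

lemma bump_outside: "c > 0 \<Longrightarrow> x \<notin> {l<..<u} \<Longrightarrow> bump c l u k x = 0"
  using bumps_outside bump_in by blast

lemma bump_0:
  "bump c l u 0 x = (if l < x \<and> x < u then exp (- c / (x - l)) * exp (- c / (u - x)) else 0)"
  by (simp add: bump_def flat_def)

section \<open>Tensor products of bumps as test functions\<close>

definition tprod :: "('n::finite \<Rightarrow> nat \<Rightarrow> real \<Rightarrow> real) \<Rightarrow> ('n \<Rightarrow> nat) \<Rightarrow> real^'n \<Rightarrow> real" where
  "tprod b c x = (\<Prod>i\<in>UNIV. b i (c i) (x $ i))"

definition tensor_test :: "('n::finite \<Rightarrow> nat \<Rightarrow> real \<Rightarrow> real) \<Rightarrow> bool" where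
  "tensor_test b \<longleftrightarrow> (\<forall>i. jet (b i)) \<and> (\<exists>l u. \<forall>i k x. x \<notin> {l<..<u} \<longrightarrow> b i k x = 0)"

lemma jet_cont: "jet b \<Longrightarrow> continuous_on A (b k)"
  by (rule DERIV_continuous_on[of _ _ "b (Suc k)"]) (auto simp: jet_def intro: has_field_derivative_at_within)

lemma tprod_cont:
  assumes "tensor_test b" shows "continuous_on A (tprod b c)"
proof -
  have "continuous_on A (\<lambda>x. b i (c i) (x $ i))" for i
    by (rule continuous_on_compose2[OF jet_cont[of "b i" UNIV]])
       (use assms in \<open>auto simp: tensor_test_def intro: continuous_on_component\<close>)
  then show ?thesis unfolding tprod_def by (intro continuous_on_prod) auto
qed

lemma tprod_line_deriv:
  assumes "tensor_test b"
  shows "((\<lambda>t. tprod b c (x + t *\<^sub>R y)) has_real_derivative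
     (\<Sum>i\<in>UNIV. y $ i * tprod b (c(i := Suc (c i))) (x + t *\<^sub>R y))) (at t)"
proof -
  have j: "jet (b i)" for i using assms by (simp add: tensor_test_def)
  have "((\<lambda>t. \<Prod>i\<in>UNIV. b i (c i) (x $ i + t * y $ i)) has_real_derivative
     (\<Sum>i\<in>UNIV. (b i (Suc (c i)) (x $ i + t * y $ i) * y $ i) *
        (\<Prod>j\<in>UNIV - {i}. b j (c j) (x $ j + t * y $ j)))) (at t)"
  proof (rule has_field_derivative_prod)
    fix i
    show "((\<lambda>t. b i (c i) (x $ i + t * y $ i)) has_real_derivative 
      b i (Suc (c i)) (x $ i + t * y $ i) * y $ i) (at t)"
      by (rule DERIV_chain2[of "b i (c i)"]) (use j in \<open>auto simp: jet_def intro!: derivative_eq_intros\<close>)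
  qed
  moreover have "(b i (Suc (c i)) (x $ i + t * y $ i) * y $ i) *
        (\<Prod>j\<in>UNIV - {i}. b j (c j) (x $ j + t * y $ j)) = y $ i * tprod b (c(i := Suc (c i))) (x + t *\<^sub>R y)" for i
    unfolding tprod_def by (subst prod.remove[of UNIV i]) (auto intro!: prod.cong)
  ultimately show ?thesis by (simp add: tprod_def)
qed

lemma tprod_partial:
  assumes "tensor_test b"
  shows "((\<lambda>h. tprod b c (x + h *\<^sub>R axis i 1)) has_real_derivative tprod b (c(i := Suc (c i))) x) (at 0)"
proof -
  have "(\<Sum>j\<in>UNIV. axis i 1 $ j * tprod b (c(j := Suc (c j))) (x + 0 *\<^sub>R axis i 1)) = 
    (\<Sum>j\<in>UNIV. if j = i then tprod b (c(j := Suc (c j))) x else 0)"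
    by (rule sum.cong) (auto simp: axis_def)
  then show ?thesis using tprod_line_deriv[OF assms, of c x "axis i 1" 0] by simp
qed

lemma dx_tprod: "tensor_test b \<Longrightarrow> dx i (tprod b c) = tprod b (c(i := Suc (c i)))"
  unfolding dx_def by (auto intro!: DERIV_imp_deriv tprod_partial)

text \<open>Only the number of occurrences of each direction survives, so a list of directions acts
  as a multi-index and the order of differentiation is immaterial.\<close>

lemma pderivs_tprod:
  "tensor_test b \<Longrightarrow> pderivs is (tprod b c) = tprod b (\<lambda>i. c i + count_list is i)"
  by (induction "is") (auto simp: dx_tprod intro!: arg_cong[where f="tprod b"])

text \<open>One radius serves every multi-index \<open>c\<close>, so a test function and all its
  derivatives share a ball. It comes from the sum norm, which dominates the Euclidean one.\<close>

lemma tprod_bounded_support: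
  assumes "tensor_test b" obtains B where "\<And>c x. norm x \<ge> B \<Longrightarrow> tprod b c x = 0"
proof -
  obtain l u where lu: "\<And>i k x. x \<notin> {l<..<u} \<Longrightarrow> b i k x = 0"
    using assms unfolding tensor_test_def by blast
  have "tprod b c x = 0" if "norm x \<ge> real CARD('a) * (\<bar>l\<bar> + \<bar>u\<bar>)" for c x
  proof (rule ccontr)
    assume "tprod b c x \<noteq> 0"
    then have "\<bar>x $ i\<bar> < \<bar>l\<bar> + \<bar>u\<bar>" for i
      using lu[of "x $ i" i "c i"] by (fastforce simp: tprod_def)
    then have "(\<Sum>i\<in>UNIV. \<bar>x $ i\<bar>) < (\<Sum>i\<in>(UNIV::'a set). \<bar>l\<bar> + \<bar>u\<bar>)"
      by (intro sum_strict_mono) auto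
    then show False using that norm_le_l1_cart[of x] by simp
  qed
  then show thesis using that by blast
qed

lemma test_fun_tprod: assumes b: "tensor_test b" shows "test_fun (tprod b c)"
proof -
  obtain B where B: "\<And>c x. norm x \<ge> B \<Longrightarrow> tprod b c x = 0"
    using tprod_bounded_support[OF b] by metis
  have "bounded {x. tprod b c x \<noteq> 0}"
    by (rule boundedI[of _ B]) (use B in force)
  then show ?thesis
    unfolding test_fun_def smooth_on_def
    using b by (auto simp: pderivs_tprod dx_tprod intro: tprod_cont tprod_partial)
qed

subsection \<open>The fundamental lemma of the calculus of variations\<close>

lemma tensor_test_bump:
  fixes l u :: "real^'n::finite"
  assumes "c > 0" shows "tensor_test (\<lambda>i. bump c (l $ i) (u $ i))"
proof -
  have "bump c (l $ i) (u $ i) k x = 0" if "x \<notin> {- norm l<..<norm u}" for i k x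
    using that component_le_norm_cart[of l i] component_le_norm_cart[of u i]
    by (intro bump_outside[OF assms]) auto
  then show ?thesis unfolding tensor_test_def using jet_bump[OF assms] by blast
qed

lemma bump_tendsto_indicator:
  fixes l u :: "real^'n::finite"
  shows "(\<lambda>N. tprod (\<lambda>i. bump (1 / real (Suc N)) (l $ i) (u $ i)) (\<lambda>_. 0) x) \<longlonglongrightarrow> indicator (box l u) x"
proof -
  have c: "(\<lambda>N. 1 / real (Suc N)) \<longlonglongrightarrow> 0"
    using LIMSEQ_inverse_real_of_nat by (simp add: inverse_eq_divide)
  \<comment> \<open>The limit keeps the literal form \<open>exp (- 0 / ...)\<close> so that it has
    the same shape as the sequence; it is simplified to 1 only in the product.\<close>
  have "(\<lambda>N. bump (1 / real (Suc N)) (l $ i) (u $ i) 0 (x $ i)) \<longlonglongrightarrow>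
      (if l $ i < x $ i \<and> x $ i < u $ i then exp (- 0 / (x $ i - l $ i)) * exp (- 0 / (u $ i - x $ i)) else 0)" for i
  proof (cases "l $ i < x $ i \<and> x $ i < u $ i")
    case True
    then have "(\<lambda>N. exp (- (1 / real (Suc N)) / (x $ i - l $ i)) * exp (- (1 / real (Suc N)) / (u $ i - x $ i)))
       \<longlonglongrightarrow> exp (- 0 / (x $ i - l $ i)) * exp (- 0 / (u $ i - x $ i))"
      by (intro tendsto_intros c) auto
    then show ?thesis using True by (simp only: bump_0 if_True simp_thms)
  next
    case False
    then show ?thesis by (simp only: bump_0 if_False simp_thms tendsto_const)
  qed
  then have "(\<lambda>N. tprod (\<lambda>i. bump (1 / real (Suc N)) (l $ i) (u $ i)) (\<lambda>_. 0) x) \<longlonglongrightarrow>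
     (\<Prod>i\<in>UNIV. (if l $ i < x $ i \<and> x $ i < u $ i then exp (- 0 / (x $ i - l $ i)) * exp (- 0 / (u $ i - x $ i)) else 0))"
    unfolding tprod_def by (intro tendsto_prod) auto
  moreover have "(\<Prod>i\<in>UNIV. (if l $ i < x $ i \<and> x $ i < u $ i then exp (- 0 / (x $ i - l $ i)) * exp (- 0 / (u $ i - x $ i)) else 0)) = (indicator (box l u) x :: real)"
    by (auto simp: indicator_def mem_box_cart intro!: prod_zero)
  ultimately show ?thesis by simp
qed

lemma bump_le_indicator:
  fixes l u :: "real^'n::finite"
  assumes "c > 0" shows "\<bar>tprod (\<lambda>i. bump c (l $ i) (u $ i)) (\<lambda>_. 0) x\<bar> \<le> indicator (box l u) x"
proof (cases "x \<in> box l u")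
  case True
  have "\<bar>bump c (l $ i) (u $ i) 0 (x $ i)\<bar> \<le> 1" for i
  proof -
    have *: "l $ i < x $ i" "x $ i < u $ i" using True by (auto simp: mem_box_cart)
    then have "exp (- c / (x $ i - l $ i)) \<le> 1" "exp (- c / (u $ i - x $ i)) \<le> 1"
      using assms by simp_all
    then show ?thesis using * by (simp add: bump_0 abs_mult mult_le_one)
  qed
  then show ?thesis using True by (auto simp: tprod_def abs_prod intro!: prod_le_1)
next
  case False
  then obtain i where "x $ i \<notin> {l $ i<..<u $ i}" by (auto simp: mem_box_cart)
  then have "bump c (l $ i) (u $ i) 0 (x $ i) = 0" by (auto simp: bump_0)
  then show ?thesis using False by (auto simp: tprod_def intro!: prod_zero)
qed

text \<open>The positive and negative parts of \<open>h\<close> are densities of two measures that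
  are finite and equal on open boxes. Boxes form a generator stable under intersection and exhaust
  the space, so the measures agree, and densities are unique almost everywhere.\<close>

lemma AE_eq_0_if_box_integrals_0:
  fixes h :: "'a::euclidean_space \<Rightarrow> real"
  assumes [measurable]: "h \<in> borel_measurable borel"
    and int: "\<And>l u. integrable lborel (\<lambda>x. h x * indicator (box l u) x)"
    and zero: "\<And>l u. (\<integral>x. h x * indicator (box l u) x \<partial>lborel) = 0"
  shows "AE x in lborel. h x = 0"
proof -
  let ?P = "density lborel (\<lambda>x. ennreal (h x))" and ?N = "density lborel (\<lambda>x. ennreal (- h x))"
  have box: "emeasure ?P (box l u) = emeasure ?N (box l u) \<and> emeasure ?P (box l u) \<noteq> \<infinity>" for l u
  proof -
    obtain r q where rq: "0 \<le> r" "0 \<le> q"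
      "(\<integral>\<^sup>+x. ennreal (h x * indicator (box l u) x) \<partial>lborel) = ennreal r"
      "(\<integral>\<^sup>+x. ennreal (- (h x * indicator (box l u) x)) \<partial>lborel) = ennreal q"
      "(\<lambda>x. h x * indicator (box l u) x) \<in> borel_measurable lborel"
      "(\<integral>x. h x * indicator (box l u) x \<partial>lborel) = r - q"
      by (rule integrableE[OF int[of l u]])
    have "ennreal (y * indicator (box l u) x) = ennreal y * indicator (box l u) x" for y and x :: 'a
      by (auto simp: indicator_def)
    moreover have "ennreal (- (y * indicator (box l u) x)) = ennreal (- y) * indicator (box l u) x" for y and x :: 'a
      by (auto simp: indicator_def)
    ultimately have "emeasure ?P (box l u) = ennreal r" "emeasure ?N (box l u) = ennreal q"
      using rq by (simp_all add: emeasure_density)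
    moreover have "r = q" using rq zero[of l u] by simp
    ultimately show ?thesis by simp
  qed
  have "?P = ?N"
  proof (rule measure_eqI_generator_eq)
    let ?E = "range (\<lambda>(a, b). box a b::'a set)"
    show "Int_stable ?E"
      by (auto simp: Int_stable_def box_Int_box)
    show "?E \<subseteq> Pow UNIV" "sets ?P = sigma_sets UNIV ?E" "sets ?N = sigma_sets UNIV ?E"
      by (simp_all add: borel_eq_box)
    let ?A = "\<lambda>n::nat. box (- (real n *\<^sub>R One)) (real n *\<^sub>R One) :: 'a set"
    show "range ?A \<subseteq> ?E" "(\<Union>i. ?A i) = UNIV"
      unfolding UN_box_eq_UNIV by auto
    show "emeasure ?P (?A i) \<noteq> \<infinity>" for i using box by blast
    show "emeasure ?P X = emeasure ?N X" if "X \<in> ?E" for X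
      using that box by auto
  qed
  then have "AE x in lborel. ennreal (h x) = ennreal (- h x)"
    by (intro sigma_finite_measure.density_unique[OF sigma_finite_lborel]) auto
  then show ?thesis
  proof eventually_elim
    case (elim x)
    \<comment> \<open>\<open>ennreal\<close> cuts negative numbers off at 0, so one of the two sides
      is always 0; equality then forces \<open>h x = 0\<close>.\<close>
    then show ?case by (cases "h x" "0::real" rule: linorder_cases) (simp_all add: ennreal_neg ennreal_eq_0_iff)
  qed
qed

text \<open>Box indicators are bounded pointwise limits of tensor bumps vanishing outside the same
  box, so dominated convergence reduces the claim to integrals over boxes.\<close>

lemma fundamental_lemma_AE:
  fixes h :: "real^'n::finite \<Rightarrow> real"
  assumes [measurable]: "h \<in> borel_measurable borel"
    and int: "\<And>l u. integrable lborel (\<lambda>x. h x * indicator (box l u) x)"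
    and zero: "\<And>b. tensor_test b \<Longrightarrow> (\<integral>x. h x * tprod b (\<lambda>_. 0) x \<partial>lborel) = 0"
  shows "AE x in lborel. h x = 0"
proof (rule AE_eq_0_if_box_integrals_0)
  fix l u :: "real^'n"
  let ?p = "\<lambda>N. tprod (\<lambda>i. bump (1 / real (Suc N)) (l $ i) (u $ i)) (\<lambda>_. 0)"
  have t: "tensor_test (\<lambda>i. bump (1 / real (Suc N)) (l $ i) (u $ i))" for N
    by (rule tensor_test_bump) simp
  have [measurable]: "?p N \<in> borel_measurable borel" for N
    by (intro borel_measurable_continuous_onI tprod_cont t)
  have "(\<lambda>N. \<integral>x. h x * ?p N x \<partial>lborel) \<longlonglongrightarrow> (\<integral>x. h x * indicator (box l u) x \<partial>lborel)"
  proof (rule integral_dominated_convergence)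
    show "integrable lborel (\<lambda>x. \<bar>h x * indicator (box l u) x\<bar>)" using int by simp
    show "AE x in lborel. (\<lambda>N. h x * ?p N x) \<longlonglongrightarrow> h x * indicator (box l u) x"
      by (intro AE_I2 tendsto_mult_left bump_tendsto_indicator)
    show "AE x in lborel. norm (h x * ?p N x) \<le> \<bar>h x * indicator (box l u) x\<bar>" for N
      using bump_le_indicator[of "1 / real (Suc N)" l u]
      by (intro AE_I2) (auto simp: abs_mult intro!: mult_left_mono)
    show "(\<lambda>x. h x * ?p N x) \<in> borel_measurable lborel" for N by measurable
  qed auto
  then show "(\<integral>x. h x * indicator (box l u) x \<partial>lborel) = 0"
    unfolding zero[OF t] LIMSEQ_const_iff by simp
qed (use int in auto)

text \<open>The coincidence set is closed and of full measure, hence everything.\<close>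

lemma continuous_AE_eq:
  fixes f g :: "'a::euclidean_space \<Rightarrow> real"
  assumes "continuous_on UNIV f" "continuous_on UNIV g" "AE x in lborel. f x = g x"
  shows "f x = g x"
proof -
  have "closed {x. f x = g x}"
    using closed_Collect_eq[OF assms(1,2)] .
  then show ?thesis
    using mem_closed_if_AE_lebesgue[of "{x. f x = g x}"] AE_completion[OF assms(3)] by auto
qed

subsection \<open>Shifted averages and weak derivatives\<close>

lemma integrable_lborel_shift:
  fixes f :: "'a::euclidean_space \<Rightarrow> real"
  assumes [measurable]: "f \<in> borel_measurable borel"
  shows "integrable lborel (\<lambda>x. f (x + s)) \<longleftrightarrow> integrable lborel f"
  using integrable_distr_eq[of "(+) s" lborel borel f] lborel_distr_plus[of s]
  by (simp add: add.commute)

lemma integral_lborel_shift: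
  fixes f :: "'a::euclidean_space \<Rightarrow> real"
  assumes [measurable]: "f \<in> borel_measurable borel"
  shows "(\<integral>x. f (x + s) \<partial>lborel) = (\<integral>x. f x \<partial>lborel)"
  using integral_distr[of "(+) s" lborel borel f] lborel_distr_plus[of s]
  by (simp add: add.commute)

lemma L2_measurable [measurable_dest]: "L2 f \<Longrightarrow> f \<in> borel_measurable borel"
  by (simp add: L2_def)

lemma L2_shift: "L2 f \<Longrightarrow> L2 (\<lambda>x. f (x + s))"
  using integrable_lborel_shift[of "\<lambda>x. (f x)\<^sup>2" s] by (auto simp: L2_def)

lemma L2_mult_le:
  fixes a b :: real shows "\<bar>a * b\<bar> \<le> a\<^sup>2 + b\<^sup>2"
proof -
  have "0 \<le> (\<bar>a\<bar> - \<bar>b\<bar>)\<^sup>2" by simp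
  then have "2 * (\<bar>a\<bar> * \<bar>b\<bar>) \<le> a\<^sup>2 + b\<^sup>2" by (simp add: power2_diff)
  moreover have "0 \<le> \<bar>a\<bar> * \<bar>b\<bar>" by simp
  ultimately show ?thesis unfolding abs_mult by linarith
qed

lemma L2_mult_integrable:
  assumes [measurable]: "f \<in> borel_measurable M" "g \<in> borel_measurable M"
    and "integrable M (\<lambda>x. (f x)\<^sup>2)" "integrable M (\<lambda>x. (g x)\<^sup>2 :: real)"
  shows "integrable M (\<lambda>x. f x * g x)"
  by (rule Bochner_Integration.integrable_bound[of _ "\<lambda>x. (f x)\<^sup>2 + (g x)\<^sup>2"])
     (use assms L2_mult_le in auto)

lemma L2_Cauchy_Schwarz:
  fixes f g :: "'a \<Rightarrow> real"
  assumes [measurable]: "f \<in> borel_measurable M" "g \<in> borel_measurable M"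
    and i: "integrable M (\<lambda>x. (f x)\<^sup>2)" "integrable M (\<lambda>x. (g x)\<^sup>2)"
  shows "\<bar>\<integral>x. f x * g x \<partial>M\<bar> \<le> sqrt (\<integral>x. (f x)\<^sup>2 \<partial>M) * sqrt (\<integral>x. (g x)\<^sup>2 \<partial>M)"
proof -
  let ?A = "\<integral>x. (f x)\<^sup>2 \<partial>M" and ?B = "\<integral>x. f x * g x \<partial>M" and ?C = "\<integral>x. (g x)\<^sup>2 \<partial>M"
  have q: "0 \<le> ?A - 2 * l * ?B + l\<^sup>2 * ?C" for l
  proof -
    have "0 \<le> (\<integral>x. (f x - l * g x)\<^sup>2 \<partial>M)" by (intro integral_nonneg_AE) auto
    also have "\<dots> = (\<integral>x. (f x)\<^sup>2 - 2 * l * (f x * g x) + l\<^sup>2 * (g x)\<^sup>2 \<partial>M)"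
      by (intro Bochner_Integration.integral_cong) (auto simp: power2_eq_square algebra_simps)
    also have "\<dots> = ?A - 2 * l * ?B + l\<^sup>2 * ?C"
      using i L2_mult_integrable[of f M g] assms by simp
    finally show ?thesis .
  qed
  have C: "0 \<le> ?C" by (intro integral_nonneg_AE) auto
  have "?B\<^sup>2 \<le> ?A * ?C"
  proof (cases "?C = 0")
    case True
    have "?B = 0"
    proof (rule ccontr)
      assume "?B \<noteq> 0"
      \<comment> \<open>With \<open>?C = 0\<close> the quadratic in \<open>l\<close> is affine, and
        this \<open>l\<close> gives it the value -1.\<close>
      then show False using q[of "(?A + 1) / (2 * ?B)"] True by simp
    qed
    then show ?thesis using True by simp
  next
    case False
    have "0 \<le> (?A - 2 * (?B / ?C) * ?B + (?B / ?C)\<^sup>2 * ?C) * ?C"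
      using q[of "?B / ?C"] C by (rule mult_nonneg_nonneg)
    also have "\<dots> = ?A * ?C - ?B\<^sup>2"
      using False by (simp add: field_simps power2_eq_square)
    finally show ?thesis by simp
  qed
  then have "sqrt (?B\<^sup>2) \<le> sqrt (?A * ?C)" by (rule real_sqrt_le_mono)
  then show ?thesis by (simp add: real_sqrt_mult)
qed

lemma L2_conv_bound:
  fixes g p :: "'a::euclidean_space \<Rightarrow> real"
  assumes [measurable]: "g \<in> borel_measurable borel" "p \<in> borel_measurable borel"
    and "integrable lborel (\<lambda>x. (g x)\<^sup>2)" "integrable lborel (\<lambda>x. (p x)\<^sup>2)"
  shows "integrable lborel (\<lambda>x. g (x + s) * p x)"
    and "(\<integral>x. \<bar>g (x + s) * p x\<bar> \<partial>lborel) \<le> (\<integral>x. (g x)\<^sup>2 \<partial>lborel) + (\<integral>x. (p x)\<^sup>2 \<partial>lborel)"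
proof -
  have i: "integrable lborel (\<lambda>x. (g (x + s))\<^sup>2)"
    using integrable_lborel_shift[of "\<lambda>x. (g x)\<^sup>2" s] assms by auto
  then show *: "integrable lborel (\<lambda>x. g (x + s) * p x)"
    using assms by (intro L2_mult_integrable) auto
  have "(\<integral>x. \<bar>g (x + s) * p x\<bar> \<partial>lborel) \<le> (\<integral>x. (g (x + s))\<^sup>2 + (p x)\<^sup>2 \<partial>lborel)"
    using i assms by (intro integral_mono L2_mult_le integrable_abs * Bochner_Integration.integrable_add)
  also have "\<dots> = (\<integral>x. (g x)\<^sup>2 \<partial>lborel) + (\<integral>x. (p x)\<^sup>2 \<partial>lborel)"
    using i assms integral_lborel_shift[of "\<lambda>x. (g x)\<^sup>2" s] by simp
  finally show "(\<integral>x. \<bar>g (x + s) * p x\<bar> \<partial>lborel) \<le> (\<integral>x. (g x)\<^sup>2 \<partial>lborel) + (\<integral>x. (p x)\<^sup>2 \<partial>lborel)" .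
qed

text \<open>Translation leaves L2 norms unchanged, so the inner integral is bounded uniformly in the
  shift and integrability of the weight \<open>a\<close> suffices. The measure \<open>M\<close> and
  the shift \<open>s\<close> stay abstract because three cases occur: shifts by y, shifts by t y
  with a weight in t and y, and shifts along a coordinate axis.\<close>

lemma conv_Fubini:
  fixes g p :: "'a::euclidean_space \<Rightarrow> real"
  assumes M: "sigma_finite_measure M" and a: "integrable M a"
    and [measurable]: "s \<in> M \<rightarrow>\<^sub>M borel" "g \<in> borel_measurable borel" "p \<in> borel_measurable borel"
    and i: "integrable lborel (\<lambda>x. (g x)\<^sup>2)" "integrable lborel (\<lambda>x. (p x)\<^sup>2)"
  shows "(\<integral>x. p x * (\<integral>w. a w * g (x + s w) \<partial>M) \<partial>lborel) =
         (\<integral>w. a w * (\<integral>x. g (x + s w) * p x \<partial>lborel) \<partial>M)"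
    and "integrable lborel (\<lambda>x. p x * (\<integral>w. a w * g (x + s w) \<partial>M))"
proof -
  interpret M: sigma_finite_measure M by fact
  interpret P: pair_sigma_finite M lborel ..
  have [measurable]: "a \<in> borel_measurable M" using a by auto
  let ?f = "\<lambda>(w, x). a w * (g (x + s w) * p x)"
  let ?K = "(\<integral>x. (g x)\<^sup>2 \<partial>lborel) + (\<integral>x. (p x)\<^sup>2 \<partial>lborel)"
  have [measurable]: "?f \<in> borel_measurable (M \<Otimes>\<^sub>M lborel)"
    by measurable
  have f: "integrable (M \<Otimes>\<^sub>M lborel) ?f"
  proof (rule P.Fubini_integrable)
    show "integrable M (\<lambda>w. \<integral>x. norm (?f (w, x)) \<partial>lborel)"
    proof (rule Bochner_Integration.integrable_bound[of _ "\<lambda>w. a w * ?K"])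
      have "(\<integral>x. norm (?f (w, x)) \<partial>lborel) \<le> \<bar>a w\<bar> * ?K" for w
        using L2_conv_bound(2)[of g p "s w"] i by (simp add: abs_mult mult_left_mono)
      then show "AE w in M. norm (\<integral>x. norm (?f (w, x)) \<partial>lborel) \<le> norm (a w * ?K)"
        by (intro AE_I2) (auto simp: abs_mult integral_nonneg_AE)
    qed (use a in auto)
    show "AE w in M. integrable lborel (\<lambda>x. ?f (w, x))"
      using L2_conv_bound(1)[of g p] i by (intro AE_I2) auto
  qed simp
  have eq: "(\<integral>w. a w * (g (x + s w) * p x) \<partial>M) = p x * (\<integral>w. a w * g (x + s w) \<partial>M)" for x
  proof -
    have "a w * (g (x + s w) * p x) = p x * (a w * g (x + s w))" for w by simp
    then show ?thesis by (simp only: integral_mult_right_zero)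
  qed
  show "(\<integral>x. p x * (\<integral>w. a w * g (x + s w) \<partial>M) \<partial>lborel) =
         (\<integral>w. a w * (\<integral>x. g (x + s w) * p x \<partial>lborel) \<partial>M)"
    using P.Fubini_integral[OF f] by (simp add: eq)
  show "integrable lborel (\<lambda>x. p x * (\<integral>w. a w * g (x + s w) \<partial>M))"
    using P.integrable_snd[OF f] by (simp add: eq)
qed

lemma tensor_test_shift:
  fixes s :: "real^'n::finite"
  assumes "tensor_test b"
  shows "tensor_test (\<lambda>i k y. b i k (y - s $ i))"
proof -
  obtain l u where lu: "\<And>i k x. x \<notin> {l<..<u} \<Longrightarrow> b i k x = 0"
    using assms unfolding tensor_test_def by blast
  have "jet (\<lambda>k y. b i k (y - s $ i))" for i
    unfolding jet_def
  proof safe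
    fix k x
    have "(b i k has_real_derivative b i (Suc k) (x - s $ i)) (at (x - s $ i))"
      using assms by (simp add: tensor_test_def jet_def)
    moreover have "((\<lambda>y. y - s $ i) has_real_derivative 1) (at x)"
      by (auto intro!: derivative_eq_intros)
    ultimately show "((\<lambda>y. b i k (y - s $ i)) has_real_derivative b i (Suc k) (x - s $ i)) (at x)"
      using DERIV_chain2[of "b i k" _ "\<lambda>y. y - s $ i" x 1 UNIV] by simp
  qed
  moreover have "b i k (x - s $ i) = 0" if "x \<notin> {l - norm s<..<u + norm s}" for i k x
    using that component_le_norm_cart[of s i] by (intro lu) auto
  ultimately show ?thesis unfolding tensor_test_def by blast
qed

lemma tprod_shift: "tprod (\<lambda>i k y. b i k (y - s $ i)) c x = tprod b c (x - s)"
  by (simp add: tprod_def)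

lemma L2_continuous_bounded_support:
  fixes f :: "real^'n::finite \<Rightarrow> real"
  assumes f: "continuous_on UNIV f" and B: "\<And>x. norm x \<ge> B \<Longrightarrow> f x = 0"
  shows "L2 f" "integrable lborel f"
proof -
  have *: "integrable lborel g" if g: "continuous_on UNIV g" "\<And>x. norm x \<ge> B \<Longrightarrow> g x = 0"
    for g :: "real^'n \<Rightarrow> real"
  proof -
    have "integrable lborel (\<lambda>x. indicator (cball 0 B) x *\<^sub>R g x)"
      by (rule borel_integrable_compact[unfolded set_integrable_def])
         (auto intro: continuous_on_subset[OF g(1)])
    moreover have "(\<lambda>x. indicator (cball 0 B) x *\<^sub>R g x) = g"
    proof
      show "indicator (cball 0 B) x *\<^sub>R g x = g x" for x
        using g(2)[of x] by (cases "norm x \<ge> B") (auto simp: indicator_def)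
    qed
    ultimately show ?thesis by simp
  qed
  show "integrable lborel f" using * assms by blast
  have "integrable lborel (\<lambda>x. (f x)\<^sup>2)" using assms by (intro * continuous_intros) auto
  then show "L2 f" using f by (auto simp: L2_def intro: borel_measurable_continuous_onI)
qed

lemma L2_tprod: "tensor_test b \<Longrightarrow> L2 (tprod b c)"
  by (rule tprod_bounded_support) (auto intro: L2_continuous_bounded_support tprod_cont)

lemma L2_D: "L2 f \<Longrightarrow> f \<in> borel_measurable borel" "L2 f \<Longrightarrow> integrable lborel (\<lambda>x. (f x)\<^sup>2)"
  by (auto simp: L2_def)

text \<open>For each \<open>w\<close> the translate of the tensor function by \<open>s w\<close> is
  again a test function, so the weak derivative identity holds for it; integrating against
  \<open>a\<close> and exchanging integrals gives the claim. A shift \<open>x - s w\<close> on the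
  test side becomes \<open>x + s w\<close> on the side of \<open>g\<close>. This is the
  transposition through which formulas for test functions pass to \<open>f\<close>.\<close>

lemma weak_deriv_conv:
  fixes f g :: "real^'n::finite \<Rightarrow> real"
  assumes b: "tensor_test b" and w: "weak_deriv is f g" and f: "L2 f" and g: "L2 g"
    and M: "sigma_finite_measure M" and a: "integrable M a" and s[measurable]: "s \<in> M \<rightarrow>\<^sub>M borel"
  shows "(\<integral>x. f x * (\<integral>w. a w * tprod b (count_list is) (x - s w) \<partial>M) \<partial>lborel) =
     (-1) ^ length is * (\<integral>x. tprod b (\<lambda>_. 0) x * (\<integral>w. a w * g (x + s w) \<partial>M) \<partial>lborel)"
    and "integrable lborel (\<lambda>x. f x * (\<integral>w. a w * tprod b (count_list is) (x - s w) \<partial>M))"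
proof -
  note d = L2_D[OF f] L2_D[OF g] L2_D[OF L2_tprod[OF b]]
  have [measurable]: "(\<lambda>w. - s w) \<in> M \<rightarrow>\<^sub>M borel" by simp
  note F1 = conv_Fubini[OF M a \<open>(\<lambda>w. - s w) \<in> M \<rightarrow>\<^sub>M borel\<close> d(5,1) d(6,2), of "count_list is"]
  note F2 = conv_Fubini[OF M a s d(3,5) d(4,6), of "\<lambda>_. 0"]
  have *: "(\<integral>x. tprod b (count_list is) (x + - s w) * f x \<partial>lborel) =
      (-1) ^ length is * (\<integral>x. g (x + s w) * tprod b (\<lambda>_. 0) x \<partial>lborel)" for w
  proof -
    let ?b = "\<lambda>i k y. b i k (y - s w $ i)"
    have b': "tensor_test ?b" using tensor_test_shift[OF b] .
    have "(\<integral>x. f x * pderivs is (tprod ?b (\<lambda>_. 0)) x \<partial>lborel) =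
       (-1) ^ length is * (\<integral>x. g x * tprod ?b (\<lambda>_. 0) x \<partial>lborel)"
      using w test_fun_tprod[OF b'] unfolding weak_deriv_def by blast
    also have "(\<integral>x. g x * tprod ?b (\<lambda>_. 0) x \<partial>lborel) = (\<integral>x. g x * tprod b (\<lambda>_. 0) (x - s w) \<partial>lborel)"
      by (simp add: tprod_shift)
    also have "\<dots> = (\<integral>x. g (x + s w) * tprod b (\<lambda>_. 0) (x + s w - s w) \<partial>lborel)"
      using d by (intro integral_lborel_shift[symmetric]) auto
    finally have "(\<integral>x. f x * pderivs is (tprod ?b (\<lambda>_. 0)) x \<partial>lborel) =
       (-1) ^ length is * (\<integral>x. g (x + s w) * tprod b (\<lambda>_. 0) (x + s w - s w) \<partial>lborel)" .
    moreover have "pderivs is (tprod ?b (\<lambda>_. 0)) = (\<lambda>x. tprod b (count_list is) (x - s w))"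
      unfolding pderivs_tprod[OF b'] by (rule ext) (simp add: tprod_shift)
    ultimately show ?thesis by (simp add: mult.commute)
  qed
  show "(\<integral>x. f x * (\<integral>w. a w * tprod b (count_list is) (x - s w) \<partial>M) \<partial>lborel) =
     (-1) ^ length is * (\<integral>x. tprod b (\<lambda>_. 0) x * (\<integral>w. a w * g (x + s w) \<partial>M) \<partial>lborel)"
  proof -
    have "a w * ((-1) ^ length is * y) = (-1) ^ length is * (a w * y)" for w y by simp
    then show ?thesis using F1(1) unfolding F2(1) * by (simp only: integral_mult_right_zero diff_conv_add_uminus)
  qed
  show "integrable lborel (\<lambda>x. f x * (\<integral>w. a w * tprod b (count_list is) (x - s w) \<partial>M))"
    using F1(2) by simp
qed

section \<open>Averages at scale t and their integrals over t in [0,1]\<close>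

lemma lborel_scale_integrable:
  fixes f :: "'a::euclidean_space \<Rightarrow> real"
  assumes [measurable]: "f \<in> borel_measurable borel" and t: "t > 0"
  shows "integrable lborel (\<lambda>y. f (x + t *\<^sub>R y)) \<longleftrightarrow> integrable lborel f"
proof -
  have "integrable lborel f \<longleftrightarrow>
      integrable (density (distr lborel borel (\<lambda>y. x + t *\<^sub>R y)) (\<lambda>_. ennreal (t ^ DIM('a)))) f"
    using lborel_affine[of t x] t by simp
  also have "\<dots> \<longleftrightarrow> integrable lborel (\<lambda>y. t ^ DIM('a) * f (x + t *\<^sub>R y))"
    using t by (subst integrable_density) (auto simp: integrable_distr_eq)
  also have "\<dots> \<longleftrightarrow> integrable lborel (\<lambda>y. f (x + t *\<^sub>R y))" using t by simp
  finally show ?thesis by simp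
qed

lemma lborel_scale_integral:
  fixes f :: "'a::euclidean_space \<Rightarrow> real"
  assumes [measurable]: "f \<in> borel_measurable borel" and t: "t > 0"
  shows "(\<integral>y. f (x + t *\<^sub>R y) \<partial>lborel) = (\<integral>y. f y \<partial>lborel) / t ^ DIM('a)"
proof -
  have "(\<integral>y. f y \<partial>lborel) =
      (\<integral>y. f y \<partial>density (distr lborel borel (\<lambda>y. x + t *\<^sub>R y)) (\<lambda>_. ennreal (t ^ DIM('a))))"
    using lborel_affine[of t x] t by simp
  also have "\<dots> = (\<integral>y. t ^ DIM('a) * f (x + t *\<^sub>R y) \<partial>lborel)"
    using t by (subst integral_density) (auto simp: integral_distr)
  finally show ?thesis using t by simp
qed

definition avg :: "('a::euclidean_space \<Rightarrow> real) \<Rightarrow> ('a \<Rightarrow> real) \<Rightarrow> real \<Rightarrow> 'a \<Rightarrow> real" where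
  "avg k g t x = (\<integral>y. k y * g (x + t *\<^sub>R y) \<partial>lborel)"

text \<open>A single inequality encodes support in the unit ball and the bound 1, so that later
  constants involve the kernel only through the volume of that ball.\<close>

definition kernel :: "('a::euclidean_space \<Rightarrow> real) \<Rightarrow> bool" where
  "kernel k \<longleftrightarrow> continuous_on UNIV k \<and> (\<forall>y. \<bar>k y\<bar> \<le> indicator (cball 0 1) y)"

lemma kernel_measurable [measurable_dest]: "kernel k \<Longrightarrow> k \<in> borel_measurable borel"
  by (simp add: kernel_def borel_measurable_continuous_onI)

lemma kernel_square:
  assumes k: "kernel k"
  shows "integrable lborel (\<lambda>y. (k y)\<^sup>2)" "(\<integral>y. (k y)\<^sup>2 \<partial>lborel) \<le> measure lborel (cball 0 1 :: 'a::euclidean_space set)"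
    "integrable lborel (k :: 'a \<Rightarrow> real)"
proof -
  have [measurable]: "k \<in> borel_measurable borel" using k by measurable
  have i: "integrable lborel (indicator (cball 0 1) :: 'a \<Rightarrow> real)"
    using emeasure_bounded_finite[OF bounded_cball] by (simp add: integrable_indicator_iff)
  have le: "\<bar>k y\<bar> \<le> indicator (cball 0 1) y" for y using k by (simp add: kernel_def)
  have le2: "(k y)\<^sup>2 \<le> indicator (cball 0 1) y" for y
    using le[of y] by (auto simp: indicator_def abs_square_le_1[symmetric] split: if_splits)
  show i2: "integrable lborel (\<lambda>y. (k y)\<^sup>2)"
    by (rule Bochner_Integration.integrable_bound[OF i]) (use le2 in auto)
  show "integrable lborel k"
    by (rule Bochner_Integration.integrable_bound[OF i]) (use le in auto)
  have "(\<integral>y. (k y)\<^sup>2 \<partial>lborel) \<le> (\<integral>y. indicator (cball 0 1) y \<partial>(lborel :: 'a measure))"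
    by (rule integral_mono[OF i2 i]) (rule le2)
  then show "(\<integral>y. (k y)\<^sup>2 \<partial>lborel) \<le> measure lborel (cball 0 1 :: 'a set)" by simp
qed

lemma avg_bound:
  fixes k :: "'a::euclidean_space \<Rightarrow> real"
  assumes k: "kernel k" and g[measurable]: "g \<in> borel_measurable borel"
    and g2: "integrable lborel (\<lambda>x. (g x)\<^sup>2)" and t: "t > 0"
  shows "integrable lborel (\<lambda>y. k y * g (x + t *\<^sub>R y))"
    and "(\<integral>y. \<bar>k y * g (x + t *\<^sub>R y)\<bar> \<partial>lborel) \<le>
      sqrt (measure lborel (cball 0 1 :: 'a set)) * (sqrt (\<integral>x. (g x)\<^sup>2 \<partial>lborel) / sqrt (t ^ DIM('a)))"
    and "\<bar>avg k g t x\<bar> \<le>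
      sqrt (measure lborel (cball 0 1 :: 'a set)) * (sqrt (\<integral>x. (g x)\<^sup>2 \<partial>lborel) / sqrt (t ^ DIM('a)))"
proof -
  have [measurable]: "k \<in> borel_measurable borel" using k by measurable
  have i: "integrable lborel (\<lambda>y. (g (x + t *\<^sub>R y))\<^sup>2)"
    using lborel_scale_integrable[of "\<lambda>y. (g y)\<^sup>2" t x] g2 t by simp
  have e: "(\<integral>y. (g (x + t *\<^sub>R y))\<^sup>2 \<partial>lborel) = (\<integral>x. (g x)\<^sup>2 \<partial>lborel) / t ^ DIM('a)"
    using lborel_scale_integral[of "\<lambda>y. (g y)\<^sup>2" t x] t by simp
  show i1: "integrable lborel (\<lambda>y. k y * g (x + t *\<^sub>R y))"
    by (rule L2_mult_integrable) (use i kernel_square[OF k] in auto)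
  have "(\<integral>y. \<bar>k y * g (x + t *\<^sub>R y)\<bar> \<partial>lborel) = (\<integral>y. \<bar>k y\<bar> * \<bar>g (x + t *\<^sub>R y)\<bar> \<partial>lborel)"
    by (simp add: abs_mult)
  also have "\<dots> \<le> \<bar>\<dots>\<bar>" by simp
  also have "\<dots> \<le> sqrt (\<integral>y. (k y)\<^sup>2 \<partial>lborel) * sqrt (\<integral>y. (g (x + t *\<^sub>R y))\<^sup>2 \<partial>lborel)"
    using L2_Cauchy_Schwarz[of "\<lambda>y. \<bar>k y\<bar>" lborel "\<lambda>y. \<bar>g (x + t *\<^sub>R y)\<bar>"] i kernel_square[OF k] by simp
  also have "\<dots> \<le> sqrt (measure lborel (cball 0 1 :: 'a set)) * sqrt (\<integral>y. (g (x + t *\<^sub>R y))\<^sup>2 \<partial>lborel)"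
    using kernel_square(2)[OF k] by (intro mult_right_mono) (auto intro: integral_nonneg_AE)
  finally show b: "(\<integral>y. \<bar>k y * g (x + t *\<^sub>R y)\<bar> \<partial>lborel) \<le>
      sqrt (measure lborel (cball 0 1 :: 'a set)) * (sqrt (\<integral>x. (g x)\<^sup>2 \<partial>lborel) / sqrt (t ^ DIM('a)))"
    by (simp add: e real_sqrt_divide)
  have "\<bar>avg k g t x\<bar> \<le> (\<integral>y. \<bar>k y * g (x + t *\<^sub>R y)\<bar> \<partial>lborel)"
    unfolding avg_def by (rule integral_abs_bound)
  with b show "\<bar>avg k g t x\<bar> \<le>
      sqrt (measure lborel (cball 0 1 :: 'a set)) * (sqrt (\<integral>x. (g x)\<^sup>2 \<partial>lborel) / sqrt (t ^ DIM('a)))" by linarith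
qed

text \<open>After the substitution z = x + t y the variable x occurs only inside the continuous
  kernel, while \<open>g\<close> is merely measurable. For a bounded sequence of centres the
  integrands are dominated by |g| on one fixed ball.\<close>

lemma avg_continuous:
  fixes k :: "'a::euclidean_space \<Rightarrow> real"
  assumes k: "kernel k" and g[measurable]: "g \<in> borel_measurable borel"
    and g2: "integrable lborel (\<lambda>x. (g x)\<^sup>2)" and t: "t > 0"
  shows "continuous_on UNIV (avg k g t)"
proof -
  have [measurable]: "k \<in> borel_measurable borel" using k by measurable
  have kc: "continuous_on UNIV k" and kb: "\<bar>k y\<bar> \<le> indicator (cball 0 1) y" for y
    using k by (auto simp: kernel_def)
  have eq: "avg k g t x = (\<integral>z. k ((z - x) /\<^sub>R t) * g z \<partial>lborel) / t ^ DIM('a)" for x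
    using lborel_scale_integral[of "\<lambda>z. k ((z - x) /\<^sub>R t) * g z" t x] t
    by (simp add: avg_def)
  have "(\<lambda>m. avg k g t (X m)) \<longlonglongrightarrow> avg k g t x" if X: "X \<longlonglongrightarrow> x" for X x
  proof -
    obtain B where B: "\<And>m. norm (X m) \<le> B"
      using convergent_imp_Bseq[of X] X by (auto simp: convergent_def Bseq_def)
    let ?w = "\<lambda>z. indicator (cball 0 (B + t)) z * g z"
    have i: "integrable lborel (indicator (cball 0 (B + t)) :: 'a \<Rightarrow> real)"
      using emeasure_bounded_finite[OF bounded_cball] by (simp add: integrable_indicator_iff)
    have w: "integrable lborel ?w"
      by (rule L2_mult_integrable)
        (use i g2 in \<open>auto simp: power2_eq_square indicator_times_eq_if(1)[symmetric] indicator_inter_arith[symmetric]\<close>)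
    have "(\<lambda>m. \<integral>z. k ((z - X m) /\<^sub>R t) * g z \<partial>lborel) \<longlonglongrightarrow> (\<integral>z. k ((z - x) /\<^sub>R t) * g z \<partial>lborel)"
    proof (rule integral_dominated_convergence[where w="\<lambda>z. \<bar>?w z\<bar>"])
      show "AE z in lborel. (\<lambda>m. k ((z - X m) /\<^sub>R t) * g z) \<longlonglongrightarrow> k ((z - x) /\<^sub>R t) * g z"
      proof (rule AE_I2, rule tendsto_mult_right)
        fix z
        have "isCont k ((z - x) /\<^sub>R t)" using kc by (simp add: continuous_on_eq_continuous_at)
        then show "(\<lambda>m. k ((z - X m) /\<^sub>R t)) \<longlonglongrightarrow> k ((z - x) /\<^sub>R t)"
          by (rule isCont_tendsto_compose) (intro tendsto_intros X)
      qed
      show "AE z in lborel. norm (k ((z - X m) /\<^sub>R t) * g z) \<le> \<bar>?w z\<bar>" for m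
      proof (rule AE_I2)
        fix z
        have "\<bar>k ((z - X m) /\<^sub>R t)\<bar> \<le> indicator (cball 0 (B + t)) z"
        proof (cases "norm (z - X m) \<le> t")
          case True
          then have "norm z \<le> B + t" using B[of m] norm_triangle_sub[of z "X m"] by linarith
          moreover have "\<bar>k ((z - X m) /\<^sub>R t)\<bar> \<le> 1"
            using kb[of "(z - X m) /\<^sub>R t"] by (rule order_trans) (simp add: indicator_def)
          ultimately show ?thesis by simp
        next
          case False
          moreover have "norm ((z - X m) /\<^sub>R t) = norm (z - X m) / t"
            using t by (simp only: norm_scaleR abs_inverse abs_of_pos divide_inverse mult.commute)
          ultimately have "(z - X m) /\<^sub>R t \<notin> cball 0 1"
            using t unfolding mem_cball dist_0_norm by simp
          then show ?thesis using kb[of "(z - X m) /\<^sub>R t"] by simp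
        qed
        then show "norm (k ((z - X m) /\<^sub>R t) * g z) \<le> \<bar>?w z\<bar>"
          by (simp add: abs_mult mult_right_mono)
      qed
    qed (use w in auto)
    then show ?thesis unfolding eq using t by (intro tendsto_intros) auto
  qed
  then show ?thesis by (auto simp: continuous_on_sequentially o_def)
qed

text \<open>The dominating function for the integrals over the scale: for 0 < t \<le> 1 the bound
  t^(p - n/2) is no worse than t^(-1/2) once n \<le> 2p + 1.\<close>

lemma integrable_inverse_sqrt: "integrable lborel (\<lambda>t. indicator {0..1} t / sqrt t)"
proof -
  have "(\<lambda>t::real. t powr (-1/2)) integrable_on {0..1}"
    by (rule integrable_on_powr_from_0) auto
  then have "(\<lambda>t::real. t powr (-1/2)) absolutely_integrable_on {0..1}"
    by (subst absolutely_integrable_on_iff_nonneg) auto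
  then have "integrable lborel (\<lambda>t. indicator {0..1} t *\<^sub>R (t::real) powr (-1/2))"
    unfolding set_integrable_def by (subst (asm) integrable_completion) auto
  moreover have "indicator {0..1} t *\<^sub>R (t::real) powr (-1/2) = indicator {0..1} t / sqrt t" for t
    by (auto simp: indicator_def powr_minus powr_half_sqrt field_simps)
  ultimately show ?thesis by simp
qed

text \<open>The weight in the integral remainder of Taylor's formula. Expanding about t = 1 makes it
  a multiple of t^p rather than of (1 - t)^p, so for p > 0 it vanishes at t = 0, just where the
  averages may blow up.\<close>

definition tweight :: "nat \<Rightarrow> real \<Rightarrow> real" where
  "tweight p t = indicator {0..1} t * t ^ p / fact p"

lemma tweight_measurable [measurable]: "tweight p \<in> borel_measurable borel"
  unfolding tweight_def[abs_def] by measurable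

definition tavg :: "nat \<Rightarrow> ('a::euclidean_space \<Rightarrow> real) \<Rightarrow> ('a \<Rightarrow> real) \<Rightarrow> 'a \<Rightarrow> real" where
  "tavg p k g x = (\<integral>t. tweight p t * avg k g t x \<partial>lborel)"

lemma tweight_bound:
  assumes n: "n \<le> 2 * p + 1" and t: "t > 0"
  shows "\<bar>tweight p t\<bar> * (a / sqrt (t ^ n)) \<le> \<bar>a\<bar> * (indicator {0..1} t / sqrt t)"
proof (cases "t \<le> 1")
  case True
  have "t ^ p / fact p \<le> t ^ p / 1" using t by (intro divide_left_mono) auto
  have "(t ^ p)\<^sup>2 * t = t ^ (2 * p + 1)" by (simp add: power_mult[symmetric] mult.commute)
  also have "\<dots> \<le> t ^ n" using True t n by (intro power_decreasing) auto
  finally have "sqrt ((t ^ p)\<^sup>2 * t) \<le> sqrt (t ^ n)" by (rule real_sqrt_le_mono)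
  then have "t ^ p * sqrt t \<le> sqrt (t ^ n)" using t by (simp add: real_sqrt_mult)
  then have "t ^ p / sqrt (t ^ n) \<le> 1 / sqrt t" using t by (simp add: field_simps)
  moreover have "t ^ p / fact p / sqrt (t ^ n) \<le> t ^ p / sqrt (t ^ n)"
    using t \<open>t ^ p / fact p \<le> t ^ p / 1\<close> by (intro divide_right_mono) auto
  ultimately have "t ^ p / fact p / sqrt (t ^ n) \<le> 1 / sqrt t" by linarith
  then have "t ^ p / fact p / sqrt (t ^ n) * \<bar>a\<bar> \<le> 1 / sqrt t * \<bar>a\<bar>" by (rule mult_right_mono) simp
  moreover have "t ^ p / fact p / sqrt (t ^ n) * a \<le> t ^ p / fact p / sqrt (t ^ n) * \<bar>a\<bar>"
    using t by (intro mult_left_mono) auto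
  ultimately show ?thesis using True t by (simp add: tweight_def mult.commute)
qed (simp add: tweight_def)

lemma tavg_Fubini_integrable:
  fixes k :: "'a::euclidean_space \<Rightarrow> real"
  assumes k: "kernel k" and g[measurable]: "g \<in> borel_measurable borel"
    and g2: "integrable lborel (\<lambda>x. (g x)\<^sup>2)" and n: "DIM('a) \<le> 2 * p + 1"
  shows "integrable (lborel \<Otimes>\<^sub>M lborel) (\<lambda>(t, y). tweight p t * k y * g (x + t *\<^sub>R y))"
proof (rule lborel_pair.Fubini_integrable)
  have [measurable]: "k \<in> borel_measurable borel" using k by measurable
  show "(\<lambda>(t, y). tweight p t * k y * g (x + t *\<^sub>R y)) \<in> borel_measurable (lborel \<Otimes>\<^sub>M lborel)"
    by measurable
  let ?N = "sqrt (measure lborel (cball 0 1 :: 'a set)) * sqrt (\<integral>x. (g x)\<^sup>2 \<partial>lborel)"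
  show "integrable lborel (\<lambda>t. \<integral>y. norm (case (t, y) of (t, y) \<Rightarrow> tweight p t * k y * g (x + t *\<^sub>R y)) \<partial>lborel)"
  proof (rule Bochner_Integration.integrable_bound[of _ "\<lambda>t. \<bar>?N\<bar> * (indicator {0..1} t / sqrt t)"])
    \<comment> \<open>The scaling bound requires t > 0. The null set t = 0 is discarded, and
      negative t are killed by the weight.\<close>
    show "AE t in lborel. norm (\<integral>y. norm (case (t, y) of (t, y) \<Rightarrow> tweight p t * k y * g (x + t *\<^sub>R y)) \<partial>lborel)
      \<le> norm (\<bar>?N\<bar> * (indicator {0..1} t / sqrt t))"
      using AE_lborel_singleton[of "0::real"]
    proof eventually_elim
      case (elim t)
      have "(\<integral>y. norm (case (t, y) of (t, y) \<Rightarrow> tweight p t * k y * g (x + t *\<^sub>R y)) \<partial>lborel) =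
         \<bar>tweight p t\<bar> * (\<integral>y. \<bar>k y * g (x + t *\<^sub>R y)\<bar> \<partial>lborel)"
        by (simp add: abs_mult mult.assoc)
      also have "\<dots> \<le> \<bar>?N\<bar> * (indicator {0..1} t / sqrt t)"
      proof (cases "t > 0")
        case True
        have "\<bar>tweight p t\<bar> * (\<integral>y. \<bar>k y * g (x + t *\<^sub>R y)\<bar> \<partial>lborel) \<le> \<bar>tweight p t\<bar> * (?N / sqrt (t ^ DIM('a)))"
          using avg_bound(2)[OF k g g2 True, of x] by (intro mult_left_mono) auto
        also have "\<dots> \<le> \<bar>?N\<bar> * (indicator {0..1} t / sqrt t)"
          by (rule tweight_bound[OF n True])
        finally show ?thesis .
      qed (use elim in \<open>auto simp: tweight_def\<close>)
      finally have "(\<integral>y. norm (case (t, y) of (t, y) \<Rightarrow> tweight p t * k y * g (x + t *\<^sub>R y)) \<partial>lborel) \<le>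
        \<bar>?N\<bar> * (indicator {0..1} t / sqrt t)" .
      moreover have "0 \<le> (\<integral>y. norm (case (t, y) of (t, y) \<Rightarrow> tweight p t * k y * g (x + t *\<^sub>R y)) \<partial>lborel)"
        by (intro integral_nonneg_AE) auto
      ultimately show ?case unfolding real_norm_def[of "integral\<^sup>L _ _"] real_norm_def[of "_ * (_ / _)"] by linarith
    qed
  qed (auto intro: integrable_mult_right[OF integrable_inverse_sqrt, of "\<bar>?N\<bar>", simplified])
  show "AE t in lborel. integrable lborel (\<lambda>y. case (t, y) of (t, y) \<Rightarrow> tweight p t * k y * g (x + t *\<^sub>R y))"
    using AE_lborel_singleton[of "0::real"]
  proof eventually_elim
    case (elim t)
    show ?case
    proof (cases "t > 0")
      case True
      show ?thesis using avg_bound(1)[OF k g g2 True, of x] by (simp add: mult.assoc)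
    qed (use elim in \<open>auto simp: tweight_def\<close>)
  qed
qed

text \<open>Written as one integral over the product of scale and direction, the remainder has the
  form to which \<open>weak_deriv_conv\<close> applies, with shift
  \<open>fst w *\<^sub>R snd w\<close>.\<close>

lemma tavg_eq:
  fixes k :: "'a::euclidean_space \<Rightarrow> real"
  assumes k: "kernel k" and g[measurable]: "g \<in> borel_measurable borel"
    and g2: "integrable lborel (\<lambda>x. (g x)\<^sup>2)" and n: "DIM('a) \<le> 2 * p + 1"
  shows "tavg p k g x = (\<integral>w. (tweight p (fst w) * k (snd w)) * g (x + fst w *\<^sub>R snd w) \<partial>(lborel \<Otimes>\<^sub>M lborel))"
  using lborel_pair.integral_fst'[OF tavg_Fubini_integrable[OF assms, of x]]
  by (simp add: tavg_def avg_def case_prod_beta' mult.assoc)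

lemma avg_measurable [measurable]:
  fixes k :: "'a::euclidean_space \<Rightarrow> real"
  assumes [measurable]: "k \<in> borel_measurable borel" "g \<in> borel_measurable borel"
  shows "(\<lambda>t. avg k g t x) \<in> borel_measurable borel"
  unfolding avg_def by measurable

lemma tavg_bound:
  fixes k :: "'a::euclidean_space \<Rightarrow> real"
  assumes k: "kernel k" and g[measurable]: "g \<in> borel_measurable borel"
    and g2: "integrable lborel (\<lambda>x. (g x)\<^sup>2)" and n: "DIM('a) \<le> 2 * p + 1"
  shows "\<bar>tavg p k g x\<bar> \<le> sqrt (measure lborel (cball 0 1 :: 'a set)) *
      (\<integral>t. indicator {0..1} t / sqrt t \<partial>lborel) * sqrt (\<integral>x. (g x)\<^sup>2 \<partial>lborel)"
    and "continuous_on UNIV (tavg p k g)"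
proof -
  have [measurable]: "k \<in> borel_measurable borel" using k by measurable
  let ?N = "sqrt (measure lborel (cball 0 1 :: 'a set)) * sqrt (\<integral>x. (g x)\<^sup>2 \<partial>lborel)"
  have N: "\<bar>?N\<bar> = ?N" by (simp add: integral_nonneg_AE)
  have b: "AE t in lborel. \<bar>tweight p t * avg k g t x\<bar> \<le> ?N * (indicator {0..1} t / sqrt t)" for x
    using AE_lborel_singleton[of "0::real"]
  proof eventually_elim
    case (elim t)
    show ?case
    proof (cases "t > 0")
      case True
      have "\<bar>tweight p t\<bar> * \<bar>avg k g t x\<bar> \<le> \<bar>tweight p t\<bar> * (?N / sqrt (t ^ DIM('a)))"
        using avg_bound(3)[OF k g g2 True, of x] by (intro mult_left_mono) auto
      also have "\<dots> \<le> \<bar>?N\<bar> * (indicator {0..1} t / sqrt t)"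
        by (rule tweight_bound[OF n True])
      finally show ?thesis unfolding N by (simp add: abs_mult)
    qed (use elim in \<open>auto simp: tweight_def\<close>)
  qed
  have i: "integrable lborel (\<lambda>t. ?N * (indicator {0..1} t / sqrt t))"
    using integrable_inverse_sqrt by (intro integrable_mult_right)
  have "\<bar>tavg p k g x\<bar> \<le> (\<integral>t. ?N * (indicator {0..1} t / sqrt t) \<partial>lborel)"
    unfolding tavg_def
    by (rule order_trans[OF integral_abs_bound]) (rule integral_mono_AE'[OF i b], use N in \<open>auto simp: indicator_def\<close>)
  then show "\<bar>tavg p k g x\<bar> \<le> sqrt (measure lborel (cball 0 1 :: 'a set)) *
      (\<integral>t. indicator {0..1} t / sqrt t \<partial>lborel) * sqrt (\<integral>x. (g x)\<^sup>2 \<partial>lborel)"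
    by (simp only: integral_mult_right_zero) (simp only: mult_ac)
  have "(\<lambda>m. tavg p k g (X m)) \<longlonglongrightarrow> tavg p k g x" if X: "X \<longlonglongrightarrow> x" for X x
    unfolding tavg_def
  proof (rule integral_dominated_convergence[OF _ _ i])
    show "AE t in lborel. (\<lambda>m. tweight p t * avg k g t (X m)) \<longlonglongrightarrow> tweight p t * avg k g t x"
      using AE_lborel_singleton[of "0::real"]
    proof eventually_elim
      case (elim t)
      show ?case
      proof (cases "t > 0")
        case True
        have "isCont (avg k g t) x"
          using avg_continuous[OF k g g2 True] by (simp add: continuous_on_eq_continuous_at)
        then show ?thesis by (intro tendsto_mult_left isCont_tendsto_compose[OF _ X])
      qed (use elim in \<open>auto simp: tweight_def\<close>)
    qed
  qed (use b in auto)
  then show "continuous_on UNIV (tavg p k g)" by (auto simp: continuous_on_sequentially o_def)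
qed

subsection \<open>Averaged Taylor formula\<close>

lemma finite_lists_le: "finite {is :: 'n::finite list. length is \<le> j}"
  using finite_lists_length_le[of "UNIV :: 'n set" j] by simp

lemma sum_lists_Suc:
  fixes F :: "'n::finite list \<Rightarrow> real"
  shows "(\<Sum>is | length is = Suc j. F is) = (\<Sum>i\<in>UNIV. \<Sum>is | length is = j. F (i # is))"
proof -
  have "{is :: 'n list. length is = Suc j} = (\<lambda>(i, is). i # is) ` (UNIV \<times> {is. length is = j})"
    by (auto simp: length_Suc_conv image_iff)
  then have "(\<Sum>is | length is = Suc j. F is) = sum F ((\<lambda>(i, is). i # is) ` (UNIV \<times> {is. length is = j}))"
    by simp
  also have "\<dots> = (\<Sum>(i, is)\<in>UNIV \<times> {is. length is = j}. F (i # is))"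
    by (subst sum.reindex) (auto simp: inj_on_def intro!: sum.cong)
  finally show ?thesis by (simp add: sum.cartesian_product)
qed

definition vmonom :: "'n::finite list \<Rightarrow> real^'n \<Rightarrow> real" where
  "vmonom is y = (\<Prod>i\<leftarrow>is. y $ i)"

text \<open>The j-th power of the directional derivative along \<open>y\<close>, evaluated at x - t
  y. Summing over ordered lists instead of multi-indices absorbs the multinomial
  coefficients.\<close>

definition dirderiv :: "('n::finite \<Rightarrow> nat \<Rightarrow> real \<Rightarrow> real) \<Rightarrow> nat \<Rightarrow> real^'n \<Rightarrow> real^'n \<Rightarrow> real \<Rightarrow> real" where
  "dirderiv b j y x t = (\<Sum>is | length is = j. vmonom is y * tprod b (count_list is) (x - t *\<^sub>R y))"

lemma dirderiv_0: "dirderiv b 0 y x t = tprod b (\<lambda>_. 0) (x - t *\<^sub>R y)"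
  by (simp add: dirderiv_def vmonom_def) (metis (no_types) count_list.simps(1))

lemma dirderiv_deriv:
  assumes b: "tensor_test b"
  shows "(dirderiv b j y x has_real_derivative - dirderiv b (Suc j) y x t) (at t)"
proof -
  have c: "(count_list is)(i := Suc (count_list is i)) = count_list (i # is)" for i and "is" :: "'a list"
    by auto
  have D: "((\<lambda>t. tprod b (count_list is) (x + t *\<^sub>R (- y))) has_real_derivative
     (\<Sum>i\<in>UNIV. (- y) $ i * tprod b (count_list (i # is)) (x + t *\<^sub>R (- y)))) (at t)" for "is"
    using tprod_line_deriv[OF b, of "count_list is" x "- y" t] unfolding c .
  have "((\<lambda>t. \<Sum>is | length is = j. vmonom is y * tprod b (count_list is) (x + t *\<^sub>R (- y))) has_real_derivative
     (\<Sum>is | length is = j. vmonom is y * (\<Sum>i\<in>UNIV. (- y) $ i * tprod b (count_list (i # is)) (x + t *\<^sub>R (- y))))) (at t)"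
    by (intro DERIV_sum DERIV_cmult D)
  moreover have "(\<Sum>is | length is = j. vmonom is y * (\<Sum>i\<in>UNIV. (- y) $ i * tprod b (count_list (i # is)) (x + t *\<^sub>R (- y))))
     = - dirderiv b (Suc j) y x t"
    unfolding dirderiv_def sum_lists_Suc
    by (subst sum.swap) (simp add: sum_distrib_left sum_negf vmonom_def mult_ac)
  ultimately show ?thesis by (simp add: dirderiv_def[abs_def])
qed

text \<open>The sum telescopes: differentiating the power in one summand cancels the derivative of
  \<open>dirderiv\<close> in the preceding one, which leaves only the last.\<close>

lemma Taylor_deriv:
  assumes b: "tensor_test b"
  shows "((\<lambda>t. \<Sum>j\<le>p. t ^ j / fact j * dirderiv b j y x t) has_real_derivative
     - (t ^ p / fact p * dirderiv b (Suc p) y x t)) (at t)"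
proof (induction p)
  case 0
  then show ?case using dirderiv_deriv[OF b, of 0 y x t] by simp
next
  case (Suc p)
  have "((\<lambda>t. t ^ Suc p / fact (Suc p)) has_real_derivative real (Suc p) * t ^ p / fact (Suc p)) (at t)"
    by (rule derivative_eq_intros refl | simp)+
  moreover have "real (Suc p) * t ^ p / fact (Suc p) = t ^ p / fact p" by (simp del: of_nat_Suc)
  ultimately have "((\<lambda>t. t ^ Suc p / fact (Suc p)) has_real_derivative t ^ p / fact p) (at t)" by (simp only:)
  from DERIV_add[OF Suc DERIV_mult[OF this dirderiv_deriv[OF b, of "Suc p" y x t]]]
  show ?case by (simp add: algebra_simps del: fact_Suc)
qed

lemma dirderiv_cont: "tensor_test b \<Longrightarrow> isCont (dirderiv b j y x) t"
  using dirderiv_deriv DERIV_isCont by blast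

lemma Taylor_identity:
  assumes b: "tensor_test b"
  shows "tprod b (\<lambda>_. 0) x =
    (\<Sum>j\<le>p. 1 / fact j * dirderiv b j y x 1) + (\<integral>t. tweight p t * dirderiv b (Suc p) y x t \<partial>lborel)"
proof -
  let ?F = "\<lambda>t. - (\<Sum>j\<le>p. t ^ j / fact j * dirderiv b j y x t)"
  have "(\<integral>t. t ^ p / fact p * dirderiv b (Suc p) y x t * indicator {0..1} t \<partial>lborel) = ?F 1 - ?F 0"
  proof (rule integral_FTC_Icc_real)
    show "(?F has_real_derivative t ^ p / fact p * dirderiv b (Suc p) y x t) (at t)" for t
      using DERIV_minus[OF Taylor_deriv[OF b, where p=p and y=y and x=x and t=t]] by simp
    show "isCont (\<lambda>t. t ^ p / fact p * dirderiv b (Suc p) y x t) t" for t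
      by (intro continuous_intros dirderiv_cont b) auto
  qed simp
  moreover have "(\<lambda>t. tweight p t * dirderiv b (Suc p) y x t) =
      (\<lambda>t. t ^ p / fact p * dirderiv b (Suc p) y x t * indicator {0..1} t)"
    by (simp add: tweight_def fun_eq_iff)
  \<comment> \<open>At t = 0 only the summand j = 0 survives, since
    \<open>0 ^ 0 = 1\<close>.\<close>
  moreover have "(\<Sum>j\<le>p. 0 ^ j / fact j * dirderiv b j y x 0) = (\<Sum>j\<le>p. if j = 0 then tprod b (\<lambda>_. 0) x else 0)"
    by (intro sum.cong) (auto simp: dirderiv_0)
  ultimately show ?thesis by simp
qed

text \<open>A continuous weight suffices for the averaging, because derivatives are taken along rays
  and never moved onto the weight.\<close>

definition tent :: "real^'n::finite \<Rightarrow> real" where "tent y = max 0 (1 - norm y)"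

definition mker :: "'n::finite list \<Rightarrow> real^'n \<Rightarrow> real" where "mker is y = tent y * vmonom is y"

lemma vmonom_cont: "continuous_on A (vmonom is)"
  unfolding vmonom_def by (induction "is") (auto intro!: continuous_intros)

lemma vmonom_le: "norm y \<le> 1 \<Longrightarrow> \<bar>vmonom is y\<bar> \<le> 1"
proof (induction "is")
  case (Cons i "is")
  have "\<bar>y $ i\<bar> \<le> 1" using component_le_norm_cart[of y i] Cons by simp
  then show ?case using Cons by (auto simp: vmonom_def abs_mult intro!: mult_le_one)
qed (simp add: vmonom_def)

lemma kernel_mker: "kernel (mker (is :: 'n::finite list))"
  unfolding kernel_def
proof safe
  show "continuous_on UNIV (mker is)"
    unfolding mker_def[abs_def] tent_def by (intro continuous_intros vmonom_cont)
  fix y :: "real^'n"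
  show "\<bar>mker is y\<bar> \<le> indicator (cball 0 1) y"
  proof (cases "norm y \<le> 1")
    case True
    then have "\<bar>tent y\<bar> * \<bar>vmonom is y\<bar> \<le> 1" by (intro mult_le_one vmonom_le) (auto simp: tent_def)
    then show ?thesis using True by (simp add: mker_def abs_mult)
  qed (simp add: mker_def tent_def)
qed

lemma kernel_tent: "kernel tent"
  using kernel_mker[of "[]"] by (simp add: mker_def[abs_def] vmonom_def)

definition cmass :: "'n::finite itself \<Rightarrow> real" where
  "cmass _ = (\<integral>y. tent (y :: real^'n) \<partial>lborel)"

lemma cmass_pos: "cmass TYPE('n::finite) > 0"
proof -
  have nn: "AE y in lborel. 0 \<le> tent (y :: real^'n)" by (simp add: tent_def)
  have "cmass TYPE('n) \<noteq> 0"
  proof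
    assume "cmass TYPE('n) = 0"
    then have "AE y in lborel. tent (y :: real^'n) = 0"
      using integral_nonneg_eq_0_iff_AE[OF kernel_square(3)[OF kernel_tent] nn] by (simp add: cmass_def)
    then have "tent (0 :: real^'n) = 0"
      using kernel_tent by (intro continuous_AE_eq) (auto simp: kernel_def)
    then show False by (simp add: tent_def)
  qed
  moreover have "cmass TYPE('n) \<ge> 0" unfolding cmass_def by (rule integral_nonneg_AE[OF nn])
  ultimately show ?thesis by simp
qed

lemma tprod_bounded:
  assumes b: "tensor_test b" obtains B where "\<And>x. \<bar>tprod b c x\<bar> \<le> B" "B \<ge> 0"
proof -
  obtain R where R: "\<And>c x. norm x \<ge> R \<Longrightarrow> tprod b c x = 0"
    using tprod_bounded_support[OF b] by metis
  have "bounded (tprod b c ` cball 0 R)"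
    by (intro compact_imp_bounded compact_continuous_image tprod_cont b) auto
  then obtain B where "\<forall>x\<in>cball 0 R. \<bar>tprod b c x\<bar> \<le> B"
    by (auto simp: bounded_iff)
  then have B: "\<And>x. norm x \<le> R \<Longrightarrow> \<bar>tprod b c x\<bar> \<le> B" by simp
  have "\<bar>tprod b c x\<bar> \<le> max B 0" for x
    using B[of x] R[of x c] by (cases "norm x \<le> R") auto
  then show thesis using that by fastforce
qed

lemma tweight_kernel_integrable:
  fixes k :: "'a::euclidean_space \<Rightarrow> real"
  assumes k: "kernel k"
  shows "integrable (lborel \<Otimes>\<^sub>M lborel) (\<lambda>w. tweight p (fst w) * k (snd w))"
proof (rule lborel_pair.Fubini_integrable)
  have [measurable]: "k \<in> borel_measurable borel" using k by measurable
  have t: "integrable lborel (tweight p)"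
  proof -
    have "integrable lborel (\<lambda>t. indicator {0..1} t *\<^sub>R (t ^ p / fact p :: real))"
      by (rule borel_integrable_compact[unfolded set_integrable_def]) (auto intro!: continuous_intros)
    then show ?thesis by (simp add: tweight_def[abs_def])
  qed
  show "(\<lambda>w. tweight p (fst w) * k (snd w)) \<in> borel_measurable (lborel \<Otimes>\<^sub>M lborel)" by measurable
  have "(\<lambda>t. \<integral>y. norm (tweight p (fst (t, y)) * k (snd (t, y))) \<partial>lborel) =
     (\<lambda>t. \<bar>tweight p t\<bar> * (\<integral>y. \<bar>k y\<bar> \<partial>lborel))" by (simp add: abs_mult)
  then show "integrable lborel (\<lambda>t. \<integral>y. norm (tweight p (fst (t, y)) * k (snd (t, y))) \<partial>lborel)"
    using t by simp
  show "AE t in lborel. integrable lborel (\<lambda>y. tweight p (fst (t, y)) * k (snd (t, y)))"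
    using kernel_square(3)[OF k] by simp
qed

text \<open>Taylor's formula holds for every y; multiplying by \<open>tent y\<close> and integrating
  replaces point values of derivatives by convolutions, a form that can be paired with
  \<open>f\<close>.\<close>

lemma averaged_Taylor:
  fixes b :: "'n::finite \<Rightarrow> nat \<Rightarrow> real \<Rightarrow> real"
  assumes b: "tensor_test b"
  shows "cmass TYPE('n) * tprod b (\<lambda>_. 0) x =
    (\<Sum>j\<le>p. \<Sum>is | length is = j. 1 / fact j * (\<integral>y. mker is y * tprod b (count_list is) (x - y) \<partial>lborel)) +
    (\<Sum>is | length is = Suc p. \<integral>w. (tweight p (fst w) * mker is (snd w)) *
        tprod b (count_list is) (x - fst w *\<^sub>R snd w) \<partial>(lborel \<Otimes>\<^sub>M lborel))"
proof -
  let ?P = "\<lambda>is. tprod b (count_list is)"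
  let ?I = "\<lambda>is y. \<integral>t. (tweight p t * mker is y) * ?P is (x - t *\<^sub>R y) \<partial>lborel"
  have m[measurable]: "?P is \<in> borel_measurable borel" for "is"
    by (intro borel_measurable_continuous_onI tprod_cont b)
  have km[measurable]: "mker is \<in> borel_measurable borel" for "is" :: "'n list" using kernel_mker by measurable
  have 1: "integrable lborel (\<lambda>y. mker is y * ?P is (x - y))" for "is"
  proof (rule tprod_bounded[OF b])
    fix B assume B: "\<And>x. \<bar>?P is x\<bar> \<le> B"
    show ?thesis
      by (rule Bochner_Integration.integrable_bound[OF integrable_mult_left[OF kernel_square(3)[OF kernel_mker[of "is"]], where c=B]])
         (auto simp: abs_mult intro!: AE_I2 mult_left_mono order_trans[OF B abs_ge_self])
  qed
  have 2: "integrable (lborel \<Otimes>\<^sub>M lborel) (\<lambda>w. (tweight p (fst w) * mker is (snd w)) * ?P is (x - fst w *\<^sub>R snd w))" for "is"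
  proof (rule tprod_bounded[OF b])
    fix B assume B: "\<And>x. \<bar>?P is x\<bar> \<le> B"
    show ?thesis
      by (rule Bochner_Integration.integrable_bound[OF integrable_mult_left[OF tweight_kernel_integrable[OF kernel_mker[of "is"]], where c=B]])
         (auto simp: abs_mult intro!: AE_I2 mult_left_mono order_trans[OF B abs_ge_self])
  qed
  have two: "integrable (lborel \<Otimes>\<^sub>M lborel) (\<lambda>(t, y). (tweight p t * mker is y) * ?P is (x - t *\<^sub>R y))" for "is"
    using 2[of "is"] by (simp add: case_prod_beta')
  note i3 = lborel_pair.integrable_snd[OF two] and i4 = lborel_pair.integral_snd[OF two]
  have pt: "tent y * tprod b (\<lambda>_. 0) x =
     (\<Sum>j\<le>p. \<Sum>is | length is = j. 1 / fact j * (mker is y * ?P is (x - y))) + (\<Sum>is | length is = Suc p. ?I is y)" for y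
  proof -
    have "integrable lborel (\<lambda>t. tweight p t * mker is y * ?P is (x - t *\<^sub>R y))" for "is"
    proof -
      have "integrable lborel (\<lambda>t. indicator {0..1} t *\<^sub>R (t ^ p / fact p * (mker is y * ?P is (x - t *\<^sub>R y))))"
        by (rule borel_integrable_compact[unfolded set_integrable_def])
           (auto intro!: continuous_intros continuous_on_compose2[OF tprod_cont[OF b, of UNIV]])
      then show ?thesis by (simp add: tweight_def mult_ac)
    qed
    then have "(\<Sum>is | length is = Suc p. ?I is y) =
       (\<integral>t. (\<Sum>is | length is = Suc p. tweight p t * mker is y * ?P is (x - t *\<^sub>R y)) \<partial>lborel)"
      by (subst Bochner_Integration.integral_sum) auto
    also have "\<dots> = (\<integral>t. tent y * (tweight p t * dirderiv b (Suc p) y x t) \<partial>lborel)"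
      by (simp add: dirderiv_def sum_distrib_left mker_def mult_ac)
    also have "\<dots> = tent y * (\<integral>t. tweight p t * dirderiv b (Suc p) y x t \<partial>lborel)" by simp
    finally have A: "(\<Sum>is | length is = Suc p. ?I is y) = tent y * (\<integral>t. tweight p t * dirderiv b (Suc p) y x t \<partial>lborel)" .
    have B: "(\<Sum>j\<le>p. \<Sum>is | length is = j. 1 / fact j * (mker is y * ?P is (x - y))) =
        tent y * (\<Sum>j\<le>p. 1 / fact j * dirderiv b j y x 1)"
      by (simp add: dirderiv_def sum_distrib_left sum_divide_distrib mker_def mult_ac)
    show ?thesis unfolding A B Taylor_identity[OF b, where x=x and p=p and y=y] by (simp add: algebra_simps)
  qed
  have "cmass TYPE('n) * tprod b (\<lambda>_. 0) x = (\<integral>y. tent (y :: real^'n) * tprod b (\<lambda>_. 0) x \<partial>lborel)"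
    by (simp add: cmass_def)
  also have "\<dots> = (\<integral>y. (\<Sum>j\<le>p. \<Sum>is | length is = j. 1 / fact j * (mker is y * ?P is (x - y))) +
     (\<Sum>is | length is = Suc p. ?I is y) \<partial>lborel)" by (simp only: pt)
  also have "\<dots> = (\<Sum>j\<le>p. \<Sum>is | length is = j. 1 / fact j * (\<integral>y. mker is y * ?P is (x - y) \<partial>lborel)) +
     (\<Sum>is | length is = Suc p. \<integral>y. ?I is y \<partial>lborel)"
  proof (subst Bochner_Integration.integral_add)
    show "integrable lborel (\<lambda>y. \<Sum>j\<le>p. \<Sum>is | length is = j. 1 / fact j * (mker is y * ?P is (x - y)))"
      by (intro Bochner_Integration.integrable_sum integrable_mult_right 1)
    show "integrable lborel (\<lambda>y. \<Sum>is | length is = Suc p. ?I is y)"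
      by (intro Bochner_Integration.integrable_sum i3)
  next
    have "(\<integral>y. (\<Sum>j\<le>p. \<Sum>is | length is = j. 1 / fact j * (mker is y * ?P is (x - y))) \<partial>lborel) =
       (\<Sum>j\<le>p. \<Sum>is | length is = j. \<integral>y. 1 / fact j * (mker is y * ?P is (x - y)) \<partial>lborel)"
      by (subst Bochner_Integration.integral_sum, intro Bochner_Integration.integrable_sum integrable_mult_right 1)
         (intro sum.cong refl Bochner_Integration.integral_sum integrable_mult_right 1)
    moreover have "(\<integral>y. (\<Sum>is | length is = Suc p. ?I is y) \<partial>lborel) = (\<Sum>is | length is = Suc p. \<integral>y. ?I is y \<partial>lborel)"
      by (intro Bochner_Integration.integral_sum i3)
    ultimately show "(\<integral>y. (\<Sum>j\<le>p. \<Sum>is | length is = j. 1 / fact j * (mker is y * ?P is (x - y))) \<partial>lborel) +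
       (\<integral>y. (\<Sum>is | length is = Suc p. ?I is y) \<partial>lborel) =
       (\<Sum>j\<le>p. \<Sum>is | length is = j. 1 / fact j * (\<integral>y. mker is y * ?P is (x - y) \<partial>lborel)) +
       (\<Sum>is | length is = Suc p. \<integral>y. ?I is y \<partial>lborel)"
      by (simp only: integral_mult_right_zero)
  qed
  finally show ?thesis unfolding i4 by (simp add: case_prod_beta')
qed

subsection \<open>Sobolev embedding\<close>

text \<open>The averaged Taylor formula after transposition, with \<open>g is\<close> in the role of
  the weak derivative of \<open>f\<close> along \<open>is\<close>. The signs are those of
  integration by parts.\<close>

definition sobrep :: "nat \<Rightarrow> ('n::finite list \<Rightarrow> real^'n \<Rightarrow> real) \<Rightarrow> real^'n \<Rightarrow> real" where
  "sobrep p g x =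
    ((\<Sum>j\<le>p. \<Sum>is | length is = j. (-1) ^ j / fact j * avg (mker is) (g is) 1 x) +
     (\<Sum>is | length is = Suc p. (-1) ^ Suc p * tavg p (mker is) (g is) x)) / cmass TYPE('n)"

lemma sobrep_continuous:
  fixes g :: "'n::finite list \<Rightarrow> real^'n \<Rightarrow> real"
  assumes n: "CARD('n) \<le> 2 * p + 1" and g: "\<And>is. length is \<le> Suc p \<Longrightarrow> L2 (g is)"
  shows "continuous_on UNIV (sobrep p g)"
proof -
  have 1: "continuous_on UNIV (avg (mker is) (g is) 1)" if "length is \<le> p" for "is"
    using that L2_D[OF g[of "is"]] by (intro avg_continuous kernel_mker) auto
  have 2: "continuous_on UNIV (tavg p (mker is) (g is))" if "length is = Suc p" for "is"
    using that L2_D[OF g[of "is"]] n by (intro tavg_bound(2) kernel_mker) auto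
  show ?thesis unfolding sobrep_def[abs_def] using cmass_pos[where 'n='n]
    by (intro continuous_intros 1 2) auto
qed

text \<open>The constant is fixed before \<open>g\<close>, \<open>N\<close> and \<open>x\<close>;
  this uniformity later lets convergence in H^m control pointwise values.\<close>

lemma sobrep_bound:
  assumes n: "CARD('n::finite) \<le> 2 * p + 1"
  obtains C where "C \<ge> 0" "\<And>(g :: 'n list \<Rightarrow> real^'n \<Rightarrow> real) N x.
    (\<And>is. length is \<le> Suc p \<Longrightarrow> L2 (g is) \<and> sqrt (\<integral>x. (g is x)\<^sup>2 \<partial>lborel) \<le> N) \<Longrightarrow> \<bar>sobrep p g x\<bar> \<le> C * N"
proof -
  define V where "V = sqrt (measure lborel (cball 0 1 :: (real^'n) set))"
  define I where "I = (\<integral>t. indicator {0..1} t / sqrt t \<partial>lborel)"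
  have V: "V \<ge> 0" by (simp add: V_def)
  have I: "I \<ge> 0" unfolding I_def by (intro integral_nonneg_AE) (auto simp: indicator_def)
  define C where "C = ((\<Sum>j\<le>p. \<Sum>is | length (is :: 'n list) = j. V) + (\<Sum>is | length (is :: 'n list) = Suc p. V * I)) / cmass TYPE('n)"
  have C: "C \<ge> 0" unfolding C_def using V I cmass_pos[where 'n='n]
    by (intro divide_nonneg_pos add_nonneg_nonneg sum_nonneg) auto
  have "\<bar>sobrep p g x\<bar> \<le> C * N"
    if g: "\<And>is. length is \<le> Suc p \<Longrightarrow> L2 (g is) \<and> sqrt (\<integral>x. (g is x)\<^sup>2 \<partial>lborel) \<le> N"
    for g :: "'n list \<Rightarrow> real^'n \<Rightarrow> real" and N x
  proof -
    have gN: "L2 (g is)" "sqrt (\<integral>x. (g is x)\<^sup>2 \<partial>lborel) \<le> N" if "length is \<le> Suc p" for "is" using g that by auto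
    have N: "N \<ge> 0"
    proof (rule order_trans)
      show "0 \<le> sqrt (\<integral>x. (g [] x)\<^sup>2 \<partial>lborel)" by (simp add: integral_nonneg_AE)
      show "sqrt (\<integral>x. (g [] x)\<^sup>2 \<partial>lborel) \<le> N" using gN(2)[of "[]"] by simp
    qed
    have 1: "\<bar>(-1) ^ j / fact j * avg (mker is) (g is) 1 x\<bar> \<le> V * N" if "j \<le> p" "length is = j" for "is" j
    proof -
      have "\<bar>avg (mker is) (g is) 1 x\<bar> \<le> V * sqrt (\<integral>x. (g is x)\<^sup>2 \<partial>lborel)"
        using avg_bound(3)[OF kernel_mker L2_D[OF gN(1)[of "is"]], of 1 "is" x] that by (simp add: V_def)
      also have "\<dots> \<le> V * N" using gN(2)[of "is"] that V by (intro mult_left_mono) auto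
      finally have *: "\<bar>avg (mker is) (g is) 1 x\<bar> \<le> V * N" .
      have "\<bar>(-1) ^ j / fact j * avg (mker is) (g is) 1 x\<bar> = 1 / fact j * \<bar>avg (mker is) (g is) 1 x\<bar>"
        by (simp add: abs_mult power_abs)
      also have "\<dots> \<le> 1 * \<bar>avg (mker is) (g is) 1 x\<bar>" by (intro mult_right_mono) auto
      finally show ?thesis using * by simp
    qed
    have 2: "\<bar>(-1) ^ Suc p * tavg p (mker is) (g is) x\<bar> \<le> V * I * N" if "length is = Suc p" for "is"
    proof -
      have "\<bar>tavg p (mker is) (g is) x\<bar> \<le> V * I * sqrt (\<integral>x. (g is x)\<^sup>2 \<partial>lborel)"
        using tavg_bound(1)[OF kernel_mker L2_D[OF gN(1)[of "is"]], of p "is" x] that n by (simp add: V_def I_def)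
      also have "\<dots> \<le> V * I * N" using gN(2)[of "is"] that V I by (intro mult_left_mono) auto
      finally show ?thesis by (simp add: abs_mult power_abs)
    qed
    have "\<bar>sobrep p g x\<bar> = \<bar>(\<Sum>j\<le>p. \<Sum>is | length is = j. (-1) ^ j / fact j * avg (mker is) (g is) 1 x) +
       (\<Sum>is | length is = Suc p. (-1) ^ Suc p * tavg p (mker is) (g is) x)\<bar> / cmass TYPE('n)"
      using cmass_pos[where 'n='n] by (simp add: sobrep_def abs_divide)
    also have "\<dots> \<le> ((\<Sum>j\<le>p. \<Sum>is | length (is :: 'n list) = j. V * N) + (\<Sum>is | length (is :: 'n list) = Suc p. V * I * N)) / cmass TYPE('n)"
    proof (intro divide_right_mono order_trans[OF abs_triangle_ineq] add_mono)
      show "\<bar>\<Sum>j\<le>p. \<Sum>is | length is = j. (-1) ^ j / fact j * avg (mker is) (g is) 1 x\<bar> \<le> (\<Sum>j\<le>p. \<Sum>is | length (is :: 'n list) = j. V * N)"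
        by (intro order_trans[OF sum_abs] sum_mono) (use 1 in auto)
      show "\<bar>\<Sum>is | length is = Suc p. (-1) ^ Suc p * tavg p (mker is) (g is) x\<bar> \<le> (\<Sum>is | length (is :: 'n list) = Suc p. V * I * N)"
        by (intro order_trans[OF sum_abs] sum_mono) (use 2 in auto)
    qed (use cmass_pos[where 'n='n] in simp)
    also have "\<dots> = C * N" unfolding C_def by (simp only: sum_distrib_right distrib_right times_divide_eq_left)
    finally show ?thesis .
  qed
  with C show thesis using that by blast
qed

lemma continuous_box_integrable:
  fixes f :: "'a::euclidean_space \<Rightarrow> real"
  assumes "continuous_on UNIV f"
  shows "integrable lborel (\<lambda>x. f x * indicator (box l u) x)"
proof -
  have "set_integrable lborel (cbox l u) f"
    unfolding set_integrable_def
    by (rule borel_integrable_compact) (auto intro: continuous_on_subset[OF assms])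
  then have "set_integrable lborel (box l u) f"
    by (rule set_integrable_subset) (auto simp: box_subset_cbox)
  then show ?thesis by (simp add: set_integrable_def mult.commute)
qed

lemma L2_box_integrable: "L2 f \<Longrightarrow> integrable lborel (\<lambda>x. f x * indicator (box l u) x)"
proof (rule L2_mult_integrable)
  have "(indicator (box l u) x)\<^sup>2 = (indicator (box l u) x :: real)" for x :: "real^'a"
    by (simp add: indicator_def)
  then show "integrable lborel (\<lambda>x :: real^'a. (indicator (box l u) x)\<^sup>2 :: real)"
    using emeasure_bounded_finite[OF bounded_box] by (simp add: integrable_indicator_iff)
qed (auto simp: L2_def)

lemma tprod_mult_integrable:
  assumes b: "tensor_test b" and f: "continuous_on UNIV f"
  shows "integrable lborel (\<lambda>x. tprod b c x * f x)"
proof (rule tprod_bounded_support[OF b])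
  fix B assume "\<And>c x. norm x \<ge> B \<Longrightarrow> tprod b c x = 0"
  then show ?thesis
    by (intro L2_continuous_bounded_support(2)[of _ B] continuous_intros tprod_cont b f) auto
qed

text \<open>Both sides are paired with an arbitrary tensor function. The averaged Taylor formula is
  inserted for the test function, every derivative is moved onto \<open>f\<close>, and what appears
  is the pairing with the continuous function \<open>sobrep p g\<close>.\<close>

theorem sobrep_AE:
  fixes f :: "real^'n::finite \<Rightarrow> real"
  assumes n: "CARD('n) \<le> 2 * p + 1" and f: "L2 f"
    and g: "\<And>is. length is \<le> Suc p \<Longrightarrow> L2 (g is)"
    and w: "\<And>is. length is \<le> Suc p \<Longrightarrow> weak_deriv is f (g is)"
  shows "AE x in lborel. f x = sobrep p g x"
proof -
  let ?R = "sobrep p g" and ?Z = "cmass TYPE('n)"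
  have c: "continuous_on UNIV ?R" using sobrep_continuous[of p g, OF n g] by simp
  have [measurable]: "f \<in> borel_measurable borel" "?R \<in> borel_measurable borel"
    using L2_D[OF f] c by (auto intro: borel_measurable_continuous_onI)
  have "AE x in lborel. f x - ?R x = 0"
  proof (rule fundamental_lemma_AE)
    show "integrable lborel (\<lambda>x. (f x - ?R x) * indicator (box l u) x)" for l u
      using L2_box_integrable[OF f] continuous_box_integrable[OF c] by (simp add: left_diff_distrib)
    fix b :: "'n \<Rightarrow> nat \<Rightarrow> real \<Rightarrow> real" assume b: "tensor_test b"
    let ?q = "tprod b (\<lambda>_. 0)" and ?P = "\<lambda>is. tprod b (count_list is)"
    let ?A = "\<lambda>is x. \<integral>y. mker is y * ?P is (x - y) \<partial>lborel"
    let ?B = "\<lambda>is x. \<integral>w. (tweight p (fst w) * mker is (snd w)) * ?P is (x - fst w *\<^sub>R snd w) \<partial>(lborel \<Otimes>\<^sub>M lborel)"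
    have M2: "sigma_finite_measure (lborel \<Otimes>\<^sub>M lborel :: (real \<times> (real^'n)) measure)"
      unfolding lborel_prod by (rule sigma_finite_lborel)
    have A: "(\<integral>x. f x * ?A is x \<partial>lborel) = (-1) ^ length is * (\<integral>x. ?q x * avg (mker is) (g is) 1 x \<partial>lborel)"
      "integrable lborel (\<lambda>x. f x * ?A is x)" if "length is \<le> Suc p" for "is"
      using weak_deriv_conv[OF b w[OF that] f g[OF that] sigma_finite_lborel kernel_square(3)[OF kernel_mker[of "is"]], of "\<lambda>y. y"]
      by (auto simp: avg_def)
    have B: "(\<integral>x. f x * ?B is x \<partial>lborel) = (-1) ^ length is * (\<integral>x. ?q x * tavg p (mker is) (g is) x \<partial>lborel)"
      "integrable lborel (\<lambda>x. f x * ?B is x)" if "length is \<le> Suc p" for "is"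
      using weak_deriv_conv[OF b w[OF that] f g[OF that] M2 tweight_kernel_integrable[OF kernel_mker[of "is"]], of "\<lambda>w. fst w *\<^sub>R snd w"]
        tavg_eq[OF kernel_mker[of "is"] L2_D[OF g[OF that]], of p] n
      by auto
    have qA: "integrable lborel (\<lambda>x. ?q x * avg (mker is) (g is) 1 x)" if "length is \<le> Suc p" for "is"
      using L2_D[OF g[OF that]] by (intro tprod_mult_integrable b avg_continuous kernel_mker) auto
    have qB: "integrable lborel (\<lambda>x. ?q x * tavg p (mker is) (g is) x)" if "length is \<le> Suc p" for "is"
      using L2_D[OF g[OF that]] n by (intro tprod_mult_integrable b tavg_bound(2) kernel_mker) auto
    have i1: "integrable lborel (\<lambda>x. f x * ?q x)"
      using L2_D[OF f] L2_D[OF L2_tprod[OF b]] by (intro L2_mult_integrable) auto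
    have i2: "integrable lborel (\<lambda>x. ?q x * ?R x)" by (rule tprod_mult_integrable[OF b c])
    have "?Z * (\<integral>x. f x * ?q x \<partial>lborel) = (\<integral>x. f x * (?Z * ?q x) \<partial>lborel)"
      by (subst integral_mult_right_zero[symmetric]) (simp add: mult_ac)
    also have "\<dots> = (\<integral>x. (\<Sum>j\<le>p. \<Sum>is | length is = j. 1 / fact j * (f x * ?A is x)) +
        (\<Sum>is | length is = Suc p. f x * ?B is x) \<partial>lborel)"
      unfolding averaged_Taylor[OF b, where p=p]
      by (simp add: distrib_left sum_distrib_left)
    also have "\<dots> = (\<integral>x. (\<Sum>j\<le>p. \<Sum>is | length is = j. 1 / fact j * (f x * ?A is x)) \<partial>lborel) +
        (\<integral>x. (\<Sum>is | length is = Suc p. f x * ?B is x) \<partial>lborel)"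
      by (intro Bochner_Integration.integral_add Bochner_Integration.integrable_sum integrable_mult_right A(2) B(2)) auto
    also have "(\<integral>x. (\<Sum>j\<le>p. \<Sum>is | length is = j. 1 / fact j * (f x * ?A is x)) \<partial>lborel) =
        (\<Sum>j\<le>p. \<integral>x. (\<Sum>is | length is = j. 1 / fact j * (f x * ?A is x)) \<partial>lborel)"
      by (intro Bochner_Integration.integral_sum Bochner_Integration.integrable_sum integrable_mult_right A(2)) auto
    also have "\<dots> = (\<Sum>j\<le>p. \<Sum>is | length is = j. \<integral>x. 1 / fact j * (f x * ?A is x) \<partial>lborel)"
      by (intro sum.cong refl Bochner_Integration.integral_sum Bochner_Integration.integrable_sum integrable_mult_right A(2)) auto
    also have "\<dots> = (\<Sum>j\<le>p. \<Sum>is | length is = j. \<integral>x. (-1) ^ j / fact j * (?q x * avg (mker is) (g is) 1 x) \<partial>lborel)"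
      by (intro sum.cong refl) (simp only: integral_mult_right_zero, simp add: A(1))
    also have "\<dots> = (\<Sum>j\<le>p. \<integral>x. (\<Sum>is | length is = j. (-1) ^ j / fact j * (?q x * avg (mker is) (g is) 1 x)) \<partial>lborel)"
      by (intro sum.cong refl Bochner_Integration.integral_sum[symmetric] Bochner_Integration.integrable_sum integrable_mult_right qA) auto
    also have "\<dots> = (\<integral>x. (\<Sum>j\<le>p. \<Sum>is | length is = j. (-1) ^ j / fact j * (?q x * avg (mker is) (g is) 1 x)) \<partial>lborel)"
      by (intro Bochner_Integration.integral_sum[symmetric] Bochner_Integration.integrable_sum integrable_mult_right qA) auto
    also have "(\<integral>x. (\<Sum>is | length is = Suc p. f x * ?B is x) \<partial>lborel) = (\<Sum>is | length is = Suc p. \<integral>x. f x * ?B is x \<partial>lborel)"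
      by (intro Bochner_Integration.integral_sum B(2)) auto
    also have "\<dots> = (\<Sum>is | length is = Suc p. \<integral>x. (-1) ^ Suc p * (?q x * tavg p (mker is) (g is) x) \<partial>lborel)"
      by (intro sum.cong refl) (simp only: integral_mult_right_zero, simp add: B(1))
    also have "\<dots> = (\<integral>x. (\<Sum>is | length is = Suc p. (-1) ^ Suc p * (?q x * tavg p (mker is) (g is) x)) \<partial>lborel)"
      by (intro Bochner_Integration.integral_sum[symmetric] integrable_mult_right qB) auto
    also have "(\<integral>x. (\<Sum>j\<le>p. \<Sum>is | length is = j. (-1) ^ j / fact j * (?q x * avg (mker is) (g is) 1 x)) \<partial>lborel) + \<dots> =
       (\<integral>x. (\<Sum>j\<le>p. \<Sum>is | length is = j. (-1) ^ j / fact j * (?q x * avg (mker is) (g is) 1 x)) +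
          (\<Sum>is | length is = Suc p. (-1) ^ Suc p * (?q x * tavg p (mker is) (g is) x)) \<partial>lborel)"
      by (intro Bochner_Integration.integral_add[symmetric] Bochner_Integration.integrable_sum integrable_mult_right qA qB) auto
    also have "\<dots> = (\<integral>x. ?Z * (?q x * ?R x) \<partial>lborel)"
    proof (intro Bochner_Integration.integral_cong refl)
      fix x
      have "?Z * ?R x = (\<Sum>j\<le>p. \<Sum>is | length is = j. (-1) ^ j / fact j * avg (mker is) (g is) 1 x) +
          (\<Sum>is | length is = Suc p. (-1) ^ Suc p * tavg p (mker is) (g is) x)"
        using cmass_pos[where 'n='n] by (simp add: sobrep_def)
      then have "?Z * (?q x * ?R x) = ?q x * (\<dots>)" by (simp only: mult.left_commute[of ?Z])
      then show "(\<Sum>j\<le>p. \<Sum>is | length is = j. (-1) ^ j / fact j * (?q x * avg (mker is) (g is) 1 x)) +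
          (\<Sum>is | length is = Suc p. (-1) ^ Suc p * (?q x * tavg p (mker is) (g is) x)) = ?Z * (?q x * ?R x)"
        by (simp only: distrib_left sum_distrib_left mult.left_commute[of "?q x"])
    qed
    finally have "?Z * (\<integral>x. f x * ?q x \<partial>lborel) = ?Z * (\<integral>x. ?q x * ?R x \<partial>lborel)" by simp
    then have "(\<integral>x. f x * ?q x \<partial>lborel) = (\<integral>x. ?q x * ?R x \<partial>lborel)" using cmass_pos[where 'n='n] by simp
    then show "(\<integral>x. (f x - ?R x) * ?q x \<partial>lborel) = 0"
      using i1 i2 by (simp add: left_diff_distrib mult.commute[of "?R _"])
  qed measurable
  then show ?thesis by eventually_elim simp
qed

text \<open>The fundamental theorem of calculus along the axis holds for test functions. Transposed
  with the weight \<open>indicator {0..r}\<close> it says that f (x + r e) - f x is the integral of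
  \<open>g\<close> along the segment for almost every x, and continuity extends this to every
  x.\<close>

lemma weak_deriv_imp_classical:
  fixes f g :: "real^'n::finite \<Rightarrow> real"
  assumes cf: "continuous_on UNIV f" and cg: "continuous_on UNIV g"
    and f: "L2 f" and g: "L2 g" and w: "weak_deriv [i] f g"
  shows "((\<lambda>h. f (x + h *\<^sub>R axis i 1)) has_real_derivative g x) (at 0)"
proof -
  let ?e = "axis i 1 :: real^'n"
  let ?G = "\<lambda>r x. \<integral>s. indicator {0..r} s * g (x + s *\<^sub>R ?e) \<partial>lborel"
  have Geq: "?G r x = integral {0..r} (\<lambda>s. g (x + s *\<^sub>R ?e))" for r x
  proof -
    have "set_integrable lborel {0..r} (\<lambda>s. g (x + s *\<^sub>R ?e))"
      unfolding set_integrable_def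
      by (rule borel_integrable_compact)
         (auto intro!: continuous_intros continuous_on_compose2[OF cg])
    from set_borel_integral_eq_integral(2)[OF this] show ?thesis
      by (simp add: set_lebesgue_integral_def)
  qed
  have cG: "continuous_on UNIV (?G r)" for r
  proof -
    have "continuous_on UNIV (\<lambda>x. integral (cbox 0 r) (\<lambda>s. g (x + s *\<^sub>R ?e)))"
      by (rule integral_continuous_on_param)
         (auto simp: case_prod_beta' intro!: continuous_intros continuous_on_compose2[OF cg])
    then show ?thesis unfolding Geq by simp
  qed
  have main: "f (x + r *\<^sub>R ?e) = f x + ?G r x" if r: "r \<ge> 0" for r x
  proof -
    have cs: "continuous_on UNIV (\<lambda>x. f (x + r *\<^sub>R ?e))"
      by (auto intro!: continuous_intros continuous_on_compose2[OF cf])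
    have ch: "continuous_on UNIV (\<lambda>x. f (x + r *\<^sub>R ?e) - f x - ?G r x)"
      by (intro continuous_on_diff cs cf cG)
    have "AE x in lborel. f (x + r *\<^sub>R ?e) - f x - ?G r x = 0"
    proof (rule fundamental_lemma_AE)
      show "(\<lambda>x. f (x + r *\<^sub>R ?e) - f x - ?G r x) \<in> borel_measurable borel"
        using ch by (rule borel_measurable_continuous_onI)
      show "integrable lborel (\<lambda>x. (f (x + r *\<^sub>R ?e) - f x - ?G r x) * indicator (box l u) x)" for l u
        by (rule continuous_box_integrable[OF ch])
      fix b :: "'n \<Rightarrow> nat \<Rightarrow> real \<Rightarrow> real" assume b: "tensor_test b"
      let ?q = "tprod b (\<lambda>_. 0)"
      have a: "integrable lborel (indicator {0..r} :: real \<Rightarrow> real)"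
        using emeasure_bounded_finite[of "{0..r}"] by (simp add: integrable_indicator_iff)
      have FTC: "(\<integral>s. indicator {0..r} s * tprod b (count_list [i]) (x - s *\<^sub>R ?e) \<partial>lborel) = ?q x - ?q (x - r *\<^sub>R ?e)" for x
      proof -
        have D: "((\<lambda>s. - ?q (x - s *\<^sub>R ?e)) has_real_derivative tprod b (count_list [i]) (x - s *\<^sub>R ?e)) (at s)" for s
        proof -
          have "(\<lambda>_. 0 :: nat)(i := Suc 0) = count_list [i]" by auto
          moreover have "(\<Sum>j\<in>UNIV. (- ?e) $ j * tprod b ((\<lambda>_. 0)(j := Suc 0)) (x + s *\<^sub>R (- ?e))) =
             (\<Sum>j\<in>UNIV. if j = i then - tprod b ((\<lambda>_. 0)(j := Suc 0)) (x + s *\<^sub>R (- ?e)) else 0)"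
            by (intro sum.cong) (auto simp: axis_def)
          ultimately show ?thesis
            using DERIV_minus[OF tprod_line_deriv[OF b, of "\<lambda>_. 0" x "- ?e" s]] by simp
        qed
        have "(\<integral>s. tprod b (count_list [i]) (x - s *\<^sub>R ?e) * indicator {0..r} s \<partial>lborel) = - ?q (x - r *\<^sub>R ?e) - (- ?q (x - 0 *\<^sub>R ?e))"
        proof (rule integral_FTC_Icc_real[OF r D])
          show "isCont (\<lambda>s. tprod b (count_list [i]) (x - s *\<^sub>R ?e)) s" for s
            using tprod_line_deriv[OF b, of "count_list [i]" x "- ?e" s] by (auto dest: DERIV_isCont)
        qed
        then show ?thesis by (simp add: mult.commute)
      qed
      have 1: "(\<integral>x. f x * (?q x - ?q (x - r *\<^sub>R ?e)) \<partial>lborel) = - (\<integral>x. ?q x * ?G r x \<partial>lborel)"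
        using weak_deriv_conv(1)[OF b w f g sigma_finite_lborel a, of "\<lambda>s. s *\<^sub>R ?e"] unfolding FTC by simp
      have q': "L2 (\<lambda>x. ?q (x + (- r *\<^sub>R ?e)))" by (rule L2_shift[OF L2_tprod[OF b]])
      have i1: "integrable lborel (\<lambda>x. f x * ?q x)" "integrable lborel (\<lambda>x. f x * ?q (x - r *\<^sub>R ?e))"
        using L2_D[OF f] L2_D[OF L2_tprod[OF b]] L2_D[OF q']
        by (auto intro!: L2_mult_integrable)
      have [measurable]: "f \<in> borel_measurable borel" "?q \<in> borel_measurable borel"
        using L2_D[OF f] L2_D[OF L2_tprod[OF b]] by auto
      have 2: "(\<integral>x. f x * ?q (x - r *\<^sub>R ?e) \<partial>lborel) = (\<integral>x. f (x + r *\<^sub>R ?e) * ?q x \<partial>lborel)"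
        using integral_lborel_shift[of "\<lambda>x. f x * ?q (x - r *\<^sub>R ?e)" "r *\<^sub>R ?e"] by simp
      have i2: "integrable lborel (\<lambda>x. ?q x * f (x + r *\<^sub>R ?e))" "integrable lborel (\<lambda>x. ?q x * f x)"
        "integrable lborel (\<lambda>x. ?q x * ?G r x)"
        by (intro tprod_mult_integrable b cs cf cG)+
      have "(\<integral>x. (f (x + r *\<^sub>R ?e) - f x - ?G r x) * ?q x \<partial>lborel) =
        (\<integral>x. ?q x * f (x + r *\<^sub>R ?e) - ?q x * f x - ?q x * ?G r x \<partial>lborel)"
        by (intro Bochner_Integration.integral_cong) (auto simp: algebra_simps)
      also have "\<dots> = (\<integral>x. ?q x * f (x + r *\<^sub>R ?e) \<partial>lborel) - (\<integral>x. ?q x * f x \<partial>lborel) - (\<integral>x. ?q x * ?G r x \<partial>lborel)"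
        using i2 by simp
      also have "\<dots> = 0"
        using 1 i1 unfolding right_diff_distrib by (simp add: 2 mult.commute)
      finally show "(\<integral>x. (f (x + r *\<^sub>R ?e) - f x - ?G r x) * ?q x \<partial>lborel) = 0" .
    qed
    then have "f (x + r *\<^sub>R ?e) - f x - ?G r x = 0"
      by (intro continuous_AE_eq[OF ch, of "\<lambda>_. 0"]) auto
    then show ?thesis by simp
  qed
  \<comment> \<open>The identity covers only r \<ge> 0. Starting one unit behind \<open>x\<close>
    puts \<open>x\<close> at the interior point r = 1, so that the derivative is two-sided.\<close>
  let ?y = "x - ?e"
  have "((\<lambda>r. f ?y + integral {0..r} (\<lambda>s. g (?y + s *\<^sub>R ?e))) has_real_derivative g (?y + 1 *\<^sub>R ?e)) (at 1 within {0..2})"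
    by (intro DERIV_add[where D=0, simplified] DERIV_const integral_has_real_derivative)
       (auto intro!: continuous_intros continuous_on_compose2[OF cg])
  then have "((\<lambda>r. f ?y + integral {0..r} (\<lambda>s. g (?y + s *\<^sub>R ?e))) has_real_derivative g x) (at 1)"
    by (subst (asm) at_within_interior) auto
  then have "((\<lambda>r. f (?y + r *\<^sub>R ?e)) has_real_derivative g x) (at 1)"
    by (rule has_field_derivative_transform_within_open[of _ _ _ "{0<..}"]) (auto simp: main Geq)
  then have "((\<lambda>h. f (?y + (h + 1) *\<^sub>R ?e)) has_real_derivative g x) (at 0)"
    using DERIV_shift[of "\<lambda>r. f (?y + r *\<^sub>R ?e)" "g x" 0 1] by simp
  then show ?thesis by (simp add: algebra_simps)
qed

subsection \<open>Classical regularity of solutions\<close>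

lemma dx_zero_open:
  assumes "open S" "x \<in> S" "\<And>y. y \<in> S \<Longrightarrow> f y = 0"
  shows "dx i f x = 0"
proof -
  have "open ((\<lambda>h. x + h *\<^sub>R axis i 1) -` S)"
    by (intro open_vimage assms continuous_intros)
  then have "((\<lambda>h. f (x + h *\<^sub>R axis i 1)) has_real_derivative 0) (at 0)"
    using assms by (intro has_field_derivative_transform_within_open[OF DERIV_const[of 0]]) auto
  then show ?thesis by (simp add: dx_def DERIV_imp_deriv)
qed

lemma pderivs_zero_open:
  assumes "open S" "\<And>y. y \<in> S \<Longrightarrow> f y = 0" "x \<in> S"
  shows "pderivs is f x = 0"
  using assms(3) by (induction "is" arbitrary: x) (auto intro: dx_zero_open[OF assms(1)] assms(2))

lemma pderivs_append: "pderivs (is @ js) f = pderivs is (pderivs js f)"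
  by (induction "is") auto

lemma pderivs_test_fun:
  assumes "test_fun q"
  shows "test_fun (pderivs is q)" "L2 (pderivs is q)"
proof -
  have c: "continuous_on UNIV (pderivs is q)" using assms by (simp add: test_fun_def smooth_on_def)
  obtain B where B: "\<And>x. q x \<noteq> 0 \<Longrightarrow> norm x \<le> B"
    using assms by (auto simp: test_fun_def bounded_iff)
  have z: "pderivs is q x = 0" if "norm x > B" for x
  proof (rule pderivs_zero_open)
    show "open {x. norm x > B}" by (intro open_Collect_less continuous_intros)
    show "q y = 0" if "y \<in> {x. norm x > B}" for y using B[of y] that by auto
  qed (use that in auto)
  have "bounded {x. pderivs is q x \<noteq> 0}"
    by (rule boundedI[of _ B]) (use z in force)
  moreover have "smooth_on UNIV (pderivs is q)"
  proof -
    have P: "continuous_on UNIV (pderivs ks q)"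
      "((\<lambda>h. pderivs ks q (x + h *\<^sub>R axis i 1)) has_real_derivative pderivs (i # ks) q x) (at 0)" for ks i x
      using assms by (auto simp: test_fun_def smooth_on_def)
    show ?thesis
      unfolding smooth_on_def using P[of "_ @ is"] by (simp add: pderivs_append)
  qed
  ultimately show "test_fun (pderivs is q)" by (simp add: test_fun_def)
  show "L2 (pderivs is q)"
    using z by (intro L2_continuous_bounded_support(1)[OF c, of "B + 1"]) auto
qed

lemma L2_lincomb:
  assumes "L2 f" "L2 g" shows "L2 (\<lambda>x. a * f x + b * g x)"
proof -
  note d = L2_D[OF assms(1)] L2_D[OF assms(2)]
  have "integrable lborel (\<lambda>x. a\<^sup>2 * (f x)\<^sup>2 + (2 * a * b) * (f x * g x) + b\<^sup>2 * (g x)\<^sup>2)"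
    using d L2_mult_integrable[of f lborel g] by (intro Bochner_Integration.integrable_add integrable_mult_right) auto
  moreover have "(\<lambda>x. a\<^sup>2 * (f x)\<^sup>2 + (2 * a * b) * (f x * g x) + b\<^sup>2 * (g x)\<^sup>2) = (\<lambda>x. (a * f x + b * g x)\<^sup>2)"
    by (auto simp: power2_eq_square algebra_simps)
  ultimately show ?thesis using d by (auto simp: L2_def)
qed

lemma weak_deriv_lincomb:
  fixes f g :: "real^'n::finite \<Rightarrow> real"
  assumes f: "L2 f" "L2 f'" "weak_deriv is f f'" and g: "L2 g" "L2 g'" "weak_deriv is g g'"
  shows "weak_deriv is (\<lambda>x. a * f x + b * g x) (\<lambda>x. a * f' x + b * g' x)"
  unfolding weak_deriv_def
proof safe
  fix q :: "real^'n \<Rightarrow> real" assume q: "test_fun q"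
  have i: "integrable lborel (\<lambda>x. u x * pderivs js q x)" if "L2 u" for u js
    using that L2_D(1)[OF that] L2_D[OF pderivs_test_fun(2)[OF q, of js]]
    by (intro L2_mult_integrable) (auto simp: L2_def)
  have e: "(\<integral>x. (a * u x + b * v x) * pderivs js q x \<partial>lborel) =
      a * (\<integral>x. u x * pderivs js q x \<partial>lborel) + b * (\<integral>x. v x * pderivs js q x \<partial>lborel)" if "L2 u" "L2 v" for u v js
    using i[OF that(1), of js] i[OF that(2), of js] by (simp add: distrib_right mult.assoc)
  show "(\<integral>x. (a * f x + b * g x) * pderivs is q x \<partial>lborel) =
      (- 1) ^ length is * (\<integral>x. (a * f' x + b * g' x) * q x \<partial>lborel)"
    using e[OF f(1) g(1), of "is"] e[OF f(2) g(2), of "[]"] f(3) g(3) q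
    by (simp add: weak_deriv_def algebra_simps)
qed

lemma sobolev_lincomb:
  assumes "sobolev m f" "sobolev m g"
  shows "sobolev m (\<lambda>x. a * f x + b * g x)"
  unfolding sobolev_def
proof safe
  show "L2 (\<lambda>x. a * f x + b * g x)" using assms by (intro L2_lincomb) (auto simp: sobolev_def)
  fix "is" :: "'a list" assume "length is \<le> m"
  then obtain f' g' where "L2 f'" "weak_deriv is f f'" "L2 g'" "weak_deriv is g g'"
    using assms unfolding sobolev_def by blast
  then show "\<exists>h. L2 h \<and> weak_deriv is (\<lambda>x. a * f x + b * g x) h"
    using assms by (intro exI[of _ "\<lambda>x. a * f' x + b * g' x"] conjI weak_deriv_lincomb L2_lincomb)
      (auto simp: sobolev_def)
qed

lemma wd_props:
  assumes "sobolev m f" "length is \<le> m"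
  shows "L2 (wd is f)" "weak_deriv is f (wd is f)"
proof -
  have "\<exists>g. L2 g \<and> weak_deriv is f g" using assms by (simp add: sobolev_def)
  then have "L2 (wd is f) \<and> weak_deriv is f (wd is f)" unfolding wd_def by (rule someI_ex)
  then show "L2 (wd is f)" "weak_deriv is f (wd is f)" by auto
qed

text \<open>\<open>wd\<close> picks its representatives independently for each list, so their
  compatibility has to be shown. As \<open>pderivs is q\<close> is itself a test function, the
  identity for \<open>js @ is\<close> with \<open>q\<close> can be compared with the one for
  \<open>js\<close> with \<open>pderivs is q\<close>.\<close>

lemma wd_append:
  assumes f: "sobolev m f" and l: "length js + length is \<le> m"
  shows "weak_deriv is (wd js f) (wd (js @ is) f)"
  unfolding weak_deriv_def
proof safe
  fix q :: "real^'a \<Rightarrow> real" assume q: "test_fun q"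
  have "(\<integral>x. f x * pderivs (js @ is) q x \<partial>lborel) = (-1) ^ length (js @ is) * (\<integral>x. wd (js @ is) f x * q x \<partial>lborel)"
    using wd_props(2)[OF f, of "js @ is"] l q by (simp add: weak_deriv_def)
  moreover have "(\<integral>x. f x * pderivs js (pderivs is q) x \<partial>lborel) = (-1) ^ length js * (\<integral>x. wd js f x * pderivs is q x \<partial>lborel)"
    using wd_props(2)[OF f, of js] l pderivs_test_fun(1)[OF q] by (simp add: weak_deriv_def)
  ultimately have "(-1) ^ length js * (\<integral>x. wd js f x * pderivs is q x \<partial>lborel) =
     (-1) ^ length js * ((-1) ^ length is * (\<integral>x. wd (js @ is) f x * q x \<partial>lborel))"
    by (simp add: pderivs_append power_add mult.assoc)
  then show "(\<integral>x. wd js f x * pderivs is q x \<partial>lborel) = (-1) ^ length is * (\<integral>x. wd (js @ is) f x * q x \<partial>lborel)"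
    by simp
qed

lemma wd_norm_le:
  assumes f: "sobolev m f" and l: "length is \<le> m"
  shows "sqrt (\<integral>x. (wd is f x)\<^sup>2 \<partial>lborel) \<le> sob_norm m f"
  unfolding sob_norm_def
  by (intro real_sqrt_le_mono member_le_sum) (use l finite_lists_le in \<open>auto intro: integral_nonneg_AE\<close>)

text \<open>The continuous representative of the weak derivative along \<open>js\<close>. The order
  p = [n/2] is the least with n \<le> 2p + 1, so [n/2] + 1 derivatives beyond \<open>js\<close> are
  consumed.\<close>

definition crep :: "'n::finite list \<Rightarrow> (real^'n \<Rightarrow> real) \<Rightarrow> real^'n \<Rightarrow> real" where
  "crep js f = sobrep (CARD('n) div 2) (\<lambda>is. wd (js @ is) f)"

lemma crep_props:
  fixes f :: "real^'n::finite \<Rightarrow> real"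
  assumes f: "sobolev m f" and l: "length js + CARD('n) div 2 + 1 \<le> m"
  shows "continuous_on UNIV (crep js f)" "AE x in lborel. wd js f x = crep js f x" "L2 (crep js f)"
proof -
  have n: "CARD('n) \<le> 2 * (CARD('n) div 2) + 1" by simp
  have L: "L2 (wd (js @ is) f)" if "length is \<le> Suc (CARD('n) div 2)" for "is"
    using that l by (intro wd_props[OF f]) auto
  show c: "continuous_on UNIV (crep js f)"
    unfolding crep_def by (rule sobrep_continuous[OF n L])
  show ae: "AE x in lborel. wd js f x = crep js f x"
    unfolding crep_def
    by (rule sobrep_AE[OF n _ L wd_append[OF f]]) (use l wd_props[OF f, of js] in auto)
  have [measurable]: "crep js f \<in> borel_measurable borel" "wd js f \<in> borel_measurable borel"
    using c L2_D[OF wd_props(1)[OF f, of js]] l by (auto intro: borel_measurable_continuous_onI)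
  have "integrable lborel (\<lambda>x. (crep js f x)\<^sup>2) \<longleftrightarrow> integrable lborel (\<lambda>x. (wd js f x)\<^sup>2)"
    using ae by (intro integrable_cong_AE) auto
  then show "L2 (crep js f)" using L2_D[OF wd_props(1)[OF f, of js]] l by (simp add: L2_def)
qed

lemma crep_Nil:
  fixes f :: "real^'n::finite \<Rightarrow> real"
  assumes f: "sobolev m f" and l: "CARD('n) div 2 + 1 \<le> m"
  shows "AE x in lborel. f x = crep [] f x"
  unfolding crep_def append_Nil
  by (rule sobrep_AE[OF _ _ wd_props[OF f]]) (use l f in \<open>auto simp: sobolev_def\<close>)

lemma crep_bound:
  obtains C where "C \<ge> 0" "\<And>m js (f :: real^'n::finite \<Rightarrow> real) x. sobolev m f \<Longrightarrow>
    length js + CARD('n) div 2 + 1 \<le> m \<Longrightarrow> \<bar>crep js f x\<bar> \<le> C * sob_norm m f"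
proof (rule sobrep_bound[where p="CARD('n) div 2" and 'n='n])
  fix C :: real
  assume C: "C \<ge> 0" "\<And>(g :: 'n list \<Rightarrow> real^'n \<Rightarrow> real) N x.
    (\<And>is. length is \<le> Suc (CARD('n) div 2) \<Longrightarrow> L2 (g is) \<and> sqrt (\<integral>x. (g is x)\<^sup>2 \<partial>lborel) \<le> N) \<Longrightarrow>
    \<bar>sobrep (CARD('n) div 2) g x\<bar> \<le> C * N"
  have "\<bar>crep js f x\<bar> \<le> C * sob_norm m f" if f: "sobolev m f" and l: "length js + CARD('n) div 2 + 1 \<le> m"
    for m js and f :: "real^'n \<Rightarrow> real" and x
    unfolding crep_def using l by (intro C(2) conjI wd_props[OF f] wd_norm_le[OF f]) auto
  with C(1) show thesis using that by blast
qed simp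

lemma crep_deriv:
  fixes f :: "real^'n::finite \<Rightarrow> real"
  assumes f: "sobolev m f" and l: "length js + CARD('n) div 2 + 2 \<le> m"
  shows "((\<lambda>h. crep js f (x + h *\<^sub>R axis i 1)) has_real_derivative crep (js @ [i]) f x) (at 0)"
proof (rule weak_deriv_imp_classical)
  show "continuous_on UNIV (crep js f)" "continuous_on UNIV (crep (js @ [i]) f)"
    "L2 (crep js f)" "L2 (crep (js @ [i]) f)"
    using l by (auto intro!: crep_props[OF f])
  have m: "wd js f \<in> borel_measurable borel" "wd (js @ [i]) f \<in> borel_measurable borel"
    "crep js f \<in> borel_measurable borel" "crep (js @ [i]) f \<in> borel_measurable borel"
    using l by (auto intro!: L2_D wd_props[OF f] crep_props[OF f])
  show "weak_deriv [i] (crep js f) (crep (js @ [i]) f)"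
    unfolding weak_deriv_def
  proof safe
    fix q :: "real^'n \<Rightarrow> real" assume q: "test_fun q"
    have [measurable]: "pderivs ks q \<in> borel_measurable borel" for ks
      using L2_D(1)[OF pderivs_test_fun(2)[OF q]] .
    have [measurable]: "q \<in> borel_measurable borel"
      using L2_D(1)[OF pderivs_test_fun(2)[OF q, of "[]"]] by simp
    have [measurable]: "dx i q \<in> borel_measurable borel"
      using L2_D(1)[OF pderivs_test_fun(2)[OF q, of "[i]"]] by simp
    note m[measurable]
    have "(\<integral>x. crep js f x * pderivs [i] q x \<partial>lborel) = (\<integral>x. wd js f x * pderivs [i] q x \<partial>lborel)"
      by (intro integral_cong_AE) (use crep_props(2)[OF f, of js] l in \<open>auto elim!: eventually_mono\<close>)
    also have "\<dots> = (- 1) ^ length [i] * (\<integral>x. wd (js @ [i]) f x * q x \<partial>lborel)"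
      using wd_append[OF f, of js "[i]"] l q by (simp add: weak_deriv_def)
    also have "(\<integral>x. wd (js @ [i]) f x * q x \<partial>lborel) = (\<integral>x. crep (js @ [i]) f x * q x \<partial>lborel)"
      by (intro integral_cong_AE) (use crep_props(2)[OF f, of "js @ [i]"] l in \<open>auto elim!: eventually_mono\<close>)
    finally show "(\<integral>x. crep js f x * pderivs [i] q x \<partial>lborel) = (- 1) ^ length [i] * (\<integral>x. crep (js @ [i]) f x * q x \<partial>lborel)" .
  qed
qed

text \<open>A continuous \<open>f\<close> coincides with its representative everywhere, not only
  almost everywhere. The strict bound on \<open>m\<close> is used in full for the second derivative:
  \<open>crep_deriv\<close> at \<open>[i]\<close> requires 1 + [n/2] + 2 \<le> m.\<close>

lemma sobolev_classical:
  fixes f :: "real^'n::finite \<Rightarrow> real"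
  assumes f: "sobolev m f" and l: "CARD('n) div 2 + 2 < m" and c: "continuous_on UNIV f"
  shows "crep [] f = f" "dx i f = crep [i] f" "dx i (dx i f) = crep [i, i] f"
    and "((\<lambda>h. f (x + h *\<^sub>R axis i 1)) has_real_derivative dx i f x) (at 0)"
    and "((\<lambda>h. dx i f (x + h *\<^sub>R axis i 1)) has_real_derivative dx i (dx i f) x) (at 0)"
proof -
  show 0: "crep [] f = f"
  proof
    show "crep [] f x = f x" for x
      by (rule continuous_AE_eq[OF crep_props(1)[OF f] c])
         (use crep_Nil[OF f] l in \<open>auto elim!: eventually_mono\<close>)
  qed
  have 1: "((\<lambda>h. f (x + h *\<^sub>R axis i 1)) has_real_derivative crep [i] f x) (at 0)" for x
    using crep_deriv[OF f, of "[]" x i] l by (simp add: 0)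
  then show e1: "dx i f = crep [i] f" unfolding dx_def by (auto intro!: DERIV_imp_deriv)
  have 2: "((\<lambda>h. crep [i] f (x + h *\<^sub>R axis i 1)) has_real_derivative crep [i, i] f x) (at 0)" for x
    using crep_deriv[OF f, of "[i]" x i] l by simp
  then have e2: "dx i (crep [i] f) = crep [i, i] f" unfolding dx_def by (auto intro!: DERIV_imp_deriv)
  then show "dx i (dx i f) = crep [i, i] f" by (simp add: e1)
  show "((\<lambda>h. f (x + h *\<^sub>R axis i 1)) has_real_derivative dx i f x) (at 0)"
    using 1 by (simp add: e1)
  show "((\<lambda>h. dx i f (x + h *\<^sub>R axis i 1)) has_real_derivative dx i (dx i f) x) (at 0)"
    using 2 by (simp add: e1 e2)
qed

text \<open>The sup bound by the Sobolev norm turns convergence of difference quotients in H^m into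
  uniform, hence pointwise, convergence of their representatives. At the end points of [0,T] the
  time derivative is one-sided.\<close>

lemma C1_Hm_classical:
  fixes U :: "real \<Rightarrow> real^'n::finite \<Rightarrow> real"
  assumes U: "C1_Hm m T U" and m: "CARD('n) div 2 + 2 < m" and T: "T > 0"
    and c: "\<And>t. t \<in> {0..T} \<Longrightarrow> continuous_on UNIV (U t)"
  shows "t \<in> {0..T} \<Longrightarrow> ((\<lambda>h. U t (x + h *\<^sub>R axis i 1)) has_real_derivative dx i (U t) x) (at 0)"
    and "t \<in> {0..T} \<Longrightarrow> ((\<lambda>h. dx i (U t) (x + h *\<^sub>R axis i 1)) has_real_derivative dx i (dx i (U t)) x) (at 0)"
    and "t \<in> {0..T} \<Longrightarrow> ((\<lambda>s. U s x) has_real_derivative dt T (\<lambda>s. U s x) t) (at t within {0..T})"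
    and "\<exists>B. \<forall>t\<in>{0..T}. \<forall>x i. \<bar>dx i (U t) x\<bar> \<le> B"
proof -
  have sU: "sobolev m (U t)" if "t \<in> {0..T}" for t using U that by (simp add: C1_Hm_def)
  obtain V where V: "\<And>t. t \<in> {0..T} \<Longrightarrow> sobolev m (V t)"
    and lim: "\<And>t. t \<in> {0..T} \<Longrightarrow>
      ((\<lambda>s. sob_norm m (\<lambda>x. (U s x - U t x) / (s - t) - V t x)) \<longlongrightarrow> 0) (at t within {0..T})"
    using U unfolding C1_Hm_def by blast
  show "((\<lambda>h. U t (x + h *\<^sub>R axis i 1)) has_real_derivative dx i (U t) x) (at 0)"
    "((\<lambda>h. dx i (U t) (x + h *\<^sub>R axis i 1)) has_real_derivative dx i (dx i (U t)) x) (at 0)" if "t \<in> {0..T}"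
    using sobolev_classical(4,5)[OF sU[OF that] m c[OF that]] by auto
  \<comment> \<open>At s = t division by 0 makes the quotient 0, so \<open>D t t\<close> is the
    negative of \<open>V t\<close> and stays in the Sobolev space; the identities \<open>D0\<close>
    and \<open>D1\<close> exclude this case.\<close>
  define D where "D t s x = (U s x - U t x) / (s - t) - V t x" for t s x
  have sD: "sobolev m (D t s)" if "t \<in> {0..T}" "s \<in> {0..T}" for t s
  proof -
    have "D t s = (\<lambda>x. 1 * (1 / (s - t) * U s x + (- 1 / (s - t)) * U t x) + (-1) * V t x)"
      by (auto simp: D_def diff_divide_distrib)
    then show ?thesis
      using sobolev_lincomb[OF sobolev_lincomb[OF sU[OF that(2)] sU[OF that(1)],
          where a="1 / (s - t)" and b="- 1 / (s - t)"] V[OF that(1)], where a=1 and b="-1"] by simp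
  qed
  have D0: "crep [] (D t s) x = (U s x - U t x) / (s - t) - crep [] (V t) x"
    if ts: "t \<in> {0..T}" "s \<in> {0..T}" "s \<noteq> t" for t s x
  proof (rule continuous_AE_eq[of "crep [] (D t s)" "\<lambda>x. (U s x - U t x) / (s - t) - crep [] (V t) x"])
    show "continuous_on UNIV (crep [] (D t s))" using m by (intro crep_props(1)[OF sD]) (use ts in auto)
    show "continuous_on UNIV (\<lambda>x. (U s x - U t x) / (s - t) - crep [] (V t) x)"
      using m by (intro continuous_intros c crep_props(1)[OF V]) (use ts in auto)
    have "AE x in lborel. V t x = crep [] (V t) x" "AE x in lborel. D t s x = crep [] (D t s) x"
      using m by (intro crep_Nil[OF V] crep_Nil[OF sD]; use ts in simp)+
    then show "AE x in lborel. crep [] (D t s) x = (U s x - U t x) / (s - t) - crep [] (V t) x"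
      by eventually_elim (simp add: D_def)
  qed
  have D1: "crep [i] (D t s) x = (dx i (U s) x - dx i (U t) x) / (s - t) - crep [i] (V t) x"
    if ts: "t \<in> {0..T}" "s \<in> {0..T}" "s \<noteq> t" for t s x i
  proof (rule DERIV_unique)
    show "((\<lambda>h. crep [] (D t s) (x + h *\<^sub>R axis i 1)) has_real_derivative crep [i] (D t s) x) (at 0)"
      using crep_deriv[OF sD, of t s "[]"] ts m by simp
    have "((\<lambda>h. (U s (x + h *\<^sub>R axis i 1) - U t (x + h *\<^sub>R axis i 1)) / (s - t) - crep [] (V t) (x + h *\<^sub>R axis i 1))
       has_real_derivative (dx i (U s) x - dx i (U t) x) / (s - t) - crep [i] (V t) x) (at 0)"
      using crep_deriv[OF V, of t "[]"] ts m
      by (intro DERIV_diff DERIV_cdivide sobolev_classical(4)[OF sU m c]) auto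
    then show "((\<lambda>h. crep [] (D t s) (x + h *\<^sub>R axis i 1)) has_real_derivative
       (dx i (U s) x - dx i (U t) x) / (s - t) - crep [i] (V t) x) (at 0)"
      by (simp add: D0[OF ts])
  qed
  obtain C where C: "C \<ge> 0" "\<And>m js (f :: real^'n \<Rightarrow> real) x. sobolev m f \<Longrightarrow>
    length js + CARD('n) div 2 + 1 \<le> m \<Longrightarrow> \<bar>crep js f x\<bar> \<le> C * sob_norm m f"
    using crep_bound[where 'n='n] by blast
  show "((\<lambda>s. U s x) has_real_derivative dt T (\<lambda>s. U s x) t) (at t within {0..T})" if t: "t \<in> {0..T}" for t x
  proof -
    have "((\<lambda>s. crep [] (D t s) x) \<longlongrightarrow> 0) (at t within {0..T})"
    proof (rule Lim_null_comparison)
      show "((\<lambda>s. C * sob_norm m (D t s)) \<longlongrightarrow> 0) (at t within {0..T})"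
        using tendsto_mult_left[OF lim[OF t], of C] by (simp add: D_def[abs_def])
      show "\<forall>\<^sub>F s in at t within {0..T}. norm (crep [] (D t s) x) \<le> C * sob_norm m (D t s)"
        unfolding eventually_at_filter using t m by (auto intro!: always_eventually C(2) sD)
    qed
    then have "((\<lambda>s. crep [] (D t s) x + crep [] (V t) x) \<longlongrightarrow> 0 + crep [] (V t) x) (at t within {0..T})"
      by (intro tendsto_intros)
    then have "((\<lambda>s. (U s x - U t x) / (s - t)) \<longlongrightarrow> 0 + crep [] (V t) x) (at t within {0..T})"
      by (rule Lim_transform_eventually) (auto simp: eventually_at_filter t intro!: always_eventually simp: D0[OF t])
    then have d: "((\<lambda>s. U s x) has_real_derivative crep [] (V t) x) (at t within {0..T})"
      by (simp add: has_field_derivative_iff)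
    then have "dt T (\<lambda>s. U s x) t = crep [] (V t) x"
      unfolding dt_def has_real_derivative_iff_has_vector_derivative
      by (rule vector_derivative_within_closed_interval[OF T t])
    with d show ?thesis by simp
  qed
  \<comment> \<open>Near \<open>t\<close> the remainder \<open>D t s\<close> has Sobolev norm below
    1, so gradients there differ from the one at \<open>t\<close> by at most |s - t| times a
    constant; compactness of [0,T] then yields one bound for all times.\<close>
  have loc: "\<exists>d B. d > 0 \<and> (\<forall>s\<in>{0..T} \<inter> ball t d. \<forall>x i. \<bar>dx i (U s) x\<bar> \<le> B)" if t: "t \<in> {0..T}" for t
  proof -
    have "\<forall>\<^sub>F s in at t within {0..T}. sob_norm m (D t s) < 1"
      using order_tendstoD(2)[OF lim[OF t], of 1] by (simp add: D_def[abs_def])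
    then obtain d where d: "d > 0" "\<And>s. s \<in> {0..T} \<Longrightarrow> s \<noteq> t \<Longrightarrow> dist s t < d \<Longrightarrow> sob_norm m (D t s) < 1"
      unfolding eventually_at by auto
    define B where "B = C * sob_norm m (U t) + T * (C + C * sob_norm m (V t))"
    have vV: "0 \<le> C * sob_norm m (V t)" and vU: "0 \<le> C * sob_norm m (U t)"
      using C(1) by (auto simp: sob_norm_def intro!: mult_nonneg_nonneg sum_nonneg integral_nonneg_AE)
    have Ut: "\<bar>dx i (U t) x\<bar> \<le> C * sob_norm m (U t)" for x i
      using C(2)[OF sU[OF t], of "[i]" x] m sobolev_classical(2)[OF sU[OF t] m c[OF t], of i] by simp
    have "\<bar>dx i (U s) x\<bar> \<le> B" if s: "s \<in> {0..T} \<inter> ball t d" for s x i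
    proof (cases "s = t")
      case True
      have "0 \<le> T * (C + C * sob_norm m (V t))" using T C(1) vV by (intro mult_nonneg_nonneg) auto
      then show ?thesis using Ut[of i x] True by (simp add: B_def)
    next
      case False
      have "\<bar>crep [i] (D t s) x\<bar> \<le> C * sob_norm m (D t s)" using C(2)[OF sD, of t s "[i]" x] s t m by simp
      also have "\<dots> \<le> C * 1" using d(2)[of s] s False C(1) by (intro mult_left_mono) (auto simp: dist_commute)
      finally have 1: "\<bar>crep [i] (D t s) x\<bar> \<le> C" by simp
      have 2: "\<bar>crep [i] (V t) x\<bar> \<le> C * sob_norm m (V t)" using C(2)[OF V[OF t], of "[i]" x] m by simp
      have "dx i (U s) x = dx i (U t) x + (s - t) * (crep [i] (D t s) x + crep [i] (V t) x)"
        using D1[OF t, of s i x] s False by simp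
      then have "\<bar>dx i (U s) x\<bar> \<le> \<bar>dx i (U t) x\<bar> + \<bar>s - t\<bar> * \<bar>crep [i] (D t s) x + crep [i] (V t) x\<bar>"
        using abs_triangle_ineq by (simp add: abs_mult[symmetric])
      also have "\<bar>s - t\<bar> * \<bar>crep [i] (D t s) x + crep [i] (V t) x\<bar> \<le> T * (C + C * sob_norm m (V t))"
        using s t T 1 2 C(1) vV by (intro mult_mono) auto
      finally show ?thesis using Ut[of i x] by (simp add: B_def)
    qed
    then show ?thesis using d(1) by blast
  qed
  then obtain d B where dB: "\<And>t. t \<in> {0..T} \<Longrightarrow> d t > 0"
    "\<And>t s x i. t \<in> {0..T} \<Longrightarrow> s \<in> {0..T} \<inter> ball t (d t) \<Longrightarrow> \<bar>dx i (U s) x\<bar> \<le> B t"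
    by metis
  obtain F where F: "F \<subseteq> {0..T}" "finite F" "{0..T} \<subseteq> (\<Union>t\<in>F. ball t (d t))"
  proof (rule compactE_image[of "{0..T}" "{0..T}" "\<lambda>t. ball t (d t)"])
    show "{0..T} \<subseteq> (\<Union>t\<in>{0..T}. ball t (d t))" using dB(1) by fastforce
  qed auto
  have "\<bar>dx i (U s) x\<bar> \<le> (\<Sum>t\<in>F. \<bar>B t\<bar>)" if s: "s \<in> {0..T}" for s x i
  proof -
    obtain t where t: "t \<in> F" "s \<in> ball t (d t)" using F s by blast
    then have "\<bar>dx i (U s) x\<bar> \<le> \<bar>B t\<bar>" using dB(2)[of t s i x] F s by force
    also have "\<dots> \<le> (\<Sum>t\<in>F. \<bar>B t\<bar>)" using t F by (intro member_le_sum) auto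
    finally show ?thesis .
  qed
  then show "\<exists>B. \<forall>t\<in>{0..T}. \<forall>x i. \<bar>dx i (U t) x\<bar> \<le> B" by blast
qed

subsection \<open>Vacuum and positivity regions\<close>

text \<open>Only earlier times are compared, since the extremum may sit at the final time T, which
  has no later neighbours.\<close>

lemma deriv_nonneg_at_left_max:
  fixes f :: "real \<Rightarrow> real"
  assumes D: "(f has_real_derivative D) (at t within {0..T})" and t: "0 < t" "t \<le> T"
    and d: "d > 0" "\<And>s. 0 \<le> s \<Longrightarrow> s \<le> t \<Longrightarrow> t - d < s \<Longrightarrow> f s \<le> f t"
  shows "D \<ge> 0"
proof (rule ccontr)
  assume "\<not> D \<ge> 0"
  then obtain d' where d': "d' > 0" "\<And>h. h > 0 \<Longrightarrow> t - h \<in> {0..T} \<Longrightarrow> h < d' \<Longrightarrow> f t < f (t - h)"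
    using has_real_derivative_neg_dec_left[OF D] by auto
  define h where "h = min t (min d d') / 2"
  have "h > 0" "h < t" "h < d" "h < d'" using t d(1) d'(1) by (auto simp: h_def)
  then show False using d'(2)[of h] d(2)[of "t - h"] t by auto
qed

text \<open>A negative second derivative would make g' negative just to the right of 0, and the mean
  value theorem would push g below its minimum.\<close>

lemma second_deriv_nonneg_at_min:
  fixes g g' :: "real \<Rightarrow> real"
  assumes g: "\<And>h. (g has_real_derivative g' h) (at h)" and g2: "(g' has_real_derivative D) (at 0)"
    and d: "d > 0" "\<And>h. \<bar>h\<bar> < d \<Longrightarrow> g 0 \<le> g h"
  shows "g' 0 = 0" "D \<ge> 0"
proof -
  show z: "g' 0 = 0" using DERIV_local_min[OF g[of 0] d(1)] d(2) by simp
  show "D \<ge> 0"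
  proof (rule ccontr)
    assume "\<not> D \<ge> 0"
    then obtain d' where d': "d' > 0" "\<And>h. h > 0 \<Longrightarrow> h < d' \<Longrightarrow> g' h < 0"
      using has_real_derivative_neg_dec_right[OF g2] z by auto
    define h where "h = min d d' / 2"
    have h: "h > 0" "h < d" "h < d'" using d(1) d'(1) by (auto simp: h_def)
    obtain y where y: "0 < y" "y < h" "g h - g 0 = (h - 0) * g' y"
      using MVT2[of 0 h g g'] h(1) g by blast
    then have "g h - g 0 < 0" using d'(2)[of y] h by (simp add: mult_pos_neg)
    then show False using d(2)[of h] h by simp
  qed
qed

lemma norm_axis_step:
  fixes x y :: "real^'n::finite"
  shows "(norm (x + h *\<^sub>R axis i 1 - y))\<^sup>2 = (norm (x - y))\<^sup>2 + 2 * h * (x - y) $ i + h\<^sup>2"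
proof -
  have "x + h *\<^sub>R axis i 1 - y = (x - y) + h *\<^sub>R axis i 1" by simp
  then show ?thesis
    by (simp only: power2_norm_eq_inner)
       (simp add: inner_add_left inner_add_right inner_axis inner_commute[of "axis i 1"] power2_eq_square algebra_simps)
qed

text \<open>Maximising a weighted square of the density over a shrinking parabola-shaped region avoids
  the flow map of the velocity field.\<close>

lemma vacuum_persists:
  fixes r :: "real^'n::finite \<Rightarrow> real \<Rightarrow> real" and u :: "real^'n \<Rightarrow> real \<Rightarrow> real^'n"
  assumes T: "T > 0"
    and cr: "continuous_on (UNIV \<times> {0..T}) (\<lambda>(x, t). r x t)"
    and cu: "continuous_on (UNIV \<times> {0..T}) (\<lambda>(x, t). u x t)"
    and rt: "\<And>x t. t \<in> {0<..T} \<Longrightarrow> ((\<lambda>s. r x s) has_real_derivative rt x t) (at t within {0..T})"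
    and rx: "\<And>x t i. t \<in> {0<..T} \<Longrightarrow> ((\<lambda>h. r (x + h *\<^sub>R axis i 1) t) has_real_derivative rx i x t) (at 0)"
    and eq: "\<And>x t. t \<in> {0<..T} \<Longrightarrow> rt x t + (\<Sum>i\<in>UNIV. rx i x t * u x t $ i) + r x t * dv x t = 0"
    and dv: "\<And>x t. t \<in> {0<..T} \<Longrightarrow> \<bar>dv x t\<bar> \<le> K"
    and init: "\<And>x. x \<in> cball xc 1 \<Longrightarrow> r x 0 = 0"
  obtains \<tau> where "0 < \<tau>" "\<tau> \<le> T" "\<And>t. t \<in> {0..\<tau>} \<Longrightarrow> r xc t = 0"
proof -
  have "bounded ((\<lambda>(x, t). u x t) ` (cball xc 1 \<times> {0..T}))"
    by (intro compact_imp_bounded compact_continuous_image continuous_on_subset[OF cu] compact_Times) auto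
  then obtain B where B: "B > 0" "\<And>x t. x \<in> cball xc 1 \<Longrightarrow> t \<in> {0..T} \<Longrightarrow> norm (u x t) \<le> B"
    unfolding bounded_pos by fastforce
  \<comment> \<open>At the maximum, transport contributes at most 2 B times the squared density; the
    extra 1 makes the final inequality strict.\<close>
  define M where "M = 2 * B + 1"
  have M: "M > 0" using B by (simp add: M_def)
  \<comment> \<open>At most half the time 1/M at which the region closes over its centre, so
    \<open>ph xc t\<close> stays positive up to \<tau>.\<close>
  define \<tau> where "\<tau> = min T (1 / (2 * M))"
  have \<tau>: "0 < \<tau>" "\<tau> \<le> T" "M * \<tau> < 1"
  proof -
    show "0 < \<tau>" "\<tau> \<le> T" using T M by (auto simp: \<tau>_def)
    have "M * \<tau> \<le> M * (1 / (2 * M))" using M by (intro mult_left_mono) (auto simp: \<tau>_def)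
    then show "M * \<tau> < 1" using M by simp
  qed
  define ph where "ph x t = 1 - (norm (x - xc))\<^sup>2 - M * t" for x t
  \<comment> \<open>Squaring makes F indifferent to the sign of the density, and the exponential
    absorbs the stretching term of the continuity equation, whose rate is at most 2 K.\<close>
  define F where "F x t = (r x t)\<^sup>2 * ph x t * exp (- (2 * K * t))" for x t
  let ?D = "cball xc 1 \<times> {0..\<tau>}"
  have "r xc ts = 0" if ts: "ts \<in> {0..\<tau>}" for ts
  proof (rule ccontr)
    assume nz: "r xc ts \<noteq> 0"
    have "M * ts \<le> M * \<tau>" using ts M by simp
    then have "F xc ts > 0" unfolding F_def ph_def using nz \<tau>(3) by simp
    have cF: "continuous_on ?D (\<lambda>p. F (fst p) (snd p))"
    proof -
      have "?D \<subseteq> UNIV \<times> {0..T}" using \<tau>(2) by auto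
      from continuous_on_subset[OF cr this] have "continuous_on ?D (\<lambda>p. r (fst p) (snd p))"
        by (simp add: case_prod_beta')
      then show ?thesis unfolding F_def ph_def by (intro continuous_intros)
    qed
    have "\<exists>p\<in>?D. \<forall>q\<in>?D. F (fst q) (snd q) \<le> F (fst p) (snd p)"
      using \<tau>(1) by (intro continuous_attains_sup[OF _ _ cF] compact_Times) auto
    then obtain x t where xt: "x \<in> cball xc 1" "t \<in> {0..\<tau>}"
      and max: "\<And>y s. y \<in> cball xc 1 \<Longrightarrow> s \<in> {0..\<tau>} \<Longrightarrow> F y s \<le> F x t" by auto
    have Fpos: "F x t > 0" using max[of xc ts] ts \<open>F xc ts > 0\<close> by auto
    have rnz: "r x t \<noteq> 0" using Fpos by (auto simp: F_def)
    have ppos: "ph x t > 0"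
    proof (rule ccontr)
      assume "\<not> ph x t > 0"
      then have "(r x t)\<^sup>2 * ph x t \<le> 0" by (simp add: mult_nonneg_nonpos)
      then have "F x t \<le> 0" by (simp add: F_def mult_nonpos_nonneg)
      with Fpos show False by simp
    qed
    have t0: "t > 0" using rnz init[OF xt(1)] xt by (cases "t = 0") auto
    have tT: "t \<in> {0<..T}" using t0 xt \<tau> by auto
    have "0 \<le> M * t" using M xt by simp
    then have "(norm (x - xc))\<^sup>2 < 1" using ppos unfolding ph_def by linarith
    then have nx: "norm (x - xc) < 1" using power2_less_imp_less[of "norm (x - xc)" 1] by simp
    \<comment> \<open>The spatial gradient of F vanishes at the maximum. This trades derivatives of
      the density for derivatives of the weight and removes the former from the transport
      term.\<close>
    have sp: "2 * r x t * rx i x t * ph x t = 2 * (r x t)\<^sup>2 * (x - xc) $ i" for i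
    proof -
      let ?g = "\<lambda>h. F (x + h *\<^sub>R axis i 1) t"
      have D: "(?g has_real_derivative
          (2 * r x t * rx i x t * ph x t + (r x t)\<^sup>2 * (- (2 * (x - xc) $ i))) * exp (- (2 * K * t))) (at 0)"
        unfolding F_def ph_def norm_axis_step
        by (auto intro!: derivative_eq_intros rx[OF tT] simp: algebra_simps power2_eq_square)
      have "?g y \<le> ?g 0" if "\<bar>0 - y\<bar> < 1 - norm (x - xc)" for y
      proof -
        have "norm (x + y *\<^sub>R axis i 1 - xc) \<le> norm (x - xc) + norm (y *\<^sub>R (axis i 1 :: real^'n))"
          using norm_triangle_ineq[of "x - xc" "y *\<^sub>R axis i 1"] by (simp add: algebra_simps)
        also have "\<dots> \<le> 1" using that by (simp add: norm_axis_1)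
        finally have "x + y *\<^sub>R axis i 1 \<in> cball xc 1" by (simp add: dist_norm norm_minus_commute)
        then show ?thesis using max[of "x + y *\<^sub>R axis i 1" t] xt by simp
      qed
      then have "(2 * r x t * rx i x t * ph x t + (r x t)\<^sup>2 * (- (2 * (x - xc) $ i))) * exp (- (2 * K * t)) = 0"
        using DERIV_local_max[OF D, of "1 - norm (x - xc)"] nx by simp
      then have "2 * r x t * rx i x t * ph x t + (r x t)\<^sup>2 * (- (2 * (x - xc) $ i)) = 0"
        by (simp only: mult_eq_0_iff exp_not_eq_zero simp_thms)
      then show ?thesis by (simp add: algebra_simps)
    qed
    have Dt: "((\<lambda>s. F x s) has_real_derivative
        (2 * r x t * rt x t * ph x t + (r x t)\<^sup>2 * (- M) + (r x t)\<^sup>2 * ph x t * (- (2 * K))) * exp (- (2 * K * t)))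
        (at t within {0..T})"
      unfolding F_def ph_def
      by (auto intro!: derivative_eq_intros rt[OF tT] simp: algebra_simps power2_eq_square)
    have "(2 * r x t * rt x t * ph x t + (r x t)\<^sup>2 * (- M) + (r x t)\<^sup>2 * ph x t * (- (2 * K))) * exp (- (2 * K * t)) \<ge> 0"
      by (rule deriv_nonneg_at_left_max[OF Dt t0, of t]) (use tT t0 max[OF xt(1)] xt in auto)
    then have 1: "2 * r x t * rt x t * ph x t + (r x t)\<^sup>2 * (- M) + (r x t)\<^sup>2 * ph x t * (- (2 * K)) \<ge> 0"
      by (simp add: zero_le_mult_iff)
    have "2 * r x t * rt x t * ph x t = - (\<Sum>i\<in>UNIV. (2 * r x t * rx i x t * ph x t) * u x t $ i) - 2 * (r x t)\<^sup>2 * ph x t * dv x t"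
    proof -
      have "rt x t = - (\<Sum>i\<in>UNIV. rx i x t * u x t $ i) - r x t * dv x t" using eq[OF tT, of x] by simp
      then have "2 * r x t * rt x t * ph x t = - (2 * r x t * ph x t * (\<Sum>i\<in>UNIV. rx i x t * u x t $ i)) - 2 * (r x t)\<^sup>2 * ph x t * dv x t"
        by (simp only:) (simp add: algebra_simps power2_eq_square)
      then show ?thesis by (simp add: sum_distrib_left mult_ac)
    qed
    also have "(\<Sum>i\<in>UNIV. (2 * r x t * rx i x t * ph x t) * u x t $ i) = 2 * (r x t)\<^sup>2 * ((x - xc) \<bullet> u x t)"
      unfolding sp by (simp add: inner_vec_def sum_distrib_left mult_ac)
    finally have "0 \<le> (r x t)\<^sup>2 * (- 2 * ((x - xc) \<bullet> u x t) - M - 2 * ph x t * (dv x t + K))"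
      using 1 by (simp add: algebra_simps)
    moreover have "- 2 * ((x - xc) \<bullet> u x t) - M - 2 * ph x t * (dv x t + K) < 0"
    proof -
      have "\<bar>(x - xc) \<bullet> u x t\<bar> \<le> norm (x - xc) * norm (u x t)" by (rule Cauchy_Schwarz_ineq2)
      also have "\<dots> \<le> 1 * B" using nx B(1) B(2)[OF xt(1), of t] tT by (intro mult_mono) auto
      finally have "\<bar>(x - xc) \<bullet> u x t\<bar> \<le> B" by simp
      moreover have "0 \<le> ph x t * (dv x t + K)" using ppos dv[OF tT, of x] by (intro mult_nonneg_nonneg) auto
      ultimately show ?thesis by (simp add: M_def)
    qed
    ultimately show False using rnz by (auto simp: zero_le_mult_iff)
  qed
  then show thesis using that \<tau> by blast
qed

text \<open>The speed \<open>s\<close> is the least value of (|x - x0| - a) / t over the nonpositive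
  points reachable at speed \<open>s0\<close>. Minimality keeps the open moving ball free of such
  points, and attainment of the minimum gives the contact point.\<close>

lemma touching_expanding_ball:
  fixes r :: "real^'n::finite \<Rightarrow> real \<Rightarrow> real"
  assumes cr: "continuous_on (UNIV \<times> {0..\<tau>}) (\<lambda>(x, t). r x t)" and \<tau>: "\<tau> > 0"
    and pos: "\<And>x t. x \<in> cball x0 a \<Longrightarrow> t \<in> {0..\<tau>} \<Longrightarrow> r x t > 0"
    and vac: "r xc \<tau> \<le> 0" and a: "a > 0"
  obtains s t1 x1 where "s > 0" "0 < t1" "t1 \<le> \<tau>" "norm (x1 - x0) = a + s * t1" "r x1 t1 = 0"
    "\<And>x t. t \<in> {0..\<tau>} \<Longrightarrow> norm (x - x0) < a + s * t \<Longrightarrow> r x t > 0"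
proof -
  have far: "norm (x - x0) > a" if "t \<in> {0..\<tau>}" "r x t \<le> 0" for x t
    using pos[of x t] that by (force simp: dist_norm norm_minus_commute)
  \<comment> \<open>The speed that just reaches \<open>xc\<close> at time \<tau>; it makes the
    competitor set nonempty and bounded.\<close>
  define s0 where "s0 = (norm (xc - x0) - a) / \<tau>"
  have s0: "s0 > 0" using far[of \<tau> xc] vac \<tau> by (simp add: s0_def)
  let ?D = "cball x0 (a + s0 * \<tau>) \<times> {0..\<tau>}"
  let ?Z = "{p \<in> ?D. r (fst p) (snd p) \<le> 0 \<and> norm (fst p - x0) \<le> a + s0 * snd p}"
  have "?D \<subseteq> UNIV \<times> {0..\<tau>}" by auto
  from continuous_on_subset[OF cr this] have c: "continuous_on ?D (\<lambda>p. r (fst p) (snd p))"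
    by (simp add: case_prod_beta')
  have "closed ?Z"
  proof -
    have "closed {p \<in> ?D. r (fst p) (snd p) \<le> 0}"
      by (intro continuous_on_closed_Collect_le c continuous_on_const closed_Times) auto
    moreover have "closed {p :: (real^'n) \<times> real. norm (fst p - x0) \<le> a + s0 * snd p}"
      by (intro closed_Collect_le continuous_intros)
    ultimately have "closed ({p \<in> ?D. r (fst p) (snd p) \<le> 0} \<inter> {p. norm (fst p - x0) \<le> a + s0 * snd p})" by (rule closed_Int)
    moreover have "{p \<in> ?D. r (fst p) (snd p) \<le> 0} \<inter> {p. norm (fst p - x0) \<le> a + s0 * snd p} = ?Z" by blast
    ultimately show ?thesis by simp
  qed
  moreover have "compact ?D" by (intro compact_Times) auto
  then have "bounded ?Z" by (rule bounded_subset[OF compact_imp_bounded]) auto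
  ultimately have Z: "compact ?Z" by (simp add: compact_eq_bounded_closed)
  \<comment> \<open>At time 0 the ball has radius \<open>a\<close> and lies in the positive region;
    so no competitor has time 0, and the quotient to be minimised is continuous.\<close>
  have tpos: "snd p > 0" if "p \<in> ?Z" for p
    using that far[of "snd p" "fst p"] by (cases "snd p = 0") auto
  have "continuous_on ?Z (\<lambda>p. (norm (fst p - x0) - a) / snd p)"
    by (intro continuous_intros) (use tpos in force)
  moreover have "(xc, \<tau>) \<in> ?Z"
    using vac \<tau> by (simp add: s0_def dist_norm norm_minus_commute)
  ultimately obtain p where p: "p \<in> ?Z" "\<And>q. q \<in> ?Z \<Longrightarrow> (norm (fst p - x0) - a) / snd p \<le> (norm (fst q - x0) - a) / snd q"
    using continuous_attains_inf[OF Z] by blast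
  define x1 where "x1 = fst p"
  define t1 where "t1 = snd p"
  define s where "s = (norm (x1 - x0) - a) / t1"
  have t1: "0 < t1" "t1 \<le> \<tau>" using tpos[OF p(1)] p(1) by (auto simp: t1_def)
  have r1: "r x1 t1 \<le> 0" using p(1) by (simp add: x1_def t1_def)
  have s: "s > 0" using far[of t1 x1] t1 r1 by (simp add: s_def)
  have ss0: "s \<le> s0" using p(2)[OF \<open>(xc, \<tau>) \<in> ?Z\<close>] by (simp add: s_def s0_def x1_def t1_def)
  have eq: "norm (x1 - x0) = a + s * t1" using t1 by (simp add: s_def)
  have inside: "r x t > 0" if t: "t \<in> {0..\<tau>}" and x: "norm (x - x0) < a + s * t" for x t
  proof (rule ccontr)
    assume n: "\<not> r x t > 0"
    have t0: "t > 0" using far[OF t, of x] n x t by (cases "t = 0") auto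
    have "a + s * t \<le> a + s0 * t" using ss0 t by (simp add: mult_right_mono)
    moreover have "a + s0 * t \<le> a + s0 * \<tau>" using s0 t by simp
    ultimately have "(x, t) \<in> ?Z" using n x t by (auto simp: dist_norm norm_minus_commute)
    then have "s \<le> (norm (x - x0) - a) / t" using p(2)[of "(x, t)"] by (simp add: s_def x1_def t1_def)
    then show False using x t0 by (simp add: field_simps)
  qed
  \<comment> \<open>The contact point lies in the closure of the open ball on which the function is
    positive at that time.\<close>
  have "r x1 t1 \<ge> 0"
  proof -
    have "continuous_on UNIV (\<lambda>x. r x t1)"
      by (rule continuous_on_compose2[OF cr, of UNIV "\<lambda>x. (x, t1)", simplified])
         (use t1 in \<open>auto intro!: continuous_intros\<close>)
    then have "closed {x. 0 \<le> r x t1}" by (intro closed_Collect_le continuous_on_const)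
    moreover have "ball x0 (a + s * t1) \<subseteq> {x. 0 \<le> r x t1}"
      using inside[of t1] t1 by (force simp: dist_norm norm_minus_commute)
    ultimately have "closure (ball x0 (a + s * t1)) \<subseteq> {x. 0 \<le> r x t1}" by (rule closure_minimal[rotated])
    moreover have "x1 \<in> closure (ball x0 (a + s * t1))"
      using a s t1 eq by (simp add: dist_norm norm_minus_commute add_pos_pos)
    ultimately show ?thesis by auto
  qed
  then show thesis using that[OF s t1 eq _ inside] r1 by simp
qed

subsection \<open>Boundary point lemma and conclusion\<close>

lemma line_derivI:
  fixes f :: "real^'n::finite \<Rightarrow> real"
  assumes "\<And>y. ((\<lambda>h. f (y + h *\<^sub>R e)) has_real_derivative f' y) (at 0)"
  shows "((\<lambda>h. f (x + h *\<^sub>R e)) has_real_derivative f' (x + h *\<^sub>R e)) (at h)"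
proof -
  have "((\<lambda>k. f (x + (k + h) *\<^sub>R e)) has_real_derivative f' (x + h *\<^sub>R e)) (at 0)"
    using assms[of "x + h *\<^sub>R e"] by (simp add: algebra_simps)
  then show ?thesis using DERIV_shift[of "\<lambda>h. f (x + h *\<^sub>R e)" _ 0 h] by simp
qed

text \<open>The coefficient \<open>r\<close> of the time derivative may vanish at the contact point: the barrier
  \<open>exp (- \<alpha> q) - 1\<close> with \<open>q = |x - x0|^2 - (a + s t)^2\<close> produces a term of order \<open>\<alpha>^2\<close> in the
  Laplacian but only of order \<open>\<alpha>\<close> in the first derivatives.\<close>

lemma Hopf_expanding_ball:
  fixes e r b :: "real^'n::finite \<Rightarrow> real \<Rightarrow> real" and u :: "real^'n \<Rightarrow> real \<Rightarrow> real^'n"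
  assumes t1: "0 < t1" "t1 \<le> T" and pos: "a > 0" "s > 0" "k > 0" "c0 > 0"
    and ce: "continuous_on (UNIV \<times> {0..T}) (\<lambda>(x, t). e x t)"
    and et: "\<And>x t. t \<in> {0<..T} \<Longrightarrow> ((\<lambda>s. e x s) has_real_derivative et x t) (at t within {0..T})"
    and ex: "\<And>x t i. t \<in> {0<..T} \<Longrightarrow> ((\<lambda>h. e (x + h *\<^sub>R axis i 1) t) has_real_derivative ex i x t) (at 0)"
    and exx: "\<And>x t i. t \<in> {0<..T} \<Longrightarrow> ((\<lambda>h. ex i (x + h *\<^sub>R axis i 1) t) has_real_derivative exx i x t) (at 0)"
    and e0: "\<And>x t. t \<in> {0..T} \<Longrightarrow> e x t \<ge> 0"
    and core: "\<And>x t. t \<in> {0..t1} \<Longrightarrow> norm (x - x0) = a \<Longrightarrow> e x t \<ge> c0"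
    and ineq: "\<And>x t. t \<in> {0<..t1} \<Longrightarrow> a < norm (x - x0) \<Longrightarrow> norm (x - x0) < a + s * t \<Longrightarrow>
      k * (\<Sum>i\<in>UNIV. exx i x t) \<le> r x t * (et x t + (\<Sum>i\<in>UNIV. u x t $ i * ex i x t)) + b x t * e x t"
    and bounds: "\<And>x t. t \<in> {0<..t1} \<Longrightarrow> a < norm (x - x0) \<Longrightarrow> norm (x - x0) < a + s * t \<Longrightarrow>
      0 \<le> r x t \<and> r x t \<le> Rm \<and> \<bar>b x t\<bar> \<le> C \<and> norm (u x t) \<le> Um"
    and x1: "norm (x1 - x0) = a + s * t1" "e x1 t1 = 0"
  shows False
proof -
  define L where "L = a + s * t1"
  have L: "L > 0" using pos t1 by (simp add: L_def add_pos_pos)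
  \<comment> \<open>Collects, after division by one factor \<open>al\<close>, every term that
    \<open>4 * k * a\<^sup>2 * al\<close> must beat: the lower-order part of the Laplacian, the
    first-order terms and the zero-order term. \<open>al\<close> is then chosen so that this
    quantity exceeds \<open>A\<close> by \<open>4 * k * a\<^sup>2\<close>.\<close>
  define A where "A = 2 * k * real CARD('n) + 2 * \<bar>Rm\<bar> * L * (s + \<bar>Um\<bar>) + \<bar>C\<bar>"
  have A: "A \<ge> 0" using pos L by (auto simp: A_def intro!: add_nonneg_nonneg mult_nonneg_nonneg)
  define al where "al = 1 + A / (4 * k * a\<^sup>2)"
  have al1: "al \<ge> 1" using A pos by (simp add: al_def)
  have alA: "4 * k * a\<^sup>2 * al = 4 * k * a\<^sup>2 + A" using pos by (simp add: al_def field_simps)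
  \<comment> \<open>On the inner sphere \<open>- q\<close> is at most \<open>L\<^sup>2\<close>, so
    this factor keeps the barrier below the lower bound \<open>c0\<close> of \<open>e\<close>
    there.\<close>
  define ep where "ep = c0 * exp (- al * L\<^sup>2)"
  have ep: "ep > 0" using pos by (simp add: ep_def)
  define q where "q x t = (norm (x - x0))\<^sup>2 - (a + s * t)\<^sup>2" for x t
  define H where "H x t = ep * exp (- al * q x t)" for x t
  have H: "H x t > 0" for x t using ep by (simp add: H_def)
  define w where "w x t = H x t - ep" for x t
  have rad: "0 < a + s * t" "a + s * t \<le> L" if "t \<in> {0..t1}" for t
  proof -
    have "0 \<le> s * t" "s * t \<le> s * t1" using that pos by (auto intro: mult_left_mono)
    then show "0 < a + s * t" "a + s * t \<le> L" using pos by (auto simp: L_def)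
  qed
  let ?D = "cball x0 L \<times> {0..t1}"
  let ?N = "{p \<in> ?D. a \<le> norm (fst p - x0) \<and> norm (fst p - x0) \<le> a + s * snd p}"
  \<comment> \<open>A negative minimum of \<open>e - w\<close> over the compact annular region is
    excluded on the outer sphere, where \<open>w\<close> = 0 \<le> \<open>e\<close>, and on the
    inner one, where \<open>w\<close> \<le> \<open>c0\<close> \<le> \<open>e\<close>. At time 0 the
    two spheres coincide. The minimum is thus interior in space and at a positive time, where the
    derivative tests apply.\<close>
  have barrier: "e x t \<ge> w x t" if xt: "t \<in> {0..t1}" "a \<le> norm (x - x0)" "norm (x - x0) \<le> a + s * t" for x t
  proof (rule ccontr)
    assume neg: "\<not> e x t \<ge> w x t"
    have "closed {p :: (real^'n) \<times> real. a \<le> norm (fst p - x0)}"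
      "closed {p :: (real^'n) \<times> real. norm (fst p - x0) \<le> a + s * snd p}"
      by (intro closed_Collect_le continuous_intros)+
    moreover have cD: "compact ?D" by (intro compact_Times) auto
    ultimately have "compact (?D \<inter> ({p. a \<le> norm (fst p - x0)} \<inter> {p. norm (fst p - x0) \<le> a + s * snd p}))"
      by (intro compact_Int_closed closed_Int)
    moreover have "?D \<inter> ({p. a \<le> norm (fst p - x0)} \<inter> {p. norm (fst p - x0) \<le> a + s * snd p}) = ?N" by blast
    ultimately have cN: "compact ?N" by simp
    have "?N \<subseteq> UNIV \<times> {0..T}" using t1 by auto
    from continuous_on_subset[OF ce this] have "continuous_on ?N (\<lambda>p. e (fst p) (snd p))"
      by (simp add: case_prod_beta')
    then have cz: "continuous_on ?N (\<lambda>p. e (fst p) (snd p) - w (fst p) (snd p))"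
      unfolding w_def H_def q_def by (intro continuous_intros)
    have inN: "(x, t) \<in> ?N" using xt rad(2)[of t] by (auto simp: dist_norm norm_minus_commute)
    then obtain p where p: "p \<in> ?N" "\<And>p'. p' \<in> ?N \<Longrightarrow>
        e (fst p) (snd p) - w (fst p) (snd p) \<le> e (fst p') (snd p') - w (fst p') (snd p')"
      using continuous_attains_inf[OF cN _ cz] by blast
    define y where "y = fst p"
    define v where "v = snd p"
    have y: "a \<le> norm (y - x0)" "norm (y - x0) \<le> a + s * v" "v \<in> {0..t1}"
      using p(1) by (auto simp: y_def v_def)
    have min: "e y v - w y v \<le> e y' v' - w y' v'"
      if "v' \<in> {0..t1}" "a \<le> norm (y' - x0)" "norm (y' - x0) \<le> a + s * v'" for y' v'
      using p(2)[of "(y', v')"] that rad(2)[of v'] by (auto simp: y_def v_def dist_norm norm_minus_commute)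
    have lt: "e y v < w y v" using min[OF xt] neg by simp
    have vT: "v \<in> {0..T}" using y(3) t1 by auto
    have "w y v > 0" using lt e0[OF vT, of y] by simp
    have ne1: "norm (y - x0) \<noteq> a + s * v"
    proof
      assume "norm (y - x0) = a + s * v"
      then have "w y v = 0" by (simp add: w_def H_def q_def)
      with \<open>w y v > 0\<close> show False by simp
    qed
    have ne2: "norm (y - x0) \<noteq> a"
    proof
      assume "norm (y - x0) = a"
      then have "c0 < w y v" using core[OF y(3)] lt by fastforce
      also have "w y v \<le> ep * exp (al * L\<^sup>2)"
      proof -
        have "(a + s * v)\<^sup>2 \<le> L\<^sup>2" using rad[OF y(3)] by (intro power_mono) auto
        then have "- q y v \<le> L\<^sup>2" unfolding q_def by (smt (verit) zero_le_power2)
        then have "al * - q y v \<le> al * L\<^sup>2" using al1 by (intro mult_left_mono) auto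
        then have "exp (- al * q y v) \<le> exp (al * L\<^sup>2)" by simp
        then have "H y v \<le> ep * exp (al * L\<^sup>2)" unfolding H_def using ep by (intro mult_left_mono) auto
        then show ?thesis using ep by (simp add: w_def)
      qed
      also have "\<dots> = c0" by (simp add: ep_def exp_minus)
      finally show False by simp
    qed
    have yi: "a < norm (y - x0)" "norm (y - x0) < a + s * v" using y ne1 ne2 by auto
    have v0: "v > 0" using yi y(3) by (cases "v = 0") auto
    have vt1: "v \<in> {0<..t1}" and vT': "v \<in> {0<..T}" using v0 y(3) t1 by auto
    \<comment> \<open>The minimum may occur at the last time, so only earlier times are used; going
      back by less than the gap to the outer sphere divided by \<open>s\<close> leaves
      \<open>y\<close> inside the region.\<close>
    have time: "et y v \<le> H y v * (2 * al * s * (a + s * v))"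
    proof -
      have Dt: "((\<lambda>t. w y t - e y t) has_real_derivative H y v * (2 * al * s * (a + s * v)) - et y v) (at v within {0..T})"
        unfolding w_def H_def q_def
        by (auto intro!: derivative_eq_intros et[OF vT'] simp: algebra_simps power2_eq_square)
      have mt: "w y v' - e y v' \<le> w y v - e y v"
        if "0 \<le> v'" "v' \<le> v" "v - (a + s * v - norm (y - x0)) / s < v'" for v'
      proof -
        have "s * (v - (a + s * v - norm (y - x0)) / s) < s * v'" using that pos by (intro mult_strict_left_mono) auto
        moreover have "s * (v - (a + s * v - norm (y - x0)) / s) = s * v - (a + s * v - norm (y - x0))"
          using pos by (simp add: field_simps)
        ultimately have "norm (y - x0) < a + s * v'" by linarith
        then show ?thesis using min[of v' y] that y by auto
      qed
      have "v \<le> T" "(a + s * v - norm (y - x0)) / s > 0" using vT yi pos by auto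
      from deriv_nonneg_at_left_max[OF Dt v0 this mt]
      have "H y v * (2 * al * s * (a + s * v)) - et y v \<ge> 0" .
      then show ?thesis by simp
    qed
    define d where "d = min (norm (y - x0) - a) (a + s * v - norm (y - x0))"
    have d: "d > 0" using yi by (simp add: d_def)
    have space: "ex i y v = - (2 * al * (y - x0) $ i) * H y v"
      "exx i y v \<ge> H y v * (4 * al\<^sup>2 * ((y - x0) $ i)\<^sup>2 - 2 * al)" for i
    proof -
      let ?e = "axis i 1 :: real^'n"
      \<comment> \<open>The barrier along an axis, plus \<open>ep\<close>, with the squared norm
        expanded into a polynomial in the step h, so that it can be differentiated directly.\<close>
      let ?W = "\<lambda>h. ep * exp (- al * ((norm (y - x0))\<^sup>2 + 2 * h * (y - x0) $ i + h\<^sup>2 - (a + s * v)\<^sup>2))"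
      let ?g = "\<lambda>h. e (y + h *\<^sub>R ?e) v - w (y + h *\<^sub>R ?e) v"
      let ?g' = "\<lambda>h. ex i (y + h *\<^sub>R ?e) v + ?W h * (al * (2 * (y - x0) $ i + 2 * h))"
      have W0: "?W 0 = H y v" by (simp add: H_def q_def)
      have dW: "(?W has_real_derivative - (?W h * (al * (2 * (y - x0) $ i + 2 * h)))) (at h)" for h
        by (auto intro!: derivative_eq_intros simp: algebra_simps)
      have g: "(?g has_real_derivative ?g' h) (at h)" for h
      proof -
        have "?g = (\<lambda>h. e (y + h *\<^sub>R ?e) v - (?W h - ep))"
          unfolding w_def H_def q_def norm_axis_step by (rule refl)
        moreover have "((\<lambda>h. e (y + h *\<^sub>R ?e) v - (?W h - ep)) has_real_derivative
           ex i (y + h *\<^sub>R ?e) v - (- (?W h * (al * (2 * (y - x0) $ i + 2 * h))) - 0)) (at h)"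
          by (rule DERIV_diff[OF line_derivI[of "\<lambda>y. e y v" ?e "\<lambda>y. ex i y v", OF ex[OF vT']]
                DERIV_diff[OF dW DERIV_const]])
        ultimately show ?thesis by simp
      qed
      have g2: "(?g' has_real_derivative exx i y v +
          (- (?W 0 * (al * (2 * (y - x0) $ i + 2 * 0))) * (al * (2 * (y - x0) $ i + 2 * 0)) + al * 2 * ?W 0)) (at 0)"
      proof -
        have "((\<lambda>h. al * (2 * (y - x0) $ i + 2 * h)) has_real_derivative al * 2) (at 0)"
          by (auto intro!: derivative_eq_intros)
        from DERIV_add[OF exx[OF vT'] DERIV_mult[OF dW this]] show ?thesis .
      qed
      have mn: "?g 0 \<le> ?g h" if "\<bar>h\<bar> < d" for h
      proof -
        have "\<bar>norm (y + h *\<^sub>R ?e - x0) - norm (y - x0)\<bar> \<le> norm (h *\<^sub>R ?e)"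
          using norm_triangle_ineq3[of "y + h *\<^sub>R ?e - x0" "y - x0"] by simp
        then have "\<bar>norm (y + h *\<^sub>R ?e - x0) - norm (y - x0)\<bar> < d" using that by (simp add: norm_axis_1)
        then show ?thesis using min[OF y(3), of "y + h *\<^sub>R ?e"] by (auto simp: d_def)
      qed
      have "?g' 0 = 0" by (rule second_deriv_nonneg_at_min(1)[OF g g2 d mn])
      then show "ex i y v = - (2 * al * (y - x0) $ i) * H y v" by (simp add: H_def q_def algebra_simps)
      have "exx i y v + (- (?W 0 * (al * (2 * (y - x0) $ i + 2 * 0))) * (al * (2 * (y - x0) $ i + 2 * 0)) + al * 2 * ?W 0) \<ge> 0"
        by (rule second_deriv_nonneg_at_min(2)[OF g g2 d mn])
      then show "exx i y v \<ge> H y v * (4 * al\<^sup>2 * ((y - x0) $ i)\<^sup>2 - 2 * al)"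
        unfolding W0 by (simp add: algebra_simps power2_eq_square)
    qed
    have bd: "0 \<le> r y v" "r y v \<le> \<bar>Rm\<bar>" "\<bar>b y v\<bar> \<le> \<bar>C\<bar>" "norm (u y v) \<le> \<bar>Um\<bar>"
      using bounds[OF vt1 yi] by auto
    have nL: "norm (y - x0) \<le> L" using yi rad[OF y(3)] by simp
    have "H y v * (4 * al\<^sup>2 * a\<^sup>2 - 2 * al * real CARD('n)) \<le> H y v * (4 * al\<^sup>2 * (norm (y - x0))\<^sup>2 - 2 * al * real CARD('n))"
      using yi pos H[of y v] by (intro mult_left_mono diff_right_mono power_mono) auto
    also have "\<dots> = (\<Sum>i\<in>UNIV. H y v * (4 * al\<^sup>2 * ((y - x0) $ i)\<^sup>2 - 2 * al))"
    proof -
      have "(norm (y - x0))\<^sup>2 = (\<Sum>i\<in>UNIV. ((y - x0) $ i)\<^sup>2)"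
        unfolding power2_norm_eq_inner by (simp add: inner_vec_def power2_eq_square)
      then show ?thesis by (simp add: sum_distrib_left sum_subtractf right_diff_distrib)
    qed
    also have "\<dots> \<le> (\<Sum>i\<in>UNIV. exx i y v)" by (intro sum_mono space(2))
    finally have "k * (H y v * (4 * al\<^sup>2 * a\<^sup>2 - 2 * al * real CARD('n))) \<le> k * (\<Sum>i\<in>UNIV. exx i y v)"
      using pos by (intro mult_left_mono) auto
    also have "\<dots> \<le> r y v * (et y v + (\<Sum>i\<in>UNIV. u y v $ i * ex i y v)) + b y v * e y v"
      by (rule ineq[OF vt1 yi])
    also have "\<dots> \<le> \<bar>Rm\<bar> * (H y v * (2 * al * L * (s + \<bar>Um\<bar>))) + \<bar>C\<bar> * H y v"
    proof (rule add_mono)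
      have "(\<Sum>i\<in>UNIV. u y v $ i * ex i y v) = - (2 * al * H y v) * (u y v \<bullet> (y - x0))"
        unfolding space(1) by (simp add: inner_vec_def sum_distrib_left sum_negf mult_ac)
      also have "\<dots> \<le> (2 * al * H y v) * (\<bar>Um\<bar> * L)"
      proof -
        have "\<bar>u y v \<bullet> (y - x0)\<bar> \<le> norm (u y v) * norm (y - x0)" by (rule Cauchy_Schwarz_ineq2)
        also have "\<dots> \<le> \<bar>Um\<bar> * L" using bd nL by (intro mult_mono) auto
        finally have "- (u y v \<bullet> (y - x0)) \<le> \<bar>Um\<bar> * L" by linarith
        then have "(2 * al * H y v) * - (u y v \<bullet> (y - x0)) \<le> (2 * al * H y v) * (\<bar>Um\<bar> * L)"
          using al1 H[of y v] by (intro mult_left_mono) auto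
        then show ?thesis by (simp only: minus_mult_commute)
      qed
      finally have "(\<Sum>i\<in>UNIV. u y v $ i * ex i y v) \<le> (2 * al * H y v) * (\<bar>Um\<bar> * L)" .
      moreover have "et y v \<le> H y v * (2 * al * s * L)"
      proof -
        have "H y v * (2 * al * s * (a + s * v)) \<le> H y v * (2 * al * s * L)"
          using rad[OF y(3)] H[of y v] al1 pos by (intro mult_left_mono) auto
        then show ?thesis using time by linarith
      qed
      ultimately have "et y v + (\<Sum>i\<in>UNIV. u y v $ i * ex i y v) \<le> H y v * (2 * al * L * (s + \<bar>Um\<bar>))"
        by (simp add: algebra_simps)
      then have "r y v * (et y v + (\<Sum>i\<in>UNIV. u y v $ i * ex i y v)) \<le> r y v * (H y v * (2 * al * L * (s + \<bar>Um\<bar>)))"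
        using bd(1) by (rule mult_left_mono)
      also have "\<dots> \<le> \<bar>Rm\<bar> * (H y v * (2 * al * L * (s + \<bar>Um\<bar>)))"
        using bd(2) H[of y v] al1 pos L by (intro mult_right_mono mult_nonneg_nonneg) auto
      finally show "r y v * (et y v + (\<Sum>i\<in>UNIV. u y v $ i * ex i y v)) \<le> \<bar>Rm\<bar> * (H y v * (2 * al * L * (s + \<bar>Um\<bar>)))" .
      \<comment> \<open>Here the assumed violation enters again: \<open>e\<close> < \<open>w\<close>
        < \<open>H\<close> at this point, so the zero-order term is also measured by
        \<open>H\<close>, and the factor \<open>H\<close> can be cancelled.\<close>
      have "b y v * e y v \<le> \<bar>C\<bar> * e y v" using bd(3) e0[OF vT, of y] by (intro mult_right_mono) auto
      also have "\<dots> \<le> \<bar>C\<bar> * H y v" using lt ep by (intro mult_left_mono) (auto simp: w_def)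
      finally show "b y v * e y v \<le> \<bar>C\<bar> * H y v" .
    qed
    finally have "H y v * (k * (4 * al\<^sup>2 * a\<^sup>2 - 2 * al * real CARD('n))) \<le> H y v * (\<bar>Rm\<bar> * (2 * al * L * (s + \<bar>Um\<bar>)) + \<bar>C\<bar>)"
      by (simp add: algebra_simps)
    then have "k * (4 * al\<^sup>2 * a\<^sup>2 - 2 * al * real CARD('n)) \<le> \<bar>Rm\<bar> * (2 * al * L * (s + \<bar>Um\<bar>)) + \<bar>C\<bar>"
      using H[of y v] by simp
    \<comment> \<open>The factor \<open>al\<close> \<ge> 1 is inserted in the zero-order term so
      that a whole \<open>al\<close> can be divided out.\<close>
    also have "\<dots> \<le> \<bar>Rm\<bar> * (2 * al * L * (s + \<bar>Um\<bar>)) + al * \<bar>C\<bar>"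
      using al1 mult_right_mono[of 1 al "\<bar>C\<bar>"] by simp
    finally have "al * (4 * k * a\<^sup>2 * al) \<le> al * A"
      unfolding A_def by (simp add: algebra_simps power2_eq_square)
    then have "4 * k * a\<^sup>2 * al \<le> A" using al1 by simp
    moreover have "0 < k * a\<^sup>2" using pos by simp
    ultimately show False using alA by linarith
  qed
  have t1T: "t1 \<in> {0<..T}" using t1 by auto
  \<comment> \<open>Only coordinate derivatives are at hand, so contact is approached along an axis
    on which the normal has a nonzero component, with \<open>sg\<close> pointing inward.\<close>
  have "x1 - x0 \<noteq> 0" using x1 L by (auto simp: L_def)
  then obtain i where i: "(x1 - x0) $ i \<noteq> 0" by (metis vec_eq_iff zero_index)
  define pp where "pp = (x1 - x0) $ i"
  let ?e = "axis i 1 :: real^'n"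
  define sg where "sg = - sgn pp"
  have sg: "sg * pp = - \<bar>pp\<bar>" "sg\<^sup>2 = 1" "pp \<noteq> 0"
    using i by (auto simp: sg_def pp_def sgn_if power2_eq_square)
  let ?f = "\<lambda>h. e (x1 + h *\<^sub>R ?e) t1"
  \<comment> \<open>\<open>e\<close> is nonnegative everywhere and 0 at the contact point, which is
    a global minimum in space.\<close>
  have "ex i x1 t1 = 0"
    by (rule DERIV_local_min[OF ex[OF t1T], of 1]) (use e0 x1 t1 in auto)
  with ex[OF t1T, of x1 i] have f0: "(?f has_real_derivative 0) (at 0)" by simp
  have "((\<lambda>h. sg * h) has_real_derivative sg) (at 0)" by (auto intro!: derivative_eq_intros)
  then have "((\<lambda>h. ?f (sg * h)) has_real_derivative 0 * sg) (at 0)"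
    using f0 by (intro DERIV_chain2[of ?f]) auto
  \<comment> \<open>Subtracting the linear growth that the barrier guarantees gives a strictly
    negative slope: for small inward steps \<open>e\<close> must fall short of that growth.\<close>
  then have D: "((\<lambda>h. ?f (sg * h) - ep * al * \<bar>pp\<bar> * h) has_real_derivative 0 * sg - ep * al * \<bar>pp\<bar> * 1) (at 0)"
    by (intro DERIV_diff DERIV_cmult DERIV_ident)
  have neg: "0 * sg - ep * al * \<bar>pp\<bar> * 1 < 0" using ep al1 sg by simp
  obtain d where d: "d > 0"
    "\<And>h. h > 0 \<Longrightarrow> h < d \<Longrightarrow> ?f (sg * h) - ep * al * \<bar>pp\<bar> * h < ?f 0"
    using has_real_derivative_neg_dec_right[OF D neg] by auto
  have La: "L > a" using t1 pos by (simp add: L_def)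
  \<comment> \<open>\<open>h\<close> \<le> |pp| lets the linear term dominate the square, which also
    keeps the point in the ball; \<open>h\<close> \<le> L - a keeps it off the interior of the
    core.\<close>
  define h where "h = min (d / 2) (min \<bar>pp\<bar> (L - a))"
  have h: "h > 0" "h < d" "h \<le> \<bar>pp\<bar>" "h \<le> L - a" using d(1) sg La by (auto simp: h_def)
  define x where "x = x1 + (sg * h) *\<^sub>R ?e"
  have nx2: "(norm (x - x0))\<^sup>2 = L\<^sup>2 - 2 * h * \<bar>pp\<bar> + h\<^sup>2"
  proof -
    have "(norm (x - x0))\<^sup>2 = (norm (x1 - x0))\<^sup>2 + 2 * h * (sg * pp) + h\<^sup>2 * sg\<^sup>2"
      unfolding x_def norm_axis_step pp_def by (simp add: power_mult_distrib mult_ac)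
    then show ?thesis using x1 unfolding sg by (simp add: L_def)
  qed
  have hh: "h * \<bar>pp\<bar> \<le> 2 * h * \<bar>pp\<bar> - h\<^sup>2"
    using h mult_left_mono[of h "\<bar>pp\<bar>" h] by (simp add: power2_eq_square)
  have "(norm (x - x0))\<^sup>2 \<le> L\<^sup>2" using nx2 hh h sg by (smt (verit) mult_pos_pos zero_less_abs_iff)
  then have up: "norm (x - x0) \<le> a + s * t1" using L power2_le_imp_le[of "norm (x - x0)" L] by (simp add: L_def)
  have lo: "a \<le> norm (x - x0)"
  proof -
    have "norm (x1 - x0) \<le> norm (x - x0) + norm ((sg * h) *\<^sub>R ?e)"
      using norm_triangle_ineq4[of "x - x0" "(sg * h) *\<^sub>R ?e"] by (simp add: x_def)
    also have "norm ((sg * h) *\<^sub>R ?e) = h"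
      using sg(2) h by (simp add: abs_mult abs_square_eq_1)
    finally show ?thesis using x1 h by (simp add: L_def)
  qed
  have "ep * al * \<bar>pp\<bar> * h \<le> w x t1"
  proof -
    have "al * (h * \<bar>pp\<bar>) \<le> al * (2 * h * \<bar>pp\<bar> - h\<^sup>2)" using hh al1 by (intro mult_left_mono) auto
    also have "\<dots> = - al * q x t1" unfolding q_def nx2 by (simp add: L_def algebra_simps)
    \<comment> \<open>The bound exp z \<ge> 1 + z makes the barrier grow at least linearly
      inward.\<close>
    also have "\<dots> \<le> exp (- al * q x t1) - 1" using exp_ge_add_one_self[of "- al * q x t1"] by linarith
    finally have "ep * (al * (h * \<bar>pp\<bar>)) \<le> ep * (exp (- al * q x t1) - 1)" using ep by (intro mult_left_mono) auto
    then show ?thesis by (simp add: w_def H_def algebra_simps)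
  qed
  also have "\<dots> \<le> e x t1" using barrier[of t1 x] t1 lo up by auto
  finally show False using d(2)[OF h(1,2)] x1(2) by (simp add: x_def)
qed

text \<open>The nonpositive points over the closed ball form a compact set, so if there are any they
  have an earliest time; it is positive by the initial condition, and half of it is safe.\<close>

lemma positive_persists:
  fixes r :: "'a::euclidean_space \<Rightarrow> real \<Rightarrow> real"
  assumes T: "T > 0" and cr: "continuous_on (UNIV \<times> {0..T}) (\<lambda>(x, t). r x t)"
    and pos: "\<And>x. x \<in> cball x0 a \<Longrightarrow> r x 0 > 0"
  obtains \<tau> where "0 < \<tau>" "\<tau> \<le> T" "\<And>x t. x \<in> cball x0 a \<Longrightarrow> t \<in> {0..\<tau>} \<Longrightarrow> r x t > 0"
proof -
  let ?D = "cball x0 a \<times> {0..T}"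
  let ?Z = "{p \<in> ?D. r (fst p) (snd p) \<le> 0}"
  have "?D \<subseteq> UNIV \<times> {0..T}" by auto
  from continuous_on_subset[OF cr this] have c: "continuous_on ?D (\<lambda>p. r (fst p) (snd p))"
    by (simp add: case_prod_beta')
  have cD: "compact ?D" by (intro compact_Times) auto
  have "closed ?Z"
    by (intro continuous_on_closed_Collect_le c continuous_on_const closed_Times) auto
  moreover have "bounded ?Z" by (rule bounded_subset[OF compact_imp_bounded[OF cD]]) auto
  ultimately have Z: "compact ?Z" by (simp add: compact_eq_bounded_closed)
  show thesis
  proof (cases "?Z = {}")
    case True
    show thesis
    proof (rule that[of T])
      fix x t assume "x \<in> cball x0 a" "t \<in> {0..T}"
      moreover from this have "(x, t) \<notin> ?Z" using True by blast
      ultimately show "r x t > 0" by auto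
    qed (use T in auto)
  next
    case False
    have "continuous_on ?Z snd" by (intro continuous_intros)
    then obtain p where p: "p \<in> ?Z" "\<And>q. q \<in> ?Z \<Longrightarrow> snd p \<le> snd q"
      using continuous_attains_inf[OF Z False] by blast
    have p0: "snd p > 0"
    proof (rule ccontr)
      assume "\<not> snd p > 0"
      then have "snd p = 0" using p(1) by auto
      then show False using pos[of "fst p"] p(1) by auto
    qed
    show thesis
    proof (rule that[of "snd p / 2"])
      fix x t assume xt: "x \<in> cball x0 a" "t \<in> {0..snd p / 2}"
      show "r x t > 0"
      proof (rule ccontr)
        assume "\<not> r x t > 0"
        then have "(x, t) \<in> ?Z" using xt p(1) by auto
        then show False using p(2)[of "(x, t)"] xt p0 by auto
      qed
    qed (use p p0 in auto)
  qed
qed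

text \<open>Keeping only diagonal entries bounds the first term below by 2\<mu> times the sum of the
  squares of \<open>A i i\<close>, and Cauchy-Schwarz bounds this below by (2\<mu>/n) times the
  squared trace. Multiples of the identity give equality, so the condition on \<open>lam\<close> is
  sharp.\<close>

lemma dissipation_nonneg:
  fixes A :: "'n::finite \<Rightarrow> 'n \<Rightarrow> real"
  assumes mu: "\<mu> > 0" and lam: "2 * \<mu> + real CARD('n) * lam \<ge> 0"
  shows "0 \<le> \<mu> / 2 * (\<Sum>i\<in>UNIV. \<Sum>j\<in>UNIV. (A i j + A j i)\<^sup>2) + lam * (\<Sum>i\<in>UNIV. A i i)\<^sup>2"
proof -
  let ?n = "real CARD('n)"
  have n: "?n > 0" by simp
  have "(\<Sum>i\<in>UNIV. A i i)\<^sup>2 \<le> ?n * (\<Sum>i\<in>UNIV. (A i i)\<^sup>2)"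
    using Cauchy_Schwarz_ineq_sum[of "\<lambda>i. 1" "\<lambda>i. A i i" UNIV] by simp
  then have "(2 * \<mu> / ?n) * (\<Sum>i\<in>UNIV. A i i)\<^sup>2 \<le> (2 * \<mu> / ?n) * (?n * (\<Sum>i\<in>UNIV. (A i i)\<^sup>2))"
    using mu n by (intro mult_left_mono) auto
  also have "\<dots> = \<mu> / 2 * (\<Sum>i\<in>UNIV. (A i i + A i i)\<^sup>2)"
    by (simp add: power2_eq_square algebra_simps sum_distrib_left)
  also have "\<dots> \<le> \<mu> / 2 * (\<Sum>i\<in>UNIV. \<Sum>j\<in>UNIV. (A i j + A j i)\<^sup>2)"
  proof -
    have "(A i i + A i i)\<^sup>2 \<le> (\<Sum>j\<in>UNIV. (A i j + A j i)\<^sup>2)" for i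
      by (rule member_le_sum[of i UNIV "\<lambda>j. (A i j + A j i)\<^sup>2"]) auto
    then show ?thesis using mu by (intro mult_left_mono sum_mono) auto
  qed
  finally have "(2 * \<mu> / ?n + lam) * (\<Sum>i\<in>UNIV. A i i)\<^sup>2 \<le>
     \<mu> / 2 * (\<Sum>i\<in>UNIV. \<Sum>j\<in>UNIV. (A i j + A j i)\<^sup>2) + lam * (\<Sum>i\<in>UNIV. A i i)\<^sup>2"
    by (simp add: distrib_right)
  moreover have "2 * \<mu> / ?n + lam \<ge> 0" using lam n by (simp add: field_simps)
  then have "0 \<le> (2 * \<mu> / ?n + lam) * (\<Sum>i\<in>UNIV. A i i)\<^sup>2" by simp
  ultimately show ?thesis by linarith
qed

section \<open>Energy inequality and conclusion\<close>

lemma dx_eqI: "((\<lambda>h. f (x + h *\<^sub>R axis i 1)) has_real_derivative D) (at 0) \<Longrightarrow> dx i f x = D"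
  unfolding dx_def by (rule DERIV_imp_deriv)

lemma bounded_on_compact:
  fixes f :: "'a::topological_space \<Rightarrow> real \<Rightarrow> 'b::real_normed_vector"
  assumes "continuous_on (UNIV \<times> {0..T}) (\<lambda>(x, t). f x t)" "compact K"
  obtains B where "\<And>x t. x \<in> K \<Longrightarrow> t \<in> {0..T} \<Longrightarrow> norm (f x t) \<le> B"
proof -
  have "bounded ((\<lambda>(x, t). f x t) ` (K \<times> {0..T}))"
    by (intro compact_imp_bounded compact_continuous_image continuous_on_subset[OF assms(1)] compact_Times assms) auto
  then show thesis using that unfolding bounded_iff by fastforce
qed

text \<open>The domain and the entropy enter only through their consequences: a ball of positive
  initial density, a unit ball of initial vacuum, and \<open>e\<close> \<ge> 0 with equality exactly
  where the density vanishes.\<close>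

lemma no_finite_entropy_solution:
  fixes \<rho> e :: "real^'n::finite \<Rightarrow> real \<Rightarrow> real" and u :: "real^'n \<Rightarrow> real \<Rightarrow> real^'n"
  assumes mu: "\<mu> > 0" "2 * \<mu> + real CARD('n) * lam \<ge> 0" and pos: "\<kappa> > 0" "\<gamma> > 1" "R > 0" "T > 0"
    and m: "CARD('n) div 2 + 2 < m"
    and NS: "full_NS \<mu> lam \<kappa> \<gamma> R T \<rho> u e"
    and C1: "C1_Hm m T (\<lambda>t x. \<rho> x t)" "\<And>i. C1_Hm m T (\<lambda>t x. u x t $ i)" "C1_Hm m T (\<lambda>t x. e x t)"
    and cr: "continuous_on (UNIV \<times> {0..T}) (\<lambda>(x, t). \<rho> x t)"
    and cu: "continuous_on (UNIV \<times> {0..T}) (\<lambda>(x, t). u x t)"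
    and ce: "continuous_on (UNIV \<times> {0..T}) (\<lambda>(x, t). e x t)"
    and e0: "\<And>x t. t \<in> {0..T} \<Longrightarrow> e x t \<ge> 0"
    and ez: "\<And>x t. t \<in> {0..T} \<Longrightarrow> e x t = 0 \<longleftrightarrow> \<rho> x t = 0"
    and a: "a > 0" and init: "\<And>x. x \<in> cball x0 a \<Longrightarrow> \<rho> x 0 > 0"
    and vac: "\<And>x. x \<in> cball xc 1 \<Longrightarrow> \<rho> x 0 = 0"
  shows False
proof -
  have slice: "continuous_on UNIV (\<lambda>x. f x t)" if "continuous_on (UNIV \<times> {0..T}) (\<lambda>(x, t). f x t)" "t \<in> {0..T}"
    for f :: "real^'n \<Rightarrow> real \<Rightarrow> 'z::real_normed_vector" and t
    by (rule continuous_on_compose2[OF that(1), of UNIV "\<lambda>x. (x, t)", simplified])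
       (use that in \<open>auto intro!: continuous_intros\<close>)
  note Cr = C1_Hm_classical[OF C1(1) m \<open>T > 0\<close> slice[OF cr]]
  note Ce = C1_Hm_classical[OF C1(3) m \<open>T > 0\<close> slice[OF ce]]
  have cui: "continuous_on UNIV (\<lambda>x. u x t $ i)" if "t \<in> {0..T}" for t i
    by (intro continuous_on_component slice[OF cu that])
  note Cu = C1_Hm_classical[OF C1(2) m \<open>T > 0\<close> cui]
  define rt where "rt x t = dt T (\<lambda>s. \<rho> x s) t" for x t
  define et where "et x t = dt T (\<lambda>s. e x s) t" for x t
  define rx where "rx i x t = dx i (\<lambda>y. \<rho> y t) x" for i x t
  define ex where "ex i x t = dx i (\<lambda>y. e y t) x" for i x t
  define exx where "exx i x t = dx i (dx i (\<lambda>y. e y t)) x" for i x t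
  define ux where "ux i j x t = dx i (\<lambda>y. u y t $ j) x" for i j x t
  define dv where "dv x t = (\<Sum>i\<in>UNIV. ux i i x t)" for x t
  have dr: "((\<lambda>h. \<rho> (x + h *\<^sub>R axis i 1) t) has_real_derivative rx i x t) (at 0)"
    and de: "((\<lambda>h. e (x + h *\<^sub>R axis i 1) t) has_real_derivative ex i x t) (at 0)"
    and du: "((\<lambda>h. u (x + h *\<^sub>R axis i 1) t $ j) has_real_derivative ux i j x t) (at 0)"
    and dee: "((\<lambda>h. ex i (x + h *\<^sub>R axis i 1) t) has_real_derivative exx i x t) (at 0)"
    and drt: "((\<lambda>s. \<rho> x s) has_real_derivative rt x t) (at t within {0..T})"
    and det: "((\<lambda>s. e x s) has_real_derivative et x t) (at t within {0..T})"
    if "t \<in> {0<..T}" for x t i j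
    using Cr(1,3)[of t] Ce(1,2,3)[of t] Cu(1)[of t] that
    by (auto simp: rx_def ex_def exx_def ux_def rt_def et_def)
  have "\<forall>j. \<exists>B. \<forall>t\<in>{0..T}. \<forall>x i. \<bar>ux i j x t\<bar> \<le> B" using Cu(4) by (auto simp: ux_def)
  then obtain Bu where Bu: "\<And>j t x i. t \<in> {0..T} \<Longrightarrow> \<bar>ux i j x t\<bar> \<le> Bu j" by metis
  define K where "K = (\<Sum>j\<in>UNIV. Bu j)"
  have dvK: "\<bar>dv x t\<bar> \<le> K" if "t \<in> {0..T}" for x t
    unfolding dv_def K_def by (intro order_trans[OF sum_abs] sum_mono Bu that)
  have mass: "rt x t + (\<Sum>i\<in>UNIV. rx i x t * u x t $ i) + \<rho> x t * dv x t = 0" if t: "t \<in> {0<..T}" for x t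
  proof -
    have "dt T (\<lambda>s. \<rho> x s) t + (\<Sum>i\<in>UNIV. dx i (\<lambda>y. \<rho> y t * u y t $ i) x) = 0"
      using NS t unfolding full_NS_def Let_def by blast
    moreover have "dx i (\<lambda>y. \<rho> y t * u y t $ i) x = rx i x t * u x t $ i + ux i i x t * \<rho> x t" for i
      using DERIV_mult[OF dr[OF t, of x i] du[OF t, of x i i]] by (intro dx_eqI) simp
    ultimately show ?thesis
      by (simp add: rt_def dv_def sum.distrib sum_distrib_left mult.commute add.assoc)
  qed
  let ?k = "\<kappa> * (\<gamma> - 1) / R"
  have k: "?k > 0" using pos by simp
  \<comment> \<open>The continuity equation, multiplied by \<open>e\<close>, is subtracted from the
    conservative form, which leaves density times the material derivative of \<open>e\<close>.
    Dropping the nonnegative dissipation gives the inequality, and the pressure work becomes a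
    zero-order term in \<open>e\<close> with a locally bounded coefficient.\<close>
  have energy: "?k * (\<Sum>i\<in>UNIV. exx i x t) \<le>
      \<rho> x t * (et x t + (\<Sum>i\<in>UNIV. u x t $ i * ex i x t)) + ((\<gamma> - 1) * \<rho> x t * dv x t) * e x t"
    if t: "t \<in> {0<..T}" for x t
  proof -
    have "dt T (\<lambda>s. \<rho> x s * e x s) t
        + (\<Sum>i\<in>UNIV. dx i (\<lambda>y. \<rho> y t * e y t * u y t $ i) x)
        + ((\<gamma> - 1) * \<rho> x t * e x t) * (\<Sum>i\<in>UNIV. dx i (\<lambda>z. u z t $ i) x)
      = \<mu> / 2 * (\<Sum>i\<in>UNIV. \<Sum>j\<in>UNIV. (dx i (\<lambda>y. u y t $ j) x + dx j (\<lambda>y. u y t $ i) x)\<^sup>2)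
        + lam * (\<Sum>i\<in>UNIV. dx i (\<lambda>z. u z t $ i) x)\<^sup>2
        + ?k * (\<Sum>i\<in>UNIV. dx i (\<lambda>y. dx i (\<lambda>z. e z t) y) x)"
      using NS t unfolding full_NS_def Let_def by blast
    moreover have "dt T (\<lambda>s. \<rho> x s * e x s) t = rt x t * e x t + et x t * \<rho> x t"
      unfolding dt_def
      by (rule vector_derivative_within_closed_interval)
         (use pos t DERIV_mult[OF drt[OF t, of x] det[OF t, of x]] in \<open>auto simp: has_real_derivative_iff_has_vector_derivative\<close>)
    moreover have "dx i (\<lambda>y. \<rho> y t * e y t * u y t $ i) x =
        (rx i x t * e x t + ex i x t * \<rho> x t) * u x t $ i + ux i i x t * (\<rho> x t * e x t)" for i
      using DERIV_mult[OF DERIV_mult[OF dr[OF t, of x i] de[OF t, of x i]] du[OF t, of x i i]] by (intro dx_eqI) simp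
    moreover have "0 \<le> \<mu> / 2 * (\<Sum>i\<in>UNIV. \<Sum>j\<in>UNIV. (ux i j x t + ux j i x t)\<^sup>2) + lam * (dv x t)\<^sup>2"
      unfolding dv_def by (rule dissipation_nonneg[OF mu])
    ultimately have "?k * (\<Sum>i\<in>UNIV. exx i x t) \<le> rt x t * e x t + et x t * \<rho> x t +
        (\<Sum>i\<in>UNIV. (rx i x t * e x t + ex i x t * \<rho> x t) * u x t $ i + ux i i x t * (\<rho> x t * e x t)) +
        ((\<gamma> - 1) * \<rho> x t * e x t) * dv x t"
      unfolding dv_def ux_def exx_def by simp
    also have "(\<Sum>i\<in>UNIV. (rx i x t * e x t + ex i x t * \<rho> x t) * u x t $ i + ux i i x t * (\<rho> x t * e x t)) =
       e x t * (\<Sum>i\<in>UNIV. rx i x t * u x t $ i) + \<rho> x t * (\<Sum>i\<in>UNIV. u x t $ i * ex i x t) + \<rho> x t * e x t * dv x t"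
      by (simp add: dv_def sum.distrib sum_distrib_left algebra_simps)
    also have "rt x t = - (\<Sum>i\<in>UNIV. rx i x t * u x t $ i) - \<rho> x t * dv x t" using mass[OF t, of x] by simp
    finally show ?thesis by (simp add: algebra_simps)
  qed
  obtain \<tau>1 where \<tau>1: "0 < \<tau>1" "\<tau>1 \<le> T" "\<And>t. t \<in> {0..\<tau>1} \<Longrightarrow> \<rho> xc t = 0"
    by (rule vacuum_persists[OF \<open>T > 0\<close> cr cu drt dr mass dvK vac]) auto
  obtain \<tau>2 where \<tau>2: "0 < \<tau>2" "\<tau>2 \<le> T" "\<And>x t. x \<in> cball x0 a \<Longrightarrow> t \<in> {0..\<tau>2} \<Longrightarrow> \<rho> x t > 0"
    using positive_persists[where r=\<rho>, OF \<open>T > 0\<close> cr init] by blast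
  define \<tau> where "\<tau> = min \<tau>1 \<tau>2"
  have \<tau>: "0 < \<tau>" "\<tau> \<le> T" "\<tau> \<le> \<tau>1" "\<tau> \<le> \<tau>2" using \<tau>1 \<tau>2 by (auto simp: \<tau>_def)
  have cr': "continuous_on (UNIV \<times> {0..\<tau>}) (\<lambda>(x, t). \<rho> x t)"
    by (rule continuous_on_subset[OF cr]) (use \<tau> in auto)
  have pos2: "\<rho> x t > 0" if "x \<in> cball x0 a" "t \<in> {0..\<tau>}" for x t
    using \<tau>2(3)[OF that(1), of t] that(2) \<tau> by auto
  have vac2: "\<rho> xc \<tau> \<le> 0" using \<tau>1(3)[of \<tau>] \<tau> by auto
  show False
  proof (rule touching_expanding_ball[OF cr' \<tau>(1) pos2 vac2 a])
    fix s t1 x1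
    assume s: "s > 0" and t1: "0 < t1" "t1 \<le> \<tau>" and x1: "norm (x1 - x0) = a + s * t1" "\<rho> x1 t1 = 0"
      and inside: "\<And>x t. t \<in> {0..\<tau>} \<Longrightarrow> norm (x - x0) < a + s * t \<Longrightarrow> \<rho> x t > 0"
    have t1T: "t1 \<le> T" using t1 \<tau> by simp
    \<comment> \<open>Positive density on the core gives \<open>e\<close> > 0 there through
      \<open>ez\<close>, and compactness makes the bound uniform in time.\<close>
    obtain c0 where c0: "c0 > 0" "\<And>x t. x \<in> cball x0 a \<Longrightarrow> t \<in> {0..t1} \<Longrightarrow> e x t \<ge> c0"
    proof -
      let ?D = "cball x0 a \<times> {0..t1}"
      have "?D \<subseteq> UNIV \<times> {0..T}" using t1T by auto
      from continuous_on_subset[OF ce this] have c: "continuous_on ?D (\<lambda>p. e (fst p) (snd p))"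
        by (simp add: case_prod_beta')
      have "compact ?D" "?D \<noteq> {}" using a t1 by (auto intro: compact_Times)
      then obtain p where p: "p \<in> ?D" "\<And>q. q \<in> ?D \<Longrightarrow> e (fst p) (snd p) \<le> e (fst q) (snd q)"
        using continuous_attains_inf[OF _ _ c] by blast
      have "snd p \<in> {0..T}" "\<rho> (fst p) (snd p) > 0" using p(1) t1 t1T pos2 by (auto intro!: pos2)
      then have "e (fst p) (snd p) > 0" using e0[of "snd p" "fst p"] ez[of "snd p" "fst p"] by simp
      then show thesis using that[of "e (fst p) (snd p)"] p(2) by fastforce
    qed
    obtain Rm where Rm: "\<And>x t. x \<in> cball x0 (a + s * t1) \<Longrightarrow> t \<in> {0..T} \<Longrightarrow> norm (\<rho> x t) \<le> Rm"
      using bounded_on_compact[OF cr compact_cball] by blast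
    obtain Um where Um: "\<And>x t. x \<in> cball x0 (a + s * t1) \<Longrightarrow> t \<in> {0..T} \<Longrightarrow> norm (u x t) \<le> Um"
      using bounded_on_compact[OF cu compact_cball] by blast
    show False
    proof (rule Hopf_expanding_ball[OF t1(1) t1T a s k c0(1) ce det de dee e0,
          where r=\<rho> and u=u and b="\<lambda>x t. (\<gamma> - 1) * \<rho> x t * dv x t" and Rm=Rm and Um=Um
            and C="(\<gamma> - 1) * Rm * K" and ?x0.0=x0 and ?x1.0=x1])
      show "norm (x1 - x0) = a + s * t1" by (rule x1)
      show "e x1 t1 = 0" using ez[of t1 x1] x1 t1 t1T by simp
      show "e x t \<ge> c0" if "t \<in> {0..t1}" "norm (x - x0) = a" for x t
        using c0(2)[of x t] that by (simp add: dist_norm norm_minus_commute)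
      fix x t assume t: "t \<in> {0<..t1}" and x: "a < norm (x - x0)" "norm (x - x0) < a + s * t"
      have tT: "t \<in> {0<..T}" "t \<in> {0..T}" "t \<in> {0..\<tau>}" using t t1 t1T by auto
      show "?k * (\<Sum>i\<in>UNIV. exx i x t) \<le>
          \<rho> x t * (et x t + (\<Sum>i\<in>UNIV. u x t $ i * ex i x t)) + (\<gamma> - 1) * \<rho> x t * dv x t * e x t"
        by (rule energy[OF tT(1)])
      have "s * t \<le> s * t1" using t s by simp
      then have xb: "x \<in> cball x0 (a + s * t1)" using x by (simp add: dist_norm norm_minus_commute)
      have p: "\<rho> x t > 0" by (rule inside[OF tT(3) x(2)])
      have "\<bar>(\<gamma> - 1) * \<rho> x t * dv x t\<bar> = (\<gamma> - 1) * \<bar>\<rho> x t\<bar> * \<bar>dv x t\<bar>" using pos by (simp add: abs_mult)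
      also have "\<dots> \<le> (\<gamma> - 1) * Rm * K"
        using Rm[OF xb tT(2)] dvK[OF tT(2), of x] pos p by (intro mult_mono) auto
      finally show "0 \<le> \<rho> x t \<and> \<rho> x t \<le> Rm \<and> \<bar>(\<gamma> - 1) * \<rho> x t * dv x t\<bar> \<le> (\<gamma> - 1) * Rm * K \<and> norm (u x t) \<le> Um"
        using p Rm[OF xb tT(2)] Um[OF xb tT(2)] by simp
    qed
  qed
qed

text \<open>Finite entropy is expressed by equating the two pressure laws and cancelling one factor
  \<rho>, because at \<rho> = 0 the uncancelled relation would hold for every
  \<open>S\<close>.\<close>

theorem theorem1p3:
  fixes \<mu> lam \<kappa> \<gamma> R T :: real and m :: nat
    and \<Omega> :: "(real^'n::finite) set"
    and \<rho>0 e0 :: "real^'n \<Rightarrow> real" and u0 :: "real^'n \<Rightarrow> real^'n"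
  assumes "\<mu> > 0" "2 * \<mu> + real CARD('n) * lam \<ge> 0" "\<kappa> > 0" "\<gamma> > 1" "R > 0"
    and "open \<Omega>" "bounded \<Omega>" "smooth_boundary \<Omega>"
    and "continuous_on UNIV \<rho>0" "continuous_on UNIV u0" "continuous_on UNIV e0"
    and "closure {x. \<rho>0 x \<noteq> 0} = closure \<Omega>"
    and "\<forall>x\<in>\<Omega>. \<rho>0 x > 0"
    and "\<forall>x\<in>\<Omega>. e0 x \<ge> 0" "\<exists>x\<in>\<Omega>. e0 x \<noteq> 0"
    and "T > 0" "m > CARD('n) div 2 + 2"
  shows "\<not> (\<exists>\<rho> u e.
            full_NS \<mu> lam \<kappa> \<gamma> R T \<rho> u e \<and>
            (\<forall>x. \<rho> x 0 = \<rho>0 x \<and> u x 0 = u0 x \<and> e x 0 = e0 x) \<and>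
            C1_Hm m T (\<lambda>t x. \<rho> x t) \<and> (\<forall>i. C1_Hm m T (\<lambda>t x. u x t $ i)) \<and> C1_Hm m T (\<lambda>t x. e x t) \<and>
            continuous_on (UNIV \<times> {0..T}) (\<lambda>(x, t). \<rho> x t) \<and>
            continuous_on (UNIV \<times> {0..T}) (\<lambda>(x, t). u x t) \<and>
            continuous_on (UNIV \<times> {0..T}) (\<lambda>(x, t). e x t) \<and>
            (\<forall>x. \<forall>t\<in>{0..T}. \<exists>S::real.
               e x t = exp ((\<gamma> - 1) * S / R) / (\<gamma> - 1) * \<rho> x t powr (\<gamma> - 1)))"
proof (rule notI, elim exE conjE)
  fix \<rho> u e
  assume NS: "full_NS \<mu> lam \<kappa> \<gamma> R T \<rho> u e"
    and ini: "\<forall>x. \<rho> x 0 = \<rho>0 x \<and> u x 0 = u0 x \<and> e x 0 = e0 x"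
    and C1: "C1_Hm m T (\<lambda>t x. \<rho> x t)" "\<forall>i. C1_Hm m T (\<lambda>t x. u x t $ i)" "C1_Hm m T (\<lambda>t x. e x t)"
    and c: "continuous_on (UNIV \<times> {0..T}) (\<lambda>(x, t). \<rho> x t)"
      "continuous_on (UNIV \<times> {0..T}) (\<lambda>(x, t). u x t)"
      "continuous_on (UNIV \<times> {0..T}) (\<lambda>(x, t). e x t)"
    and S: "\<forall>x. \<forall>t\<in>{0..T}. \<exists>S::real.
               e x t = exp ((\<gamma> - 1) * S / R) / (\<gamma> - 1) * \<rho> x t powr (\<gamma> - 1)"
  have e0: "e x t \<ge> 0" if t: "t \<in> {0..T}" for x t
  proof -
    obtain S where "e x t = exp ((\<gamma> - 1) * S / R) / (\<gamma> - 1) * \<rho> x t powr (\<gamma> - 1)"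
      using S[rule_format, OF t, of x] by blast
    then show ?thesis using assms(4) by simp
  qed
  \<comment> \<open>\<open>powr\<close> is 0 at base 0 and an exponential at every other base, so
    finiteness of \<open>S\<close> ties the zeros of \<open>e\<close> to those of \<rho>.\<close>
  have ez: "e x t = 0 \<longleftrightarrow> \<rho> x t = 0" if t: "t \<in> {0..T}" for x t
  proof -
    obtain S where "e x t = exp ((\<gamma> - 1) * S / R) / (\<gamma> - 1) * \<rho> x t powr (\<gamma> - 1)"
      using S[rule_format, OF t, of x] by blast
    then show ?thesis using assms(4) by simp
  qed
  \<comment> \<open>Nonemptiness of \<Omega> is read off from \<open>e0\<close> not vanishing
    identically there.\<close>
  obtain x0 where "x0 \<in> \<Omega>" using assms(15) by blast
  then obtain a where a: "a > 0" "cball x0 a \<subseteq> \<Omega>"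
    using assms(6) open_contains_cball by blast
  have "bounded {x. \<rho>0 x \<noteq> 0}"
    using bounded_subset[OF bounded_closure[OF assms(7)], of "{x. \<rho>0 x \<noteq> 0}"]
      closure_subset[of "{x. \<rho>0 x \<noteq> 0}"] assms(12) by simp
  then obtain B where B: "\<And>x. \<rho>0 x \<noteq> 0 \<Longrightarrow> norm x \<le> B" by (auto simp: bounded_iff)
  \<comment> \<open>Any axis will do. With norm |B| + 2 the unit ball around \<open>xc\<close> stays
    at norm at least |B| + 1, where the initial density vanishes.\<close>
  define xc :: "real^'n" where "xc = (\<bar>B\<bar> + 2) *\<^sub>R axis undefined 1"
  have nxc: "norm xc = \<bar>B\<bar> + 2" by (simp add: xc_def norm_axis_1)
  have vac: "\<rho> x 0 = 0" if "x \<in> cball xc 1" for x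
  proof (rule ccontr)
    assume "\<rho> x 0 \<noteq> 0"
    then have "norm x \<le> B" using B[of x] ini by simp
    moreover have "norm xc \<le> norm x + dist xc x" using norm_triangle_sub[of xc x] by (simp add: dist_norm)
    ultimately show False using that nxc by simp
  qed
  show False
    by (rule no_finite_entropy_solution[OF assms(1-5,16,17) NS C1(1) _ C1(3) c e0 ez a(1) _ vac])
       (use C1(2) a(2) assms(13) ini in auto)
qed

end
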